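(* Assume that, for some $L$ slowly varying at $+\infty$, $\rho(t)\sim tL(t)$ as $t\to\infty$. (I) For each $j\ge2$, $$\limsup_{t\to\infty}\frac{K^*_j(t)-\mathbb{E}K^*_j(t)}{(\mathrm{Var}\,K^*_j(t)\,\log\log \mathrm{Var}\,K^*_j(t))^{1/2}}=2^{1/2}\quad\text{a.s.},$$ $$\mathbb{E}K^*_j(t)\sim\frac{1}{j(j-1)}tL(t),\quad t\to\infty,\qquad\text{and}\qquad \lim_{t\to\infty}\frac{\mathrm{Var}\,K^*_j(t)}{tL(t)}=\frac{1}{j(j-1)}-\frac{(2j-2)!}{2^{2j-1}(j!)^2}.$$ (II) The function $\hat L(t):=\int_t^\infty y^{-1}L(y)\,\mathrm{d}y$ is well-defined for large $t$, slowly varying at $\infty$ and satisfies $\lim_{t\to\infty}L(t)/\hat L(t)=0$. If, for each small enough $\gamma>0$, $$\lim_{n\to\infty}\frac{\hat L(\exp((n+1)^{1+\gamma}))}{\hat L(\exp(n^{1+\gamma}))}=0,\qquad(\ast)$$ then $$\limsup_{t\to\infty}\frac{K^*_1(t)-\mathbb{E}K^*_1(t)}{(\mathrm{Var}\,K^*_1(t)\,\log\log \mathrm{Var}\,K^*_1(t))^{1/2}}=2^{1/2}\quad\text{a.s.}$$ If it is not the case that $(\ast)$ holds for each small enough $\gamma>0$, then $$\limsup_{t\to\infty}\frac{K^*_1(t)-\mathbb{E}K^*_1(t)}{(\mathrm{Var}\,K^*_1(t)\,\log\log \mathrm{Var}\,K^*_1(t))^{1/2}}\le2^{1/2}\quad\text{a.s.}$$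 and $$\liminf_{t\to\infty}\frac{K^*_1(t)-\mathbb{E}K^*_1(t)}{(\mathrm{Var}\,K^*_1(t)\,\log\log \mathrm{Var}\,K^*_1(t))^{1/2}}\ge-2^{1/2}\quad\text{a.s.}$$ In any event, $\mathrm{Var}\,K^*_1(t)\sim\mathbb{E}K^*_1(t)\sim t\hat L(t)$ as $t\to\infty$.
   Context: Let $(p_k)_{k\in\mathbb{N}}$ be a discrete probability distribution with $p_k>0$ for infinitely many $k$, and put $\rho(t):=\#\{k\in\mathbb{N}:1/p_k\le t\}$ for $t>0$. Poissonized Karlin occupancy scheme: balls are thrown at the arrival times $S_1<S_2<\dots$ of a unit-intensity Poisson process on $[0,\infty)$, and, independently of the arrival times, each ball falls independently into box $k$ with probability $p_k$, $k\in\mathbb{N}$. Equivalently, letting $\pi_k(t)$ be the number of balls in box $k$ at time $t$, the processes $(\pi_k(t))_{t\ge0}$, $k\in\mathbb{N}$, are independent Poisson processes with intensities $p_k$. For $j\in\mathbb{N}$ and $t\ge0$, $K^*_j(t):=\sum_{k\ge1}\mathbf{1}_{\{\pi_k(t)=j\}}$ is the number of boxes containing exactly $j$ balls at time $t$. The notation $f(t)\sim g(t)$ means $f(t)/g(t)\to1$. Slowly varying functions are positive and measurable. *)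

theory Defs
  imports "HOL-Probability.Probability" "HOL-Library.Landau_Symbols"
begin

text \<open>
  A slowly varying function only has to be defined (positive, Lebesgue measurable) on some
  half-line; its values outside that half-line are irrelevant.
\<close>

definition slowly_varying :: "(real \<Rightarrow> real) \<Rightarrow> bool" where
  "slowly_varying L \<longleftrightarrow>
     (\<exists>a. L \<in> borel_measurable (lebesgue_on {a..}) \<and> (\<forall>t\<ge>a. L t > 0)) \<and>
     (\<forall>c>0. ((\<lambda>t. L (c * t) / L t) \<longlongrightarrow> 1) at_top)"

definition L_hat :: "(real \<Rightarrow> real) \<Rightarrow> real \<Rightarrow> real" where
  "L_hat L t = (LINT y:{t..}|lebesgue. L y / y)"

definition star_condition :: "(real \<Rightarrow> real) \<Rightarrow> real \<Rightarrow> bool" where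
  "star_condition L \<gamma> \<longleftrightarrow>
     (\<lambda>n::nat. L_hat L (exp (real (n + 1) powr (1 + \<gamma>))) / L_hat L (exp (real n powr (1 + \<gamma>))))
       \<longlonglongrightarrow> 0"

text \<open>
  Boxes of probability zero are never counted (1/0 stands for infinity), hence the restriction to
  the support.
\<close>

definition \<rho> :: "nat pmf \<Rightarrow> real \<Rightarrow> nat" where
  "\<rho> p t = card {k \<in> set_pmf p. 1 / pmf p k \<le> t}"

text \<open>
  Arrival times of a Poisson process of constant intensity: the numbers of arrivals in successive
  intervals are independent and Poisson distributed. The first arrival has index 0.
\<close>

definition (in prob_space) poisson_arrivals :: "real \<Rightarrow> (nat \<Rightarrow> 'a \<Rightarrow> real) \<Rightarrow> bool" where
  "poisson_arrivals r S \<longleftrightarrow>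
     (\<forall>n. random_variable borel (S n)) \<and>
     (AE \<omega> in M. 0 < S 0 \<omega> \<and> strict_mono (\<lambda>n. S n \<omega>) \<and>
                filterlim (\<lambda>n. S n \<omega>) at_top sequentially) \<and>
     (\<forall>s t. 0 \<le> s \<longrightarrow> s < t \<longrightarrow>
        distr M (count_space UNIV) (\<lambda>\<omega>. card {n. S n \<omega> \<in> {s<..t}})
          = measure_pmf (poisson_pmf (r * (t - s)))) \<and>
     (\<forall>\<tau>::nat \<Rightarrow> real. 0 \<le> \<tau> 0 \<longrightarrow> strict_mono \<tau> \<longrightarrow>
        indep_vars (\<lambda>_. count_space UNIV)
          (\<lambda>i \<omega>. card {n. S n \<omega> \<in> {\<tau> i<..\<tau> (Suc i)}}) UNIV)"

text \<open>
  Poissonized Karlin scheme: the ball arriving at time \<open>S n\<close> falls into box \<open>X n\<close>.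
\<close>

locale poissonized_karlin_scheme = prob_space M
  for M :: "'a measure" +
  fixes p :: "nat pmf" and S :: "nat \<Rightarrow> 'a \<Rightarrow> real" and X :: "nat \<Rightarrow> 'a \<Rightarrow> nat"
  assumes infinite_support: "infinite (set_pmf p)"
    and arrivals: "poisson_arrivals 1 S"
    and box_distr: "distr M (count_space UNIV) (X n) = measure_pmf p"
    and boxes_indep: "indep_vars (\<lambda>_. count_space UNIV) X UNIV"
    and arrivals_boxes_indep:
      "indep_var (\<Pi>\<^sub>M n\<in>UNIV. borel) (\<lambda>\<omega> n. S n \<omega>)
                 (\<Pi>\<^sub>M n\<in>UNIV. count_space UNIV) (\<lambda>\<omega> n. X n \<omega>)"

definition balls_in_box ::
  "(nat \<Rightarrow> 'a \<Rightarrow> real) \<Rightarrow> (nat \<Rightarrow> 'a \<Rightarrow> nat) \<Rightarrow> nat \<Rightarrow> real \<Rightarrow> 'a \<Rightarrow> nat" where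
  "balls_in_box S X k t \<omega> = card {n. S n \<omega> \<le> t \<and> X n \<omega> = k}"

definition K_star ::
  "(nat \<Rightarrow> 'a \<Rightarrow> real) \<Rightarrow> (nat \<Rightarrow> 'a \<Rightarrow> nat) \<Rightarrow> nat \<Rightarrow> real \<Rightarrow> 'a \<Rightarrow> real" where
  "K_star S X j t \<omega> = real (card {k. balls_in_box S X k t \<omega> = j})"

definition lil_ratio :: "'a measure \<Rightarrow> (real \<Rightarrow> 'a \<Rightarrow> real) \<Rightarrow> real \<Rightarrow> 'a \<Rightarrow> real" where
  "lil_ratio M Y t \<omega> =
     (Y t \<omega> - prob_space.expectation M (Y t)) /
       sqrt (prob_space.variance M (Y t) * ln (ln (prob_space.variance M (Y t))))"

end

theory Submission
  imports Defs "HOL-Real_Asymp.Real_Asymp"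
begin

text \<open>
  The occupancy processes of the boxes are independent Poisson processes, so \<open>K_star\<close> and the
  increments of the numbers of boxes with at least \<open>i\<close> balls are sums of independent Bernoulli
  variables. Chernoff bounds give sharp upper estimates for their tails, exponential tilting gives
  matching lower ones. The means and variances are sums \<open>\<Sum>k. f (t * p k)\<close>; written as
  integrals of \<open>f'\<close> against \<open>\<rho> (t / x)\<close>, they are evaluated by dominated convergence,
  where the monotonicity of \<open>\<rho>\<close> makes a Potter bound elementary.

  For the upper half of the law, the Chernoff bound is applied along \<open>(1 + \<delta>) ^ n\<close>. Between
  these times the count with exactly \<open>j\<close> balls is the difference of two monotone processes
  (at least \<open>j\<close> and at least \<open>j + 1\<close> balls), whose oscillation is controlled by chaining.

  For the lower half, times \<open>t n\<close> are chosen so sparse that almost all the variance at time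
  \<open>t n\<close> stems from a block of boxes, with disjoint blocks for different \<open>n\<close>; the second
  Borel-Cantelli lemma applies. For \<open>j \<ge> 2\<close> the boxes with \<open>p k * t\<close> of order one
  dominate and a geometric sequence of large ratio suffices. For \<open>j = 1\<close> all boxes with
  \<open>p k * t \<le> 1\<close> contribute, and the sequence \<open>exp (n powr (1 + \<gamma>))\<close> has the required
  property precisely under the star condition; since \<open>ln (ln (t n)) = (1 + \<gamma>) * ln n\<close>, the
  constant obtained is \<open>sqrt (2 / (1 + \<gamma>))\<close>, and \<open>\<gamma>\<close> tends to zero.
\<close>

section \<open>Sums of independent Bernoulli variables\<close>

text \<open>The constant \<open>sqrt 2\<close> tolerates no constant factor lost in an exponent. The
  exponential estimates are sharp enough because the relevant \<theta> is of order
  \<open>sqrt (ln (ln V) / V)\<close> and tends to zero: corrections such as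
  \<open>1 + 2 * \<theta>\<close> vanish in the limit, and no normal approximation enters. L need be
  neither monotone nor locally bounded. Hence everything before the last section is normalised by
  \<rho>, whose regular variation is all that L contributes, or by \<open>U\<close> in the case of
  one ball; L returns only through the quotients of \<rho> by \<open>t * L t\<close> and of
  \<open>L_hat L\<close> by \<open>U\<close>, both tending to 1. The cases differ in the size of the
  variance: it is comparable to \<rho> for j \<ge> 2, but to \<open>t * U t\<close>, which is of
  larger order, for j = 1. The upper half uses only three facts common to both: the variance exceeds
  a power of t, it bounds the mean numbers of boxes with j and with j + 1 balls up to a constant,
  and it is almost increasing. Its deviation bounds are two-sided, so the lower limit is bounded
  along with the upper one.\<close>

lemma exp_le_quadratic:
  fixes x :: real
  shows "exp x \<le> 1 + x + x\<^sup>2 / 2 * exp \<bar>x\<bar>"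
proof -
  obtain t where t: "\<bar>t\<bar> \<le> \<bar>x\<bar>" "exp x = (\<Sum>m<2. x ^ m / fact m) + exp t / fact 2 * x ^ 2"
    using Maclaurin_exp_le[of x 2] by blast
  have "exp t * x\<^sup>2 \<le> exp \<bar>x\<bar> * x\<^sup>2"
    using t(1) by (intro mult_right_mono) auto
  then show ?thesis
    using t(2) by (simp add: numeral_2_eq_2 algebra_simps)
qed

lemma exp_ge_quadratic:
  fixes x :: real
  shows "1 + x + x\<^sup>2 / 2 * exp (- \<bar>x\<bar>) \<le> exp x"
proof -
  obtain t where t: "\<bar>t\<bar> \<le> \<bar>x\<bar>" "exp x = (\<Sum>m<2. x ^ m / fact m) + exp t / fact 2 * x ^ 2"
    using Maclaurin_exp_le[of x 2] by blast
  have "exp (- \<bar>x\<bar>) * x\<^sup>2 \<le> exp t * x\<^sup>2"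
    using t(1) by (intro mult_right_mono) auto
  then show ?thesis
    using t(2) by (simp add: numeral_2_eq_2 algebra_simps)
qed

text \<open>The moment generating function of the centred variable: centring cancels the term linear
  in \<theta>, which leaves the variance \<open>q * (1 - q)\<close> as leading coefficient.\<close>

definition bernoulli_mgf :: "real \<Rightarrow> real \<Rightarrow> real" where
  "bernoulli_mgf q \<theta> = q * exp (\<theta> * (1 - q)) + (1 - q) * exp (- \<theta> * q)"

text \<open>Both values of the centred variable have modulus at most 1, so that one remainder factor
  \<open>exp \<bar>\<theta>\<bar>\<close> serves both exponentials; their average has the form
  \<open>1 + y \<le> exp y\<close>.\<close>

lemma bernoulli_mgf_upper:
  assumes "0 \<le> q" "q \<le> 1"
  shows "bernoulli_mgf q \<theta> \<le> exp (q * (1 - q) * (\<theta>\<^sup>2 / 2 * exp \<bar>\<theta>\<bar>))"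
proof -
  have mono: "exp x \<le> 1 + x + x\<^sup>2 / 2 * exp \<bar>\<theta>\<bar>" if "\<bar>x\<bar> \<le> \<bar>\<theta>\<bar>" for x :: real
  proof -
    have "x\<^sup>2 / 2 * exp \<bar>x\<bar> \<le> x\<^sup>2 / 2 * exp \<bar>\<theta>\<bar>" using that by (intro mult_left_mono) auto
    then show ?thesis using exp_le_quadratic[of x] by linarith
  qed
  have a: "\<bar>\<theta> * (1 - q)\<bar> \<le> \<bar>\<theta>\<bar>" "\<bar>- \<theta> * q\<bar> \<le> \<bar>\<theta>\<bar>"
    using assms by (auto simp: abs_mult mult_left_le)
  have "bernoulli_mgf q \<theta> \<le> q * (1 + \<theta> * (1 - q) + (\<theta> * (1 - q))\<^sup>2 / 2 * exp \<bar>\<theta>\<bar>)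
      + (1 - q) * (1 + - \<theta> * q + (- \<theta> * q)\<^sup>2 / 2 * exp \<bar>\<theta>\<bar>)"
    unfolding bernoulli_mgf_def using assms a
    by (intro add_mono mult_left_mono mono) auto
  also have "\<dots> = 1 + q * (1 - q) * (\<theta>\<^sup>2 / 2 * exp \<bar>\<theta>\<bar>)"
    by (simp add: field_simps power2_eq_square)
  also have "\<dots> \<le> exp (q * (1 - q) * (\<theta>\<^sup>2 / 2 * exp \<bar>\<theta>\<bar>))"
    by (rule exp_ge_add_one_self)
  finally show ?thesis .
qed

lemma bernoulli_mgf_lower:
  assumes "0 \<le> q" "q \<le> 1" "\<bar>\<theta>\<bar> \<le> 1"
  shows "exp (q * (1 - q) * (\<theta>\<^sup>2 / 2 * (1 - 2 * \<bar>\<theta>\<bar>))) \<le> bernoulli_mgf q \<theta>"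
proof -
  have mono: "1 + x + x\<^sup>2 / 2 * exp (- \<bar>\<theta>\<bar>) \<le> exp x" if "\<bar>x\<bar> \<le> \<bar>\<theta>\<bar>" for x :: real
  proof -
    have "x\<^sup>2 / 2 * exp (- \<bar>\<theta>\<bar>) \<le> x\<^sup>2 / 2 * exp (- \<bar>x\<bar>)" using that by (intro mult_left_mono) auto
    then show ?thesis using exp_ge_quadratic[of x] by linarith
  qed
  have a: "\<bar>\<theta> * (1 - q)\<bar> \<le> \<bar>\<theta>\<bar>" "\<bar>- \<theta> * q\<bar> \<le> \<bar>\<theta>\<bar>"
    using assms by (auto simp: abs_mult mult_left_le)
  define u where "u = q * (1 - q) * (\<theta>\<^sup>2 / 2)"
  define y where "y = u * exp (- \<bar>\<theta>\<bar>)"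
  have u0: "0 \<le> u" unfolding u_def using assms by auto
  have y0: "0 \<le> y" unfolding y_def using u0 by auto
  have q1: "q * (1 - q) \<le> 1" using assms by (intro mult_le_one) auto
  have t2: "\<theta>\<^sup>2 \<le> \<bar>\<theta>\<bar>"
    using mult_left_le[of "\<bar>\<theta>\<bar>" "\<bar>\<theta>\<bar>"] assms(3) by (simp add: power2_eq_square)
  have "u \<le> 1 * (\<theta>\<^sup>2 / 2)" unfolding u_def using q1 by (intro mult_right_mono) auto
  then have ut: "u \<le> \<bar>\<theta>\<bar>" using t2 by (auto intro: order_trans[of _ "\<theta>\<^sup>2"])
  have yu: "y \<le> u" unfolding y_def using u0 by (intro mult_left_le) auto
  \<comment> \<open>One factor \<open>1 - \<bar>\<theta>\<bar>\<close> is lost in replacing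
    \<open>exp (- \<bar>\<theta>\<bar>)\<close>, the other in
    \<open>ln (1 + y) \<ge> y * (1 - y)\<close> with \<open>y \<le> \<bar>\<theta>\<bar>\<close>;
    their product is at least \<open>1 - 2 * \<bar>\<theta>\<bar>\<close>.\<close>
  have "(u * (1 - \<bar>\<theta>\<bar>)) * (1 - \<bar>\<theta>\<bar>) \<le> y * (1 - y)"
  proof (intro mult_mono)
    show "u * (1 - \<bar>\<theta>\<bar>) \<le> y" unfolding y_def
      using u0 exp_ge_add_one_self[of "- \<bar>\<theta>\<bar>"] by (intro mult_left_mono) auto
  qed (use ut yu y0 assms in auto)
  moreover have "u * (1 - 2 * \<bar>\<theta>\<bar>) \<le> (u * (1 - \<bar>\<theta>\<bar>)) * (1 - \<bar>\<theta>\<bar>)"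
  proof -
    have "u * (1 - 2 * \<bar>\<theta>\<bar>) \<le> u * ((1 - \<bar>\<theta>\<bar>) * (1 - \<bar>\<theta>\<bar>))"
      by (intro mult_left_mono u0) (simp add: algebra_simps)
    then show ?thesis by (simp add: mult.assoc)
  qed
  ultimately have "u * (1 - 2 * \<bar>\<theta>\<bar>) \<le> y - y\<^sup>2" by (simp add: algebra_simps power2_eq_square)
  also have "\<dots> \<le> ln (1 + y)"
    using y0 yu ut assms(3) by (intro ln_one_plus_pos_lower_bound) auto
  finally have "exp (u * (1 - 2 * \<bar>\<theta>\<bar>)) \<le> 1 + y"
    using y0 by (metis add_pos_nonneg exp_le_cancel_iff exp_ln zero_less_one)
  also have "1 + y = q * (1 + \<theta> * (1 - q) + (\<theta> * (1 - q))\<^sup>2 / 2 * exp (- \<bar>\<theta>\<bar>))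
      + (1 - q) * (1 + - \<theta> * q + (- \<theta> * q)\<^sup>2 / 2 * exp (- \<bar>\<theta>\<bar>))"
    unfolding y_def u_def by (simp add: field_simps power2_eq_square)
  also have "\<dots> \<le> bernoulli_mgf q \<theta>"
    unfolding bernoulli_mgf_def using assms a
    by (intro add_mono mult_left_mono mono) auto
  finally show ?thesis by (simp add: u_def mult.assoc)
qed

text \<open>The common frame of all deviation bounds: \<open>B k\<close> will say that box k holds
  exactly j balls, that it does so and belongs to a given set of boxes, or that it reaches level i
  between two times.\<close>

locale bernoulli_family = prob_space M for M :: "'a measure" +
  fixes B :: "nat \<Rightarrow> 'a \<Rightarrow> bool"
  assumes indep: "indep_vars (\<lambda>_. count_space UNIV) B UNIV"
    and summable_prob: "summable (\<lambda>k. prob {\<omega> \<in> space M. B k \<omega>})"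
begin

definition q :: "nat \<Rightarrow> real" where "q k = prob {\<omega> \<in> space M. B k \<omega>}"
text \<open>Where infinitely many events occur, \<open>card\<close> returns 0; by
  \<open>AE_finite\<close> this concerns a null set only.\<close>

definition occ :: "'a \<Rightarrow> real" where "occ \<omega> = real (card {k. B k \<omega>})"
definition psum :: "nat \<Rightarrow> 'a \<Rightarrow> real" where "psum n \<omega> = (\<Sum>k<n. of_bool (B k \<omega>))"
definition occ_mean :: real where "occ_mean = (\<Sum>k. q k)"
definition occ_var :: real where "occ_var = (\<Sum>k. q k * (1 - q k))"

lemma B_measurable [measurable]: "Measurable.pred M (B k)"
  using indep by (auto simp: indep_vars_def)

lemma q_bounds: "0 \<le> q k" "q k \<le> 1"
  by (auto simp: q_def)

lemma summable_q: "summable q"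
  using summable_prob by (simp add: q_def[abs_def])

lemma summable_qv: "summable (\<lambda>k. q k * (1 - q k))"
  by (rule summable_comparison_test'[OF summable_q, of 0]) (auto simp: q_bounds mult_left_le)

lemma occ_measurable [measurable]: "occ \<in> borel_measurable M"
  unfolding occ_def by measurable

lemma psum_measurable [measurable]: "psum n \<in> borel_measurable M"
  unfolding psum_def by measurable

lemma expectation_B:
  fixes f :: "bool \<Rightarrow> real"
  shows "integrable M (\<lambda>\<omega>. f (B k \<omega>))"
    and "expectation (\<lambda>\<omega>. f (B k \<omega>)) = q k * f True + (1 - q k) * f False"
proof -
  have eq: "f (B k \<omega>) = f False + (f True - f False) * indicator {\<omega> \<in> space M. B k \<omega>} \<omega>"
    if "\<omega> \<in> space M" for \<omega>
    using that by (auto simp: indicator_def)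
  have int: "integrable M (\<lambda>\<omega>. f False + (f True - f False) * indicator {\<omega> \<in> space M. B k \<omega>} \<omega>)"
    by (auto simp: emeasure_eq_measure)
  then show "integrable M (\<lambda>\<omega>. f (B k \<omega>))"
    by (subst Bochner_Integration.integrable_cong[OF refl eq]) simp_all
  have "expectation (\<lambda>\<omega>. f (B k \<omega>)) =
      expectation (\<lambda>\<omega>. f False + (f True - f False) * indicator {\<omega> \<in> space M. B k \<omega>} \<omega>)"
    by (intro Bochner_Integration.integral_cong refl eq)
  also have "\<dots> = f False + (f True - f False) * q k"
    by (subst Bochner_Integration.integral_add) (auto simp: q_def prob_space emeasure_eq_measure)
  finally show "expectation (\<lambda>\<omega>. f (B k \<omega>)) = q k * f True + (1 - q k) * f False"
    by (simp add: algebra_simps)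
qed

lemma indep_fun:
  fixes f :: "nat \<Rightarrow> bool \<Rightarrow> real"
  shows "indep_vars (\<lambda>_. borel) (\<lambda>k \<omega>. f k (B k \<omega>)) A"
  by (rule indep_vars_subset[OF indep_vars_compose2[OF indep]]) auto

lemma mgf_psum:
  "integrable M (\<lambda>\<omega>. exp (\<theta> * (psum n \<omega> - (\<Sum>k<n. q k))))"
  "expectation (\<lambda>\<omega>. exp (\<theta> * (psum n \<omega> - (\<Sum>k<n. q k)))) = (\<Prod>k<n. bernoulli_mgf (q k) \<theta>)"
proof -
  have eq: "exp (\<theta> * (psum n \<omega> - (\<Sum>k<n. q k))) = (\<Prod>k<n. exp (\<theta> * (of_bool (B k \<omega>) - q k)))" for \<omega>
    by (simp add: psum_def exp_sum[symmetric] sum_distrib_left[symmetric] sum_subtractf)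
  have ind: "indep_vars (\<lambda>_. borel) (\<lambda>k \<omega>. exp (\<theta> * (of_bool (B k \<omega>) - q k))) {..<n}"
    by (rule indep_fun[of "\<lambda>k b. exp (\<theta> * (of_bool b - q k))"])
  have int: "integrable M (\<lambda>\<omega>. exp (\<theta> * (of_bool (B k \<omega>) - q k)))" for k
    by (rule expectation_B[of "\<lambda>b. exp (\<theta> * (of_bool b - q k))"])
  show "integrable M (\<lambda>\<omega>. exp (\<theta> * (psum n \<omega> - (\<Sum>k<n. q k))))"
    unfolding eq by (rule indep_vars_integrable[OF _ ind int]) auto
  have "expectation (\<lambda>\<omega>. exp (\<theta> * (psum n \<omega> - (\<Sum>k<n. q k)))) =
      (\<Prod>k<n. expectation (\<lambda>\<omega>. exp (\<theta> * (of_bool (B k \<omega>) - q k))))"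
    unfolding eq by (rule indep_vars_lebesgue_integral[OF _ ind int]) auto
  also have "\<dots> = (\<Prod>k<n. bernoulli_mgf (q k) \<theta>)"
    by (intro prod.cong refl, subst expectation_B(2)[of "\<lambda>b. exp (\<theta> * (of_bool b - q k))" for k])
       (simp add: bernoulli_mgf_def)
  finally show "expectation (\<lambda>\<omega>. exp (\<theta> * (psum n \<omega> - (\<Sum>k<n. q k)))) = (\<Prod>k<n. bernoulli_mgf (q k) \<theta>)" .
qed

lemma bernoulli_mgf_nonneg: "0 \<le> bernoulli_mgf (q k) \<theta>"
  unfolding bernoulli_mgf_def using q_bounds[of k] by auto

lemma mgf_psum_upper:
  "expectation (\<lambda>\<omega>. exp (\<theta> * (psum n \<omega> - (\<Sum>k<n. q k))))
     \<le> exp ((\<Sum>k<n. q k * (1 - q k)) * (\<theta>\<^sup>2 / 2 * exp \<bar>\<theta>\<bar>))"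
  unfolding mgf_psum(2) sum_distrib_right exp_sum[OF finite_lessThan]
  by (intro prod_mono conjI bernoulli_mgf_upper bernoulli_mgf_nonneg q_bounds)

lemma mgf_psum_lower:
  assumes "\<bar>\<theta>\<bar> \<le> 1"
  shows "exp ((\<Sum>k<n. q k * (1 - q k)) * (\<theta>\<^sup>2 / 2 * (1 - 2 * \<bar>\<theta>\<bar>)))
     \<le> expectation (\<lambda>\<omega>. exp (\<theta> * (psum n \<omega> - (\<Sum>k<n. q k))))"
  unfolding mgf_psum(2) sum_distrib_right exp_sum[OF finite_lessThan] using assms
  by (intro prod_mono conjI bernoulli_mgf_lower q_bounds) auto

lemma variance_psum:
  "integrable M (psum n)" "integrable M (\<lambda>\<omega>. (psum n \<omega>)\<^sup>2)"
  "expectation (psum n) = (\<Sum>k<n. q k)"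
  "expectation (\<lambda>\<omega>. (psum n \<omega>)\<^sup>2) = (\<Sum>k<n. q k * (1 - q k)) + (\<Sum>k<n. q k)\<^sup>2"
proof -
  have bnd: "\<bar>psum n \<omega>\<bar> \<le> real n" for n \<omega>
    using sum_mono[of "{..<n}" "\<lambda>k. of_bool (B k \<omega>)" "\<lambda>_. 1::real"]
    by (auto simp: psum_def sum_nonneg)
  have int1: "integrable M (psum n)" for n
    by (rule integrable_const_bound[where B="real n"]) (use bnd in auto)
  have int2: "integrable M (\<lambda>\<omega>. (psum n \<omega>)\<^sup>2)" for n
    by (rule integrable_const_bound[where B="(real n)\<^sup>2"])
       (use bnd[of n] in \<open>auto simp: abs_le_square_iff[symmetric]\<close>)
  have ex: "expectation (psum n) = (\<Sum>k<n. q k)" for n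
    unfolding psum_def using expectation_B[of of_bool] by (subst Bochner_Integration.integral_sum) auto
  have "expectation (\<lambda>\<omega>. (psum n \<omega>)\<^sup>2) = (\<Sum>k<n. q k * (1 - q k)) + (\<Sum>k<n. q k)\<^sup>2"
  proof (induction n)
    case 0 then show ?case by (simp add: psum_def)
  next
    case (Suc n)
    have ind: "indep_var borel (\<lambda>\<omega>. of_bool (B n \<omega>) :: real) borel (psum n)"
      unfolding psum_def by (rule indep_vars_sum[OF _ _ indep_fun[of "\<lambda>_. of_bool"]]) auto
    have i1: "integrable M (\<lambda>\<omega>. of_bool (B n \<omega>) :: real)" by (rule expectation_B[of of_bool])
    have e1: "expectation (\<lambda>\<omega>. of_bool (B n \<omega>) :: real) = q n" using expectation_B(2)[of of_bool] by simp
    have cross: "integrable M (\<lambda>\<omega>. of_bool (B n \<omega>) * psum n \<omega>)"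
      "expectation (\<lambda>\<omega>. of_bool (B n \<omega>) * psum n \<omega>) = q n * (\<Sum>k<n. q k)"
      using indep_var_integrable[OF ind i1 int1] indep_var_lebesgue_integral[OF ind i1 int1]
      by (simp_all add: e1 ex)
    have "(\<lambda>\<omega>. (psum (Suc n) \<omega>)\<^sup>2) =
        (\<lambda>\<omega>. (psum n \<omega>)\<^sup>2 + (2 * (of_bool (B n \<omega>) * psum n \<omega>) + of_bool (B n \<omega>)))"
      by (auto simp: psum_def power2_eq_square algebra_simps)
    then have "expectation (\<lambda>\<omega>. (psum (Suc n) \<omega>)\<^sup>2) = expectation (\<lambda>\<omega>. (psum n \<omega>)\<^sup>2)
        + (2 * (q n * (\<Sum>k<n. q k)) + q n)"
      using int2 cross i1 e1 by simp
    then show ?case using Suc by (simp add: power2_eq_square algebra_simps)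
  qed
  then show "integrable M (psum n)" "integrable M (\<lambda>\<omega>. (psum n \<omega>)\<^sup>2)"
    "expectation (psum n) = (\<Sum>k<n. q k)"
    "expectation (\<lambda>\<omega>. (psum n \<omega>)\<^sup>2) = (\<Sum>k<n. q k * (1 - q k)) + (\<Sum>k<n. q k)\<^sup>2"
    using int1 int2 ex by auto
qed

lemma AE_finite: "AE \<omega> in M. finite {k. B k \<omega>}"
proof -
  have "AE \<omega> in M. \<forall>\<^sub>F k in sequentially. \<omega> \<in> space M - {\<omega> \<in> space M. B k \<omega>}"
    by (rule borel_cantelli_AE1) (use summable_prob in \<open>auto simp: emeasure_eq_measure\<close>)
  then show ?thesis
  proof (rule AE_mp, intro AE_I2 impI)
    fix \<omega> assume w: "\<omega> \<in> space M" "\<forall>\<^sub>F k in sequentially. \<omega> \<in> space M - {\<omega> \<in> space M. B k \<omega>}"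
    then obtain N where "\<And>k. k \<ge> N \<Longrightarrow> \<not> B k \<omega>" by (auto simp: eventually_sequentially)
    then have "{k. B k \<omega>} \<subseteq> {..<N}" by (auto simp: not_less[symmetric])
    then show "finite {k. B k \<omega>}" by (rule finite_subset) auto
  qed
qed

lemma psum_eventually_eq:
  assumes "finite {k. B k \<omega>}"
  shows "\<forall>\<^sub>F n in sequentially. psum n \<omega> = occ \<omega>"
proof -
  obtain N where N: "{k. B k \<omega>} \<subseteq> {..<N}" using finite_nat_bounded[OF assms] by auto
  have "psum n \<omega> = occ \<omega>" if "n \<ge> N" for n
  proof -
    have "{..<n} \<inter> {k. B k \<omega>} = {k. B k \<omega>}" using N that by fastforce
    then show ?thesis by (simp add: psum_def occ_def of_bool_def sum.If_cases)
  qed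
  then show ?thesis by (auto simp: eventually_sequentially)
qed

lemma AE_psum_tendsto: "AE \<omega> in M. (\<lambda>n. psum n \<omega>) \<longlonglongrightarrow> occ \<omega>"
  using AE_finite by eventually_elim (rule tendsto_eventually[OF psum_eventually_eq])

lemma mono_psum: "mono (\<lambda>n. psum n \<omega>)"
  by (rule incseq_SucI) (auto simp: psum_def)

lemma psum_nonneg: "0 \<le> psum n \<omega>"
  by (simp add: psum_def sum_nonneg)

lemma
  shows expectation_occ: "expectation occ = occ_mean"
    and variance_occ: "variance occ = occ_var"
proof -
  have m: "(\<lambda>n. \<Sum>k<n. q k) \<longlonglongrightarrow> occ_mean"
    unfolding occ_mean_def by (rule summable_LIMSEQ[OF summable_q])
  have v: "(\<lambda>n. \<Sum>k<n. q k * (1 - q k)) \<longlonglongrightarrow> occ_var"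
    unfolding occ_var_def by (rule summable_LIMSEQ[OF summable_qv])
  have 1: "has_bochner_integral M occ occ_mean"
    by (rule has_bochner_integral_monotone_convergence[where f=psum])
       (use m AE_psum_tendsto mono_psum in \<open>auto simp: variance_psum\<close>)
  have 2: "has_bochner_integral M (\<lambda>\<omega>. (occ \<omega>)\<^sup>2) (occ_var + occ_mean\<^sup>2)"
  proof (rule has_bochner_integral_monotone_convergence[where f="\<lambda>n \<omega>. (psum n \<omega>)\<^sup>2"])
    show "AE \<omega> in M. mono (\<lambda>n. (psum n \<omega>)\<^sup>2)"
      by (auto intro!: AE_I2 monoI power_mono psum_nonneg monoD[OF mono_psum])
    show "AE \<omega> in M. (\<lambda>n. (psum n \<omega>)\<^sup>2) \<longlonglongrightarrow> (occ \<omega>)\<^sup>2"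
      using AE_psum_tendsto by eventually_elim (rule tendsto_power)
    show "(\<lambda>n. expectation (\<lambda>\<omega>. (psum n \<omega>)\<^sup>2)) \<longlonglongrightarrow> occ_var + occ_mean\<^sup>2"
      unfolding variance_psum(4) by (intro tendsto_intros m v)
  qed (auto simp: variance_psum)
  show "expectation occ = occ_mean"
    using 1 by (auto simp: has_bochner_integral_iff)
  then show "variance occ = occ_var"
    using 1 2 by (subst variance_eq) (auto simp: has_bochner_integral_iff)
qed

text \<open>Fatou's lemma along the partial sums. It carries over upper bounds only; lower tails are
  accordingly stated for finitely many summands.\<close>

lemma mgf_occ_upper:
  "(\<integral>\<^sup>+\<omega>. ennreal (exp (\<theta> * (occ \<omega> - occ_mean))) \<partial>M)
     \<le> ennreal (exp (occ_var * (\<theta>\<^sup>2 / 2 * exp \<bar>\<theta>\<bar>)))"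
proof -
  let ?f = "\<lambda>n \<omega>. ennreal (exp (\<theta> * (psum n \<omega> - (\<Sum>k<n. q k))))"
  have m: "(\<lambda>n. \<Sum>k<n. q k) \<longlonglongrightarrow> occ_mean"
    unfolding occ_mean_def by (rule summable_LIMSEQ[OF summable_q])
  have "(\<integral>\<^sup>+\<omega>. ennreal (exp (\<theta> * (occ \<omega> - occ_mean))) \<partial>M) = (\<integral>\<^sup>+\<omega>. liminf (\<lambda>n. ?f n \<omega>) \<partial>M)"
  proof (intro nn_integral_cong_AE, use AE_psum_tendsto in eventually_elim)
    fix \<omega> assume "(\<lambda>n. psum n \<omega>) \<longlonglongrightarrow> occ \<omega>"
    then have "(\<lambda>n. ?f n \<omega>) \<longlonglongrightarrow> ennreal (exp (\<theta> * (occ \<omega> - occ_mean)))"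
      by (intro tendsto_ennrealI tendsto_intros m)
    then show "ennreal (exp (\<theta> * (occ \<omega> - occ_mean))) = liminf (\<lambda>n. ?f n \<omega>)"
      by (intro lim_imp_Liminf[symmetric]) auto
  qed
  also have "\<dots> \<le> liminf (\<lambda>n. \<integral>\<^sup>+\<omega>. ?f n \<omega> \<partial>M)"
    by (rule nn_integral_liminf) auto
  also have "\<dots> \<le> ennreal (exp (occ_var * (\<theta>\<^sup>2 / 2 * exp \<bar>\<theta>\<bar>)))"
  proof (rule order_trans[OF Liminf_mono[where g="\<lambda>_. ennreal (exp (occ_var * (\<theta>\<^sup>2 / 2 * exp \<bar>\<theta>\<bar>)))"]])
    have "(\<integral>\<^sup>+\<omega>. ?f n \<omega> \<partial>M) \<le> ennreal (exp (occ_var * (\<theta>\<^sup>2 / 2 * exp \<bar>\<theta>\<bar>)))" for n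
    proof -
      have "(\<integral>\<^sup>+\<omega>. ?f n \<omega> \<partial>M) = ennreal (expectation (\<lambda>\<omega>. exp (\<theta> * (psum n \<omega> - (\<Sum>k<n. q k)))))"
        by (rule nn_integral_eq_integral) (auto simp: mgf_psum)
      also have "\<dots> \<le> ennreal (exp ((\<Sum>k<n. q k * (1 - q k)) * (\<theta>\<^sup>2 / 2 * exp \<bar>\<theta>\<bar>)))"
        by (rule ennreal_leI[OF mgf_psum_upper])
      also have "\<dots> \<le> ennreal (exp (occ_var * (\<theta>\<^sup>2 / 2 * exp \<bar>\<theta>\<bar>)))"
        unfolding occ_var_def
        by (intro ennreal_leI, subst exp_le_cancel_iff, intro mult_right_mono sum_le_suminf summable_qv)
           (auto simp: q_bounds)
      finally show ?thesis .
    qed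
    then show "\<forall>\<^sub>F n in sequentially. (\<integral>\<^sup>+\<omega>. ?f n \<omega> \<partial>M) \<le> ennreal (exp (occ_var * (\<theta>\<^sup>2 / 2 * exp \<bar>\<theta>\<bar>)))"
      by simp
  qed (simp add: Liminf_const)
  finally show ?thesis .
qed

lemma occ_var_nonneg: "0 \<le> occ_var"
  unfolding occ_var_def by (intro suminf_nonneg summable_qv) (auto simp: q_bounds)

text \<open>Exponential Markov inequality. The sign of \<theta> is left open so that the two tails
  are two instances, and \<open>exp \<bar>\<theta>\<bar>\<close> is relaxed to
  \<open>1 + 2 * \<bar>\<theta>\<bar>\<close> to keep the exponent polynomial.\<close>

lemma chernoff_one_sided:
  assumes "\<bar>\<theta>\<bar> \<le> 1"
  shows "prob {\<omega> \<in> space M. y \<le> \<theta> * (occ \<omega> - occ_mean)}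
    \<le> exp (- y + occ_var * (\<theta>\<^sup>2 / 2 * (1 + 2 * \<bar>\<theta>\<bar>)))"
proof -
  let ?A = "{\<omega> \<in> space M. y \<le> \<theta> * (occ \<omega> - occ_mean)}"
  have "ennreal (exp y) * emeasure M ?A = (\<integral>\<^sup>+\<omega>. ennreal (exp y) * indicator ?A \<omega> \<partial>M)"
    by (subst nn_integral_cmult_indicator) auto
  also have "\<dots> \<le> (\<integral>\<^sup>+\<omega>. ennreal (exp (\<theta> * (occ \<omega> - occ_mean))) \<partial>M)"
    by (intro nn_integral_mono) (auto simp: indicator_def)
  also have "\<dots> \<le> ennreal (exp (occ_var * (\<theta>\<^sup>2 / 2 * exp \<bar>\<theta>\<bar>)))" by (rule mgf_occ_upper)
  finally have "exp y * prob ?A \<le> exp (occ_var * (\<theta>\<^sup>2 / 2 * exp \<bar>\<theta>\<bar>))"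
    by (simp add: emeasure_eq_measure flip: ennreal_mult)
  then have "exp (- y) * (exp y * prob ?A) \<le> exp (- y) * exp (occ_var * (\<theta>\<^sup>2 / 2 * exp \<bar>\<theta>\<bar>))"
    by (intro mult_left_mono) auto
  then have "prob ?A \<le> exp (- y + occ_var * (\<theta>\<^sup>2 / 2 * exp \<bar>\<theta>\<bar>))"
    by (simp only: mult.assoc[symmetric] exp_add[symmetric]) simp
  also have "\<dots> \<le> exp (- y + occ_var * (\<theta>\<^sup>2 / 2 * (1 + 2 * \<bar>\<theta>\<bar>)))"
  proof -
    have "exp \<bar>\<theta>\<bar> \<le> 1 + \<bar>\<theta>\<bar> + \<bar>\<theta>\<bar>\<^sup>2" using assms by (intro exp_bound) auto
    also have "\<dots> \<le> 1 + 2 * \<bar>\<theta>\<bar>"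
      using mult_left_le[of "\<bar>\<theta>\<bar>" "\<bar>\<theta>\<bar>"] assms by (simp add: power2_eq_square)
    finally show ?thesis using occ_var_nonneg by (auto intro!: mult_left_mono)
  qed
  finally show ?thesis .
qed

lemma chernoff:
  assumes "0 < \<theta>" "\<theta> \<le> 1"
  shows "prob {\<omega> \<in> space M. y \<le> \<bar>occ \<omega> - occ_mean\<bar>}
    \<le> 2 * exp (- \<theta> * y + occ_var * (\<theta>\<^sup>2 / 2 * (1 + 2 * \<theta>)))"
proof -
  let ?A = "\<lambda>s. {\<omega> \<in> space M. \<theta> * y \<le> s * (occ \<omega> - occ_mean)}"
  have sub: "{\<omega> \<in> space M. y \<le> \<bar>occ \<omega> - occ_mean\<bar>} \<subseteq> ?A \<theta> \<union> ?A (- \<theta>)"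
  proof safe
    fix \<omega> assume y: "y \<le> \<bar>occ \<omega> - occ_mean\<bar>" "\<not> \<theta> * y \<le> - \<theta> * (occ \<omega> - occ_mean)"
    have "\<theta> * y \<le> \<theta> * \<bar>occ \<omega> - occ_mean\<bar>"
      using y(1) assms(1) by (intro mult_left_mono) auto
    then show "\<theta> * y \<le> \<theta> * (occ \<omega> - occ_mean)"
      using y(2) by (auto simp: abs_if split: if_splits)
  qed
  have "prob {\<omega> \<in> space M. y \<le> \<bar>occ \<omega> - occ_mean\<bar>} \<le> prob (?A \<theta> \<union> ?A (- \<theta>))"
    by (rule finite_measure_mono[OF sub]) measurable
  also have "\<dots> \<le> prob (?A \<theta>) + prob (?A (- \<theta>))"
    by (rule measure_Un_le) auto
  also have "\<dots> \<le> 2 * exp (- \<theta> * y + occ_var * (\<theta>\<^sup>2 / 2 * (1 + 2 * \<theta>)))"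
    using chernoff_one_sided[of \<theta> "\<theta> * y"] chernoff_one_sided[of "- \<theta>" "\<theta> * y"] assms
    by simp
  finally show ?thesis .
qed


text \<open>
  Under the exponentially tilted law the sum concentrates near \<open>\<theta> * v\<close>: the parts of
  the moment generating function outside \<open>\<bar>s - \<theta> * v\<bar> \<le> \<delta> * \<theta> * v\<close> are
  controlled by its values at \<open>(1 \<plusminus> \<delta>) * \<theta>\<close>.
\<close>

lemma psum_lower_tail:
  fixes n :: nat and \<delta> \<theta> :: real
  defines "v \<equiv> \<Sum>k<n. q k * (1 - q k)"
  assumes d: "0 < \<delta>" "\<delta> \<le> 1" and t: "0 < \<theta>" "\<theta> \<le> \<delta>\<^sup>2 / 40" and big: "8 \<le> \<delta>\<^sup>2 * (\<theta>\<^sup>2 * v)"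
  shows "exp (- (1 + 4 * \<delta>) * (\<theta>\<^sup>2 * v / 2))
    \<le> prob {\<omega> \<in> space M. (1 - \<delta>) * (\<theta> * v) \<le> psum n \<omega> - (\<Sum>k<n. q k)}"
proof -
  define u where "u = \<theta>\<^sup>2 * v / 2"
  define s where "s \<omega> = psum n \<omega> - (\<Sum>k<n. q k)" for \<omega>
  define mgf where "mgf h = expectation (\<lambda>\<omega>. exp (h * s \<omega>))" for h
  define a b where "a = (1 - \<delta>) * (\<theta> * v)" and "b = (1 + \<delta>) * (\<theta> * v)"
  have [measurable]: "s \<in> borel_measurable M" unfolding s_def by measurable
  have d2: "\<delta>\<^sup>2 \<le> 1" using d by (simp add: power_le_one)
  have dd: "\<delta>\<^sup>2 \<le> \<delta>" using d by (simp add: power2_eq_square mult_left_le)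
  have t1: "\<theta> \<le> 1/40" using t d2 by simp
  have int: "integrable M (\<lambda>\<omega>. exp (h * s \<omega>))" for h unfolding s_def by (rule mgf_psum)
  have v0: "0 \<le> v" unfolding v_def by (intro sum_nonneg) (auto simp: q_bounds)
  have u0: "0 \<le> u" unfolding u_def using v0 by auto
  have up: "mgf (c * \<theta>) \<le> exp (u * (c\<^sup>2 * (1 + 2 * (c * \<theta>))))" if "0 \<le> c" "c \<le> 2" for c
  proof -
    have ct: "0 \<le> c * \<theta>" "c * \<theta> \<le> 1" using that t t1 mult_mono[of c 2 \<theta> "1/40"] by auto
    have "exp \<bar>c * \<theta>\<bar> \<le> 1 + c * \<theta> + (c * \<theta>)\<^sup>2" using exp_bound[of "c * \<theta>"] ct by simp
    also have "\<dots> \<le> 1 + 2 * (c * \<theta>)" using mult_left_le[OF ct(2,1)] by (simp add: power2_eq_square mult.commute)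
    finally have e: "exp \<bar>c * \<theta>\<bar> \<le> 1 + 2 * (c * \<theta>)" .
    have "mgf (c * \<theta>) \<le> exp (v * ((c * \<theta>)\<^sup>2 / 2 * exp \<bar>c * \<theta>\<bar>))"
      unfolding mgf_def s_def v_def by (rule mgf_psum_upper)
    also have "\<dots> \<le> exp (v * ((c * \<theta>)\<^sup>2 / 2 * (1 + 2 * (c * \<theta>))))"
      using e v0 by (auto intro!: mult_left_mono)
    also have "v * ((c * \<theta>)\<^sup>2 / 2 * (1 + 2 * (c * \<theta>))) = u * (c\<^sup>2 * (1 + 2 * (c * \<theta>)))"
      by (simp add: u_def power2_eq_square)
    finally show ?thesis .
  qed
  have low: "exp (u * (1 - 2 * \<theta>)) \<le> mgf \<theta>"
  proof -
    have "exp (v * (\<theta>\<^sup>2 / 2 * (1 - 2 * \<bar>\<theta>\<bar>))) \<le> mgf \<theta>"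
      unfolding mgf_def s_def v_def using t t1 by (intro mgf_psum_lower) auto
    then show ?thesis using t by (simp add: u_def mult.commute mult.left_commute)
  qed
  have mgf_pos: "0 < mgf \<theta>" using low exp_gt_zero less_le_trans by blast
  \<comment> \<open>The hypothesis \<open>big\<close> says
    \<open>\<delta>\<^sup>2 / 2 * u \<ge> 2\<close>. A gap of
    \<open>\<delta>\<^sup>2 / 2 * u\<close> in the exponent then makes each of the two outer parts
    at most a quarter of \<open>mgf \<theta>\<close>, so half of it is left for the window.\<close>
  have quarter: "exp (- (\<delta>\<^sup>2 / 2) * u) \<le> 1 / 4"
  proof -
    have "1 + 2 + 2\<^sup>2 / 2 \<le> exp (2::real)" by (rule exp_lower_Taylor_quadratic) simp
    then have "4 \<le> exp (2::real)" by simp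
    also have "\<dots> \<le> exp (\<delta>\<^sup>2 / 2 * u)" using big by (simp add: u_def)
    finally show ?thesis by (simp add: exp_minus field_simps)
  qed
  \<comment> \<open>Here \<open>w\<close> is the price of moving the tilt from \<theta> to
    \<open>c * \<theta>\<close>; the hypothesis asks that the total exponent stay below the one in
    \<open>low\<close> by the gap just used.\<close>
  have tail: "exp (w * u) * mgf (c * \<theta>) \<le> mgf \<theta> / 4"
    if "0 \<le> c" "c \<le> 2" "w + c\<^sup>2 * (1 + 2 * (c * \<theta>)) \<le> 1 - 2 * \<theta> - \<delta>\<^sup>2 / 2" for w c
  proof -
    have "exp (w * u) * mgf (c * \<theta>) \<le> exp (w * u) * exp (u * (c\<^sup>2 * (1 + 2 * (c * \<theta>))))"
      using up[OF that(1,2)] by (intro mult_left_mono) auto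
    also have "\<dots> = exp (u * (w + c\<^sup>2 * (1 + 2 * (c * \<theta>))))"
      by (simp add: exp_add[symmetric] algebra_simps)
    also have "\<dots> \<le> exp (u * (1 - 2 * \<theta> - \<delta>\<^sup>2 / 2))"
      using that(3) u0 by (auto intro!: mult_left_mono)
    also have "\<dots> = exp (u * (1 - 2 * \<theta>)) * exp (- (\<delta>\<^sup>2 / 2) * u)"
      by (simp add: exp_add[symmetric] algebra_simps)
    also have "\<dots> \<le> mgf \<theta> * (1 / 4)" by (intro mult_mono low quarter) (use mgf_pos in auto)
    finally show ?thesis by simp
  qed
  have c2: "\<delta>\<^sup>2 * \<theta> \<le> \<theta>" "\<delta> * \<theta> \<le> \<theta>" "\<delta> ^ 3 * \<theta> \<le> \<theta>" "0 \<le> \<delta> * \<theta>" "0 \<le> \<delta>\<^sup>2 * \<theta>" "0 \<le> \<delta> ^ 3 * \<theta>"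
    using t d d2 by (auto simp: power_le_one)
  \<comment> \<open>The main terms give \<open>(1 + \<delta>)\<^sup>2 - 2 * \<delta> * (1 +
    \<delta>) = 1 - \<delta>\<^sup>2\<close>. The corrections add up to at most
    \<open>16 * \<theta>\<close>, so \<open>18 * \<theta> \<le> \<delta>\<^sup>2 / 2\<close> is
    required; this is what the 40 in the bound on \<theta> provides.\<close>
  have above: "exp (- (\<delta> * (2 * (1 + \<delta>))) * u) * mgf ((1 + \<delta>) * \<theta>) \<le> mgf \<theta> / 4"
  proof (rule tail)
    have "- (\<delta> * (2 * (1 + \<delta>))) + (1 + \<delta>)\<^sup>2 * (1 + 2 * ((1 + \<delta>) * \<theta>))
        = 1 - \<delta>\<^sup>2 + 2 * \<theta> + 6 * (\<delta> * \<theta>) + 6 * (\<delta>\<^sup>2 * \<theta>) + 2 * (\<delta> ^ 3 * \<theta>)"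
      by (simp add: power2_eq_square power3_eq_cube algebra_simps)
    also have "\<dots> \<le> 1 - 2 * \<theta> - \<delta>\<^sup>2 / 2" using c2 t by linarith
    finally show "- (\<delta> * (2 * (1 + \<delta>))) + (1 + \<delta>)\<^sup>2 * (1 + 2 * ((1 + \<delta>) * \<theta>)) \<le> 1 - 2 * \<theta> - \<delta>\<^sup>2 / 2" .
  qed (use d in auto)
  have below: "exp (\<delta> * (2 * (1 - \<delta>)) * u) * mgf ((1 - \<delta>) * \<theta>) \<le> mgf \<theta> / 4"
  proof (rule tail)
    have "\<delta> * (2 * (1 - \<delta>)) + (1 - \<delta>)\<^sup>2 * (1 + 2 * ((1 - \<delta>) * \<theta>))
        = 1 - \<delta>\<^sup>2 + 2 * \<theta> - 6 * (\<delta> * \<theta>) + 6 * (\<delta>\<^sup>2 * \<theta>) - 2 * (\<delta> ^ 3 * \<theta>)"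
      by (simp add: power2_eq_square power3_eq_cube algebra_simps)
    also have "\<dots> \<le> 1 - 2 * \<theta> - \<delta>\<^sup>2 / 2" using c2 t by linarith
    finally show "\<delta> * (2 * (1 - \<delta>)) + (1 - \<delta>)\<^sup>2 * (1 + 2 * ((1 - \<delta>) * \<theta>)) \<le> 1 - 2 * \<theta> - \<delta>\<^sup>2 / 2" .
  qed (use d in auto)
  let ?A = "{\<omega> \<in> space M. a \<le> s \<omega>}"
  have ub: "\<theta> * b = 2 * (1 + \<delta>) * u" "\<theta> * a = 2 * (1 - \<delta>) * u"
    by (simp_all add: a_def b_def u_def power2_eq_square)
  have "mgf \<theta> \<le> expectation (\<lambda>\<omega>. exp (\<theta> * b) * indicator ?A \<omega>
      + (exp (- \<delta> * (\<theta> * b)) * exp ((1 + \<delta>) * \<theta> * s \<omega>) + exp (\<delta> * (\<theta> * a)) * exp ((1 - \<delta>) * \<theta> * s \<omega>)))"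
    unfolding mgf_def
  proof (intro integral_mono int Bochner_Integration.integrable_add integrable_mult_right)
    show "integrable M (indicat_real ?A)" by (auto simp: emeasure_eq_measure)
    fix \<omega> assume w: "\<omega> \<in> space M"
    have dt: "0 \<le> \<delta> * \<theta>" using d t by auto
    consider "s \<omega> < a" | "b < s \<omega>" | "a \<le> s \<omega>" "s \<omega> \<le> b" by linarith
    then show "exp (\<theta> * s \<omega>) \<le> exp (\<theta> * b) * indicator ?A \<omega>
      + (exp (- \<delta> * (\<theta> * b)) * exp ((1 + \<delta>) * \<theta> * s \<omega>) + exp (\<delta> * (\<theta> * a)) * exp ((1 - \<delta>) * \<theta> * s \<omega>))"
    proof cases
      case 1
      have "(\<delta> * \<theta>) * s \<omega> \<le> (\<delta> * \<theta>) * a" using 1 dt by (intro mult_left_mono) auto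
      then have "exp (\<theta> * s \<omega>) \<le> exp (\<delta> * (\<theta> * a)) * exp ((1 - \<delta>) * \<theta> * s \<omega>)"
        by (simp add: exp_add[symmetric] algebra_simps)
      then show ?thesis by (intro add_increasing) auto
    next
      case 2
      have "(\<delta> * \<theta>) * b \<le> (\<delta> * \<theta>) * s \<omega>" using 2 dt by (intro mult_left_mono) auto
      then have "exp (\<theta> * s \<omega>) \<le> exp (- \<delta> * (\<theta> * b)) * exp ((1 + \<delta>) * \<theta> * s \<omega>)"
        by (simp add: exp_add[symmetric] algebra_simps)
      then show ?thesis by (intro add_increasing[where a="exp (\<theta> * b) * indicator ?A \<omega>"] add_increasing2) auto
    next
      case 3
      then have "exp (\<theta> * s \<omega>) \<le> exp (\<theta> * b) * indicator ?A \<omega>"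
        using w t by (auto simp: indicator_def)
      then show ?thesis by (intro add_increasing2) auto
    qed
  qed
  also have "\<dots> = exp (\<theta> * b) * prob ?A
      + (exp (- \<delta> * (\<theta> * b)) * mgf ((1 + \<delta>) * \<theta>) + exp (\<delta> * (\<theta> * a)) * mgf ((1 - \<delta>) * \<theta>))"
  proof -
    have iA: "integrable M (\<lambda>\<omega>. exp (\<theta> * b) * indicat_real ?A \<omega>)" by (auto simp: emeasure_eq_measure)
    have i: "integrable M (\<lambda>\<omega>. exp (- \<delta> * (\<theta> * b)) * exp ((1 + \<delta>) * \<theta> * s \<omega>))"
      "integrable M (\<lambda>\<omega>. exp (\<delta> * (\<theta> * a)) * exp ((1 - \<delta>) * \<theta> * s \<omega>))"
      by (intro integrable_mult_right int)+
    show ?thesis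
      unfolding Bochner_Integration.integral_add[OF iA Bochner_Integration.integrable_add[OF i]]
        Bochner_Integration.integral_add[OF i] mgf_def
      by (simp add: emeasure_eq_measure)
  qed
  also have "\<dots> \<le> exp (\<theta> * b) * prob ?A + (mgf \<theta> / 4 + mgf \<theta> / 4)"
    using above below unfolding ub by (intro add_left_mono add_mono) (simp_all add: mult.assoc)
  finally have "mgf \<theta> / 2 \<le> exp (\<theta> * b) * prob ?A" by simp
  then have "exp (- (\<theta> * b)) * (mgf \<theta> / 2) \<le> exp (- (\<theta> * b)) * (exp (\<theta> * b) * prob ?A)"
    by (intro mult_left_mono) auto
  then have A: "exp (- (\<theta> * b)) * (mgf \<theta> / 2) \<le> prob ?A"
    by (simp only: mult.assoc[symmetric] exp_add[symmetric]) simp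
  have half: "exp (- \<delta> * u) \<le> 1 / 2"
  proof -
    have "exp (- \<delta> * u) \<le> exp (- (\<delta>\<^sup>2 / 2) * u)"
      using mult_right_mono[of "\<delta>\<^sup>2 / 2" \<delta> u] dd d(1) u0 by simp
    from order_trans[OF this quarter] show ?thesis by simp
  qed
  \<comment> \<open>The loss \<open>4 * \<delta>\<close> is made up of \<open>2 * \<delta>\<close>
    for evaluating the tilt at the right end \<open>b\<close>, one \<delta> for the factor 1/2, and
    one for \<open>2 * \<theta> \<le> \<delta>\<close>.\<close>
  have "exp (- (1 + 4 * \<delta>) * u) \<le> exp (- (\<theta> * b) + u * (1 - 2 * \<theta>) + - \<delta> * u)"
  proof -
    have "(2 * \<theta>) * u \<le> \<delta> * u" using t dd u0 by (intro mult_right_mono) auto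
    then show ?thesis unfolding ub by (simp add: algebra_simps)
  qed
  also have "\<dots> = exp (- (\<theta> * b)) * (exp (u * (1 - 2 * \<theta>)) * exp (- \<delta> * u))"
    by (simp add: exp_add[symmetric] add.assoc)
  also have "\<dots> \<le> exp (- (\<theta> * b)) * (mgf \<theta> * (1 / 2))"
    using half low mgf_pos by (intro mult_left_mono mult_mono) auto
  finally show ?thesis using A by (simp add: u_def s_def a_def)
qed

lemma restrict: "bernoulli_family M (\<lambda>k \<omega>. k \<in> A \<and> B k \<omega>)"
proof
  show "indep_vars (\<lambda>_. count_space UNIV) (\<lambda>k \<omega>. k \<in> A \<and> B k \<omega>) UNIV"
    by (rule indep_vars_compose2[OF indep, of "\<lambda>k b. k \<in> A \<and> b"]) auto
  show "summable (\<lambda>k. prob {\<omega> \<in> space M. k \<in> A \<and> B k \<omega>})"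
    by (rule summable_comparison_test'[OF summable_prob, of 0]) (auto intro!: finite_measure_mono)
qed

end

text \<open>By \<open>1 - r \<le> exp (- r)\<close>, a positive probability that no event occurs
  from index m on would bound all partial sums by minus its logarithm.\<close>

lemma (in prob_space) second_borel_cantelli:
  fixes P :: "nat \<Rightarrow> 'a \<Rightarrow> bool"
  assumes ind: "indep_vars (\<lambda>_. count_space UNIV) P UNIV"
    and div: "\<not> summable (\<lambda>n. prob {\<omega> \<in> space M. P n \<omega>})"
  shows "AE \<omega> in M. \<exists>\<^sub>F n in sequentially. P n \<omega>"
proof -
  have [measurable]: "Measurable.pred M (P n)" for n using ind by (auto simp: indep_vars_def)
  define r where "r n = prob {\<omega> \<in> space M. P n \<omega>}" for n
  have r: "0 \<le> r n" "r n \<le> 1" for n by (auto simp: r_def)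
  have AE: "AE \<omega> in M. \<exists>n\<ge>m. P n \<omega>" for m
  proof -
    let ?N = "{\<omega> \<in> space M. \<forall>n\<ge>m. \<not> P n \<omega>}"
    have bound: "prob ?N \<le> exp (- (\<Sum>n\<in>{m..<m+k}. r n))" for k
    proof -
      have eq: "(\<Prod>n\<in>{m..<m+k}. of_bool (\<not> P n \<omega>)) = (of_bool (\<forall>n\<in>{m..<m+k}. \<not> P n \<omega>) :: real)" for \<omega>
        by (induction k) (auto simp: of_bool_def less_Suc_eq)
      have indv: "indep_vars (\<lambda>_. borel) (\<lambda>n \<omega>. of_bool (\<not> P n \<omega>) :: real) {m..<m+k}"
        by (rule indep_vars_subset[OF indep_vars_compose2[OF ind]]) auto
      have e: "expectation (\<lambda>\<omega>. of_bool (\<not> P n \<omega>)) = 1 - r n" for n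
      proof -
        have "expectation (\<lambda>\<omega>. of_bool (\<not> P n \<omega>) :: real) = expectation (\<lambda>\<omega>. 1 - indicator {\<omega> \<in> space M. P n \<omega>} \<omega>)"
          by (intro Bochner_Integration.integral_cong) (auto simp: indicator_def)
        also have "\<dots> = expectation (\<lambda>\<omega>. 1) - expectation (indicator {\<omega> \<in> space M. P n \<omega>})"
          by (rule Bochner_Integration.integral_diff) (auto simp: emeasure_eq_measure)
        also have "\<dots> = 1 - r n" by (simp add: r_def prob_space)
        finally show ?thesis .
      qed
      have int: "integrable M (\<lambda>\<omega>. of_bool (\<not> P n \<omega>) :: real)" for n
        by (rule integrable_const_bound[where B=1]) auto
      have "prob ?N \<le> prob {\<omega> \<in> space M. \<forall>n\<in>{m..<m+k}. \<not> P n \<omega>}"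
        by (rule finite_measure_mono) auto
      also have "\<dots> = expectation (\<lambda>\<omega>. indicator {\<omega> \<in> space M. \<forall>n\<in>{m..<m+k}. \<not> P n \<omega>} \<omega>)"
        by (simp add: emeasure_eq_measure)
      also have "\<dots> = expectation (\<lambda>\<omega>. \<Prod>n\<in>{m..<m+k}. of_bool (\<not> P n \<omega>))"
        unfolding eq by (intro Bochner_Integration.integral_cong) (auto simp: indicator_def)
      also have "\<dots> = (\<Prod>n\<in>{m..<m+k}. 1 - r n)"
        by (subst indep_vars_lebesgue_integral[OF _ indv int]) (auto simp: e)
      also have "\<dots> \<le> (\<Prod>n\<in>{m..<m+k}. exp (- r n))"
        using r by (intro prod_mono conjI) (auto simp: exp_ge_add_one_self[of "- r _", simplified])
      also have "\<dots> = exp (- (\<Sum>n\<in>{m..<m+k}. r n))" by (simp add: exp_sum sum_negf[symmetric])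
      finally show ?thesis .
    qed
    have "prob ?N \<le> 0"
    proof (rule ccontr)
      assume "\<not> prob ?N \<le> 0"
      then have pos: "0 < prob ?N" by simp
      have "(\<Sum>n<k. r (n + m)) \<le> - ln (prob ?N)" for k
      proof -
        have "ln (prob ?N) \<le> - (\<Sum>n\<in>{m..<m+k}. r n)"
          using bound[of k] pos by (metis exp_gt_zero ln_exp ln_le_cancel_iff)
        moreover have "(\<Sum>n\<in>{m..<m+k}. r n) = (\<Sum>n<k. r (n + m))"
          using sum.shift_bounds_nat_ivl[of r 0 m k] by (simp add: lessThan_atLeast0 add.commute)
        ultimately show ?thesis by simp
      qed
      then have "summable (\<lambda>n. r (n + m))"
        by (intro summableI_nonneg_bounded[where x="- ln (prob ?N)"]) (auto simp: r)
      then have "summable r" by (simp add: summable_iff_shift)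
      then show False using div by (simp add: r_def[abs_def])
    qed
    then have "prob ?N = 0" using measure_nonneg[of M ?N] by linarith
    then have "AE \<omega> in M. \<omega> \<notin> ?N" by (subst (asm) prob_eq_0) auto
    then show ?thesis by (rule AE_mp) (auto intro!: AE_I2)
  qed
  then have "AE \<omega> in M. \<forall>m. \<exists>n\<ge>m. P n \<omega>" by (simp add: AE_all_countable)
  then show ?thesis by (simp add: frequently_sequentially)
qed

section \<open>Independence of the boxes\<close>

text \<open>
  \<open>poisson_pmf 0\<close> is unspecified, but \<open>0\<close> is the intensity of a box outside the
  support of \<open>p\<close>.
\<close>

definition pois_law :: "real \<Rightarrow> nat pmf" where
  "pois_law x = (if 0 < x then poisson_pmf x else return_pmf 0)"

lemma pmf_pois_law: "0 \<le> x \<Longrightarrow> pmf (pois_law x) a = x ^ a / fact a * exp (- x)"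
  by (cases "x = 0") (auto simp: pois_law_def indicator_def power_0_left)

text \<open>On a countable product of finitely many factors a law is determined by its point masses;
  if these factorise, it is the product law, and independence and the marginals follow
  together.\<close>

lemma (in prob_space) indep_vars_from_pmfs:
  fixes W :: "'i \<Rightarrow> 'a \<Rightarrow> 'b::countable" and P :: "'i \<Rightarrow> 'b pmf"
  assumes fin: "finite I" and ne: "I \<noteq> {}"
    and meas: "\<And>i. i \<in> I \<Longrightarrow> W i \<in> measurable M (count_space UNIV)"
    and joint: "\<And>a. prob {\<omega> \<in> space M. \<forall>i\<in>I. W i \<omega> = a i} = (\<Prod>i\<in>I. pmf (P i) (a i))"
  shows "indep_vars (\<lambda>_. count_space UNIV) W I"
    and "\<And>i. i \<in> I \<Longrightarrow> distr M (count_space UNIV) (W i) = measure_pmf (P i)"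
proof -
  let ?J = "\<lambda>\<omega>. \<lambda>i\<in>I. W i \<omega>"
  interpret P: product_prob_space "\<lambda>i. measure_pmf (P i)" I
    by (rule product_prob_spaceI) (rule prob_space_measure_pmf)
  have J: "?J \<in> measurable M (\<Pi>\<^sub>M i\<in>I. count_space UNIV)"
    using meas by (intro measurable_restrict) auto
  have setsP: "sets (\<Pi>\<^sub>M i\<in>I. measure_pmf (P i)) = sets (\<Pi>\<^sub>M i\<in>I. count_space UNIV)"
    by (intro sets_PiM_cong) auto
  have D: "distr M (\<Pi>\<^sub>M i\<in>I. count_space UNIV) ?J = (\<Pi>\<^sub>M i\<in>I. measure_pmf (P i))"
  proof (rule measure_eqI_countable'[where A="PiE I (\<lambda>_. UNIV)"])
    have s: "{x} \<in> sets (\<Pi>\<^sub>M i\<in>I. count_space UNIV)" if "x \<in> PiE I (\<lambda>_. UNIV)" for x :: "'i \<Rightarrow> 'b"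
      using PiE_singleton[of x I] that sets_PiM_I_finite[OF fin, of "\<lambda>i. {x i}" "\<lambda>_. count_space UNIV"]
      by (auto simp: PiE_def)
    show "{x} \<in> sets (distr M (\<Pi>\<^sub>M i\<in>I. count_space UNIV) ?J)" if "x \<in> PiE I (\<lambda>_. UNIV)" for x
      using s[OF that] by simp
    show "{x} \<in> sets (\<Pi>\<^sub>M i\<in>I. measure_pmf (P i))" if "x \<in> PiE I (\<lambda>_. UNIV)" for x
      using s[OF that] by (simp add: setsP)
    show "countable (PiE I (\<lambda>_. UNIV :: 'b set))" by (rule countable_PiE[OF fin]) auto
    fix a :: "'i \<Rightarrow> 'b" assume a: "a \<in> PiE I (\<lambda>_. UNIV)"
    have "emeasure (distr M (\<Pi>\<^sub>M i\<in>I. count_space UNIV) ?J) {a} = emeasure M (?J -` {a} \<inter> space M)"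
      by (rule emeasure_distr[OF J s[OF a]])
    also have "?J -` {a} \<inter> space M = {\<omega> \<in> space M. \<forall>i\<in>I. W i \<omega> = a i}"
      using a by (auto simp: PiE_def extensional_def fun_eq_iff restrict_def)
    also have "emeasure M \<dots> = ennreal (\<Prod>i\<in>I. pmf (P i) (a i))"
      by (simp add: emeasure_eq_measure joint)
    also have "\<dots> = (\<Prod>i\<in>I. emeasure (measure_pmf (P i)) {a i})"
      by (simp add: emeasure_pmf_single prod_ennreal)
    also have "\<dots> = emeasure (\<Pi>\<^sub>M i\<in>I. measure_pmf (P i)) (PiE I (\<lambda>i. {a i}))"
      by (rule P.emeasure_PiM[symmetric]) (auto simp: fin)
    also have "PiE I (\<lambda>i. {a i}) = {a}" using a by (intro PiE_singleton) (auto simp: PiE_def)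
    finally show "emeasure (distr M (\<Pi>\<^sub>M i\<in>I. count_space UNIV) ?J) {a} =
      emeasure (\<Pi>\<^sub>M i\<in>I. measure_pmf (P i)) {a}" .
  qed (auto simp: space_PiM)
  show distr: "distr M (count_space UNIV) (W i) = measure_pmf (P i)" if i: "i \<in> I" for i
  proof -
    have "distr M (count_space UNIV) (W i) =
        distr (distr M (\<Pi>\<^sub>M i\<in>I. count_space UNIV) ?J) (count_space UNIV) (\<lambda>f. f i)"
      using i by (subst distr_distr[OF _ J]) (auto simp: comp_def intro!: distr_cong)
    also have "\<dots> = distr (\<Pi>\<^sub>M i\<in>I. measure_pmf (P i)) (measure_pmf (P i)) (\<lambda>f. f i)"
      unfolding D by (intro distr_cong) auto
    also have "\<dots> = measure_pmf (P i)"
      by (rule distr_PiM_component[OF _ i]) (rule prob_space_measure_pmf)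
    finally show ?thesis .
  qed
  show "indep_vars (\<lambda>_. count_space UNIV) W I"
    by (subst indep_vars_iff_distr_eq_PiM'[OF ne meas]) (auto simp: D distr intro!: PiM_cong)
qed

lemma (in prob_space) indep_vars_finite_index:
  assumes "\<And>J. finite J \<Longrightarrow> J \<noteq> {} \<Longrightarrow> J \<subseteq> I \<Longrightarrow> indep_vars N W J"
  shows "indep_vars N W I"
proof -
  have "W i \<in> measurable M (N i)" if "i \<in> I" for i
    using assms[of "{i}"] that by (auto simp: indep_vars_def)
  moreover have "indep_sets (\<lambda>i. {W i -` A \<inter> space M |A. A \<in> sets (N i)}) I"
    by (subst indep_sets_finite_index_sets) (use assms in \<open>auto simp: indep_vars_def2\<close>)
  ultimately show ?thesis by (auto simp: indep_vars_def2)
qed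

text \<open>Independence of finitely many variables is a property of their joint law, which ignores
  null sets. It is required because the balls in a box are the sum of the interval counts only
  almost surely.\<close>

lemma (in prob_space) indep_vars_AE_cong:
  assumes ind: "indep_vars N W I"
    and ae: "\<And>i. i \<in> I \<Longrightarrow> AE \<omega> in M. W i \<omega> = W' i \<omega>"
    and meas: "\<And>i. i \<in> I \<Longrightarrow> W' i \<in> measurable M (N i)"
  shows "indep_vars N W' I"
proof (rule indep_vars_finite_index)
  fix J assume J: "finite J" "J \<noteq> {}" "J \<subseteq> I"
  have "distr M (\<Pi>\<^sub>M i\<in>J. N i) (\<lambda>x. \<lambda>i\<in>J. W' i x) = distr M (\<Pi>\<^sub>M i\<in>J. N i) (\<lambda>x. \<lambda>i\<in>J. W i x)"
  proof (rule distr_cong_AE)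
    have "AE x in M. \<forall>i\<in>J. W i x = W' i x" using J ae by (subst AE_finite_all) auto
    then show "AE x in M. (\<lambda>i\<in>J. W' i x) = (\<lambda>i\<in>J. W i x)"
      by eventually_elim (auto simp: restrict_def)
    show "(\<lambda>x. \<lambda>i\<in>J. W' i x) \<in> measurable M (\<Pi>\<^sub>M i\<in>J. N i)" using J meas by (intro measurable_restrict) auto
    show "(\<lambda>x. \<lambda>i\<in>J. W i x) \<in> measurable M (\<Pi>\<^sub>M i\<in>J. N i)"
      using J ind by (intro measurable_restrict) (auto simp: indep_vars_def)
  qed auto
  also have "\<dots> = (\<Pi>\<^sub>M i\<in>J. distr M (N i) (W i))"
    using indep_vars_subset[OF ind J(3)] J
    by (subst indep_vars_iff_distr_eq_PiM'[symmetric]) (auto simp: indep_vars_def)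
  also have "\<dots> = (\<Pi>\<^sub>M i\<in>J. distr M (N i) (W' i))"
    using J ind meas ae by (intro PiM_cong distr_cong_AE refl) (auto simp: indep_vars_def)
  finally show "indep_vars N W' J"
    using J meas by (subst indep_vars_iff_distr_eq_PiM') auto
qed

section \<open>Multinomial counts and Poisson thinning\<close>

definition multinomial_prob :: "nat pmf \<Rightarrow> nat set \<Rightarrow> (nat \<Rightarrow> nat) \<Rightarrow> nat \<Rightarrow> real" where
  "multinomial_prob p J a c = (if sum a J \<le> c
     then fact c / fact (c - sum a J) * (\<Prod>k\<in>J. pmf p k ^ a k / fact (a k)) * (1 - sum (pmf p) J) ^ (c - sum a J)
     else 0)"

lemma sum_pmf_le_1: "finite J \<Longrightarrow> sum (pmf p) J \<le> 1"
  by (metis measure_measure_pmf_finite measure_pmf.prob_le_1)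

lemma multinomial_prob_nonneg: "finite J \<Longrightarrow> 0 \<le> multinomial_prob p J a c"
  using sum_pmf_le_1[of J p] by (auto simp: multinomial_prob_def intro!: mult_nonneg_nonneg divide_nonneg_nonneg prod_nonneg)

text \<open>Conditioning on one ball: it falls outside J, which is one additional class absorbing
  \<open>c - sum a J\<close> balls, or into a box k of J, where \<open>a k - 1\<close> further balls
  are then due.\<close>

lemma multinomial_prob_Suc:
  assumes J: "finite J"
  shows "multinomial_prob p J a (Suc c) = (1 - sum (pmf p) J) * multinomial_prob p J a c
    + (\<Sum>k\<in>J. if a k = 0 then 0 else pmf p k * multinomial_prob p J (a(k := a k - 1)) c)"
proof -
  define r where "r = 1 - sum (pmf p) J"
  define W where "W a = (\<Prod>k\<in>J. pmf p k ^ a k / fact (a k) :: real)" for a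
  define N where "N = sum a J"
  have upd: "sum (a(k := a k - 1)) J = N - 1" "pmf p k * W (a(k := a k - 1)) = a k * W a" "1 \<le> N"
    if k: "k \<in> J" "a k \<noteq> 0" for k
  proof -
    have "N = a k + sum a (J - {k})" unfolding N_def using J k by (simp add: sum.remove)
    moreover have "sum (a(k := a k - 1)) J = (a k - 1) + sum a (J - {k})"
      using J k by (subst sum.remove[of J k]) (auto intro!: sum.cong)
    ultimately show "sum (a(k := a k - 1)) J = N - 1" "1 \<le> N" using k by auto
    define R where "R = (\<Prod>k\<in>J - {k}. pmf p k ^ a k / fact (a k))"
    have W1: "W (a(k := a k - 1)) = pmf p k ^ (a k - 1) / fact (a k - 1) * R"
      unfolding W_def R_def using J k by (subst prod.remove[of J k]) (auto intro!: prod.cong)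
    have W2: "W a = pmf p k ^ a k / fact (a k) * R"
      unfolding W_def R_def using J k by (simp add: prod.remove)
    have "pmf p k * (pmf p k ^ (a k - 1) / fact (a k - 1)) = a k * (pmf p k ^ a k / fact (a k))"
      using k by (cases "a k") (simp_all del: of_nat_Suc)
    then show "pmf p k * W (a(k := a k - 1)) = a k * W a"
      unfolding W1 W2 by (simp only: mult.assoc[symmetric])
  qed
  have mp: "multinomial_prob p J b c = (if sum b J \<le> c then fact c / fact (c - sum b J) * W b * r ^ (c - sum b J) else 0)" for b c
    by (simp add: multinomial_prob_def W_def r_def)
  \<comment> \<open>Each summand is \<open>a k\<close> times one common quantity, so the sum is N
    times it; what remains is \<open>(c + 1) / (c + 1 - N) = 1 + N / (c + 1 - N)\<close>.\<close>
  have summand: "(if a k = 0 then 0 else pmf p k * multinomial_prob p J (a(k := a k - 1)) c) =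
      (if N \<le> Suc c then real (a k) * (fact c / fact (Suc c - N) * W a * r ^ (Suc c - N)) else 0)" if "k \<in> J" for k
  proof (cases "a k = 0")
    case False
    note u = upd[OF that False]
    have e: "c - (N - 1) = Suc c - N" "N - 1 \<le> c \<longleftrightarrow> N \<le> Suc c" using u(3) by auto
    have "pmf p k * (fact c / fact (Suc c - N) * W (a(k := a k - 1)) * r ^ (Suc c - N)) =
        fact c / fact (Suc c - N) * (pmf p k * W (a(k := a k - 1))) * r ^ (Suc c - N)"
      by (simp only: mult_ac)
    also have "\<dots> = real (a k) * (fact c / fact (Suc c - N) * W a * r ^ (Suc c - N))"
      unfolding u(2) by (simp only: mult_ac)
    finally show ?thesis unfolding mp u(1) e using False by simp
  qed auto
  have sumN: "(\<Sum>k\<in>J. real (a k)) = real N" by (simp add: N_def)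
  have "(\<Sum>k\<in>J. if a k = 0 then 0 else pmf p k * multinomial_prob p J (a(k := a k - 1)) c) =
      (if N \<le> Suc c then real N * (fact c / fact (Suc c - N) * W a * r ^ (Suc c - N)) else 0)"
  proof -
    have "(\<Sum>k\<in>J. if a k = 0 then 0 else pmf p k * multinomial_prob p J (a(k := a k - 1)) c) =
      (\<Sum>k\<in>J. if N \<le> Suc c then real (a k) * (fact c / fact (Suc c - N) * W a * r ^ (Suc c - N)) else 0)"
      by (intro sum.cong refl summand)
    then show ?thesis unfolding sumN[symmetric] sum_distrib_right by simp
  qed
  moreover have "multinomial_prob p J a (Suc c) = r * multinomial_prob p J a c +
      (if N \<le> Suc c then real N * (fact c / fact (Suc c - N) * W a * r ^ (Suc c - N)) else 0)"
  proof -
    consider "N \<le> c" | "N = Suc c" | "Suc c < N" by linarith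
    then show ?thesis
    proof cases
      case 1
      then obtain d where d: "c = N + d" using le_Suc_ex by blast
      define T where "T = fact c / fact d * W a * r ^ Suc d"
      have f: "multinomial_prob p J a (Suc c) = real (Suc c) / real (Suc d) * T"
        "r * multinomial_prob p J a c = T"
        "real N * (fact c / fact (Suc c - N) * W a * r ^ (Suc c - N)) = real N / real (Suc d) * T"
        unfolding mp N_def[symmetric] T_def using d by (simp_all add: Suc_diff_le)
      have f4: "real (Suc c) / real (Suc d) = 1 + real N / real (Suc d)"
        using d by (simp add: field_simps)
      have "N \<le> Suc c" using 1 by simp
      then show ?thesis by (simp only: f f4 if_True distrib_right mult_1_left)
    qed (auto simp: mp N_def[symmetric])
  qed
  ultimately show ?thesis by (simp add: r_def)
qed

text \<open>Shifted by \<open>N = sum a J\<close>, the series over c is the exponential series in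
  \<open>l * r\<close>, and \<open>exp (- l) * exp (l * r)\<close> splits into one factor
  \<open>exp (- (pmf p k * l))\<close> for each box of J: a Poisson number of balls makes the box
  counts independent.\<close>

lemma poisson_mixture_multinomial:
  assumes J: "finite J" and l: "0 < l"
  shows "(\<integral>\<^sup>+c. ennreal (multinomial_prob p J a c) \<partial>measure_pmf (poisson_pmf l))
    = ennreal (\<Prod>k\<in>J. pmf (pois_law (pmf p k * l)) (a k))"
proof -
  define r where "r = 1 - sum (pmf p) J"
  define W where "W = (\<Prod>k\<in>J. pmf p k ^ a k / fact (a k) :: real)"
  define N where "N = sum a J"
  define f where "f c = pmf (poisson_pmf l) c * multinomial_prob p J a c" for c
  have "(\<lambda>c. (l * r) ^ c /\<^sub>R fact c) sums exp (l * r)" by (rule exp_converges)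
  from sums_mult[OF this, of "W * l ^ N * exp (- l)"]
  have "(\<lambda>c. f (c + N)) sums (W * l ^ N * exp (- l) * exp (l * r))"
    using l by (simp add: f_def multinomial_prob_def N_def[symmetric] W_def[symmetric] r_def[symmetric]
        field_simps power_add power_mult_distrib)
  then have "f sums (W * l ^ N * exp (- l) * exp (l * r))"
    by (subst (asm) sums_zero_iff_shift) (auto simp: f_def multinomial_prob_def N_def[symmetric])
  moreover have "W * l ^ N * exp (- l) * exp (l * r) = (\<Prod>k\<in>J. pmf (pois_law (pmf p k * l)) (a k))"
  proof -
    have "(\<Prod>k\<in>J. pmf (pois_law (pmf p k * l)) (a k)) =
        (\<Prod>k\<in>J. (pmf p k ^ a k / fact (a k)) * (l ^ a k * exp (- (pmf p k * l))))"
      using l by (intro prod.cong) (auto simp: pmf_pois_law power_mult_distrib)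
    also have "\<dots> = W * ((\<Prod>k\<in>J. l ^ a k) * (\<Prod>k\<in>J. exp (- (pmf p k * l))))"
      by (simp only: prod.distrib W_def)
    also have "(\<Prod>k\<in>J. l ^ a k) = l ^ N" by (simp add: N_def power_sum)
    also have "(\<Prod>k\<in>J. exp (- (pmf p k * l))) = exp (- (\<Sum>k\<in>J. pmf p k * l))"
      by (simp add: exp_sum[OF J] sum_negf[symmetric])
    also have "exp (- (\<Sum>k\<in>J. pmf p k * l)) = exp (- l) * exp (l * r)"
      by (simp add: exp_add[symmetric] r_def algebra_simps sum_distrib_left)
    finally show ?thesis by simp
  qed
  ultimately have s: "f sums (\<Prod>k\<in>J. pmf (pois_law (pmf p k * l)) (a k))" by simp
  have "(\<integral>\<^sup>+c. ennreal (multinomial_prob p J a c) \<partial>measure_pmf (poisson_pmf l)) = (\<Sum>c. ennreal (f c))"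
    unfolding nn_integral_measure_pmf nn_integral_count_space_nat f_def
    by (intro suminf_cong) (simp add: ennreal_mult' del: pmf_poisson)
  also have "\<dots> = ennreal (\<Prod>k\<in>J. pmf (pois_law (pmf p k * l)) (a k))"
    by (rule suminf_ennreal_eq[OF _ s]) (auto simp: f_def multinomial_prob_nonneg[OF J])
  finally show ?thesis .
qed

lemma count_update:
  fixes a c :: "'b \<Rightarrow> nat"
  assumes "K \<in> J"
  shows "(\<forall>k\<in>J. (if K = k then Suc (c k) else c k) = a k) \<longleftrightarrow>
    a K \<noteq> 0 \<and> (\<forall>k\<in>J. c k = (a(K := a K - 1)) k)"
proof
  assume *: "\<forall>k\<in>J. (if K = k then Suc (c k) else c k) = a k"
  then have "a K = Suc (c K)" using assms by auto
  then show "a K \<noteq> 0 \<and> (\<forall>k\<in>J. c k = (a(K := a K - 1)) k)" using * by (auto split: if_splits)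
next
  assume "a K \<noteq> 0 \<and> (\<forall>k\<in>J. c k = (a(K := a K - 1)) k)"
  then show "\<forall>k\<in>J. (if K = k then Suc (c k) else c k) = a k" using assms by auto
qed

section \<open>Joint law of the numbers of balls by box and time interval\<close>

context poissonized_karlin_scheme
begin

abbreviation balls :: "nat \<Rightarrow> real \<Rightarrow> 'a \<Rightarrow> nat" where "balls \<equiv> balls_in_box S X"

text \<open>Indexed by pairs of a box and an interval, so that independence over boxes and over time
  becomes a single statement about one family.\<close>

definition cnt :: "(nat \<Rightarrow> real) \<Rightarrow> nat \<times> nat \<Rightarrow> 'a \<Rightarrow> nat" where
  "cnt \<tau> = (\<lambda>(k, i) \<omega>. card {n. S n \<omega> \<in> {\<tau> i<..\<tau> (Suc i)} \<and> X n \<omega> = k})"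

lemma S_measurable [measurable]: "S n \<in> borel_measurable M"
  using arrivals by (auto simp: poisson_arrivals_def)

lemma X_measurable [measurable]: "X n \<in> measurable M (count_space UNIV)"
  using boxes_indep by (auto simp: indep_vars_def)

lemma X_in_measurable [measurable]: "Measurable.pred M (\<lambda>\<omega>. X n \<omega> \<in> A)"
  by (rule measurable_compose[OF X_measurable]) simp

lemma balls_measurable [measurable]: "balls k t \<in> measurable M (count_space UNIV)"
  unfolding balls_in_box_def by measurable

lemma cnt_measurable [measurable]: "cnt \<tau> ki \<in> measurable M (count_space UNIV)"
  unfolding cnt_def case_prod_beta by measurable

lemma AE_arrivals:
  "AE \<omega> in M. 0 < S 0 \<omega> \<and> strict_mono (\<lambda>n. S n \<omega>) \<and> filterlim (\<lambda>n. S n \<omega>) at_top sequentially"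
  using arrivals by (auto simp: poisson_arrivals_def)

lemma finite_arrivals:
  fixes s :: "nat \<Rightarrow> real"
  assumes "filterlim s at_top sequentially"
  shows "finite {n. s n \<le> t}"
proof -
  have "\<forall>\<^sub>F n in sequentially. t < s n" using assms by (simp add: filterlim_at_top_dense)
  then obtain N where "\<And>n. n \<ge> N \<Longrightarrow> t < s n" by (auto simp: eventually_sequentially)
  then have "{n. s n \<le> t} \<subseteq> {..<N}" by (auto simp: not_le[symmetric])
  then show ?thesis by (rule finite_subset) auto
qed

lemma X_split:
  assumes "finite A" "finite B" "A \<inter> B = {}"
  shows "prob {\<omega> \<in> space M. P1 (\<lambda>n\<in>A. X n \<omega>) \<and> P2 (\<lambda>n\<in>B. X n \<omega>)} =
    prob {\<omega> \<in> space M. P1 (\<lambda>n\<in>A. X n \<omega>)} * prob {\<omega> \<in> space M. P2 (\<lambda>n\<in>B. X n \<omega>)}"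
proof -
  have i: "indep_var (PiM A (\<lambda>_. count_space UNIV)) (\<lambda>\<omega>. \<lambda>n\<in>A. X n \<omega>)
      (PiM B (\<lambda>_. count_space UNIV)) (\<lambda>\<omega>. \<lambda>n\<in>B. X n \<omega>)"
    by (rule indep_var_restrict[OF boxes_indep assms(3)]) auto
  have s: "{f \<in> PiE A (\<lambda>_. UNIV). P1 f} \<in> sets (PiM A (\<lambda>_. count_space UNIV))"
    "{f \<in> PiE B (\<lambda>_. UNIV). P2 f} \<in> sets (PiM B (\<lambda>_. count_space UNIV))"
    using assms by (auto simp: count_space_PiM_finite)
  from indep_varD[OF i s] show ?thesis
    by (simp add: vimage_def Int_def conj_commute)
qed

lemma prob_box: "prob {\<omega> \<in> space M. X n \<omega> \<in> A} = measure_pmf.prob p A"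
proof -
  have "measure_pmf.prob p A = measure (distr M (count_space UNIV) (X n)) A"
    by (simp add: box_distr)
  also have "\<dots> = prob (X n -` A \<inter> space M)" by (rule measure_distr) auto
  finally show ?thesis by (simp add: vimage_def Int_def conj_commute)
qed

lemma multinomial:
  assumes D: "finite D" and J: "finite J"
  shows "prob {\<omega> \<in> space M. \<forall>k\<in>J. card {n \<in> D. X n \<omega> = k} = a k} = multinomial_prob p J a (card D)"
  using D
proof (induction D arbitrary: a)
  case empty
  show ?case
  proof (cases "\<forall>k\<in>J. a k = 0")
    case True
    then show ?thesis using J by (simp add: multinomial_prob_def prob_space)
  next
    case False
    then have *: "{\<omega> \<in> space M. \<forall>k\<in>J. card {n \<in> {}. X n \<omega> = k} = a k} = {}" by auto
    show ?thesis unfolding * using False J by (simp add: multinomial_prob_def)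
  qed
next
  case (insert x D)
  define E where "E b \<omega> = (\<forall>k\<in>J. card {n \<in> D. X n \<omega> = k} = b k)" for b \<omega>
  have [measurable]: "Measurable.pred M (E b)" for b unfolding E_def using J insert(1) by measurable
  have IH: "prob {\<omega> \<in> space M. E b \<omega>} = multinomial_prob p J b (card D)" for b
    unfolding E_def by (rule insert.IH)
  have prod: "prob {\<omega> \<in> space M. X x \<omega> \<in> A \<and> E b \<omega>} = measure_pmf.prob p A * multinomial_prob p J b (card D)" for A b
  proof -
    have r: "{n \<in> D. (if n \<in> D then X n \<omega> else undefined) = k} = {n \<in> D. X n \<omega> = k}" for \<omega> k by auto
    have "prob {\<omega> \<in> space M. X x \<omega> \<in> A \<and> E b \<omega>} = prob {\<omega> \<in> space M. X x \<omega> \<in> A} * prob {\<omega> \<in> space M. E b \<omega>}"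
      using X_split[of "{x}" D "\<lambda>f. f x \<in> A" "\<lambda>f. \<forall>k\<in>J. card {n \<in> D. f n = k} = b k"] insert(1,2)
      by (simp add: E_def r)
    then show ?thesis by (simp add: prob_box IH)
  qed
  have card: "card {n \<in> insert x D. X n \<omega> = k} = (if X x \<omega> = k then Suc (card {n \<in> D. X n \<omega> = k}) else card {n \<in> D. X n \<omega> = k})" for k \<omega>
  proof -
    have "{n \<in> insert x D. X n \<omega> = k} = (if X x \<omega> = k then insert x {n \<in> D. X n \<omega> = k} else {n \<in> D. X n \<omega> = k})"
      by auto
    then show ?thesis using insert(1,2) by simp
  qed
  \<comment> \<open>In \<open>F k\<close> the new ball lands in box k, in \<open>G\<close> it misses
    J. The condition \<open>a k \<noteq> 0\<close> keeps the truncated subtraction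
    \<open>a k - 1\<close> from turning an impossible demand into a possible one.\<close>
  define F where "F k = {\<omega> \<in> space M. X x \<omega> \<in> {k} \<and> a k \<noteq> 0 \<and> E (a(k := a k - 1)) \<omega>}" for k
  define G where "G = {\<omega> \<in> space M. X x \<omega> \<in> - J \<and> E a \<omega>}"
  have [measurable]: "F k \<in> sets M" "G \<in> sets M" for k unfolding F_def G_def by measurable
  have split: "{\<omega> \<in> space M. \<forall>k\<in>J. card {n \<in> insert x D. X n \<omega> = k} = a k} = G \<union> (\<Union>k\<in>J. F k)"
  proof (rule set_eqI)
    fix \<omega>
    show "\<omega> \<in> {\<omega> \<in> space M. \<forall>k\<in>J. card {n \<in> insert x D. X n \<omega> = k} = a k} \<longleftrightarrow> \<omega> \<in> G \<union> (\<Union>k\<in>J. F k)"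
    proof (cases "X x \<omega> \<in> J")
      case True
      have "(\<forall>k\<in>J. card {n \<in> insert x D. X n \<omega> = k} = a k) \<longleftrightarrow>
          a (X x \<omega>) \<noteq> 0 \<and> E (a(X x \<omega> := a (X x \<omega>) - 1)) \<omega>"
        using True unfolding card E_def by (rule count_update)
      then show ?thesis using True by (auto simp: F_def G_def)
    next
      case False
      then have "(\<forall>k\<in>J. card {n \<in> insert x D. X n \<omega> = k} = a k) \<longleftrightarrow> E a \<omega>"
        unfolding card E_def by auto
      then show ?thesis using False by (auto simp: F_def G_def)
    qed
  qed
  have PF: "prob (F k) = (if a k = 0 then 0 else pmf p k * multinomial_prob p J (a(k := a k - 1)) (card D))" for k
    using prod[of "{k}" "a(k := a k - 1)"] by (cases "a k = 0") (auto simp: F_def measure_pmf_single)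
  have PG: "prob G = (1 - sum (pmf p) J) * multinomial_prob p J a (card D)"
  proof -
    have "measure_pmf.prob p (- J) = 1 - sum (pmf p) J"
      using measure_pmf.prob_compl[of J p] J by (simp add: Compl_eq_Diff_UNIV measure_measure_pmf_finite)
    then show ?thesis using prod[of "- J" a] by (simp add: G_def)
  qed
  have "prob (G \<union> (\<Union>k\<in>J. F k)) = prob G + prob (\<Union>k\<in>J. F k)"
    by (rule finite_measure_Union) (use J in \<open>auto simp: F_def G_def\<close>)
  also have "prob (\<Union>k\<in>J. F k) = (\<Sum>k\<in>J. prob (F k))"
    by (rule finite_measure_finite_Union[OF J]) (auto simp: disjoint_family_on_def F_def)
  finally have "prob (G \<union> (\<Union>k\<in>J. F k)) = prob G + (\<Sum>k\<in>J. prob (F k))" .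
  then show ?case unfolding split PF PG using insert(1,2) J by (simp add: multinomial_prob_Suc)
qed

lemma multinomial_blocks:
  fixes m :: nat
  assumes D: "\<forall>i<m. finite (D i)" "disjoint_family_on D {..<m}" and J: "finite J"
  shows "prob {\<omega> \<in> space M. \<forall>i<m. \<forall>k\<in>J. card {n \<in> D i. X n \<omega> = k} = a k i}
    = (\<Prod>i<m. multinomial_prob p J (\<lambda>k. a k i) (card (D i)))"
  using D
proof (induction m)
  case 0 then show ?case by (simp add: prob_space)
next
  case (Suc m)
  let ?U = "\<Union>i<m. D i"
  have "D i \<inter> D m = {}" if "i < m" for i
    using disjoint_family_onD[OF Suc.prems(2), of i m] that by simp
  then have disj: "?U \<inter> D m = {}" by blast
  have c: "{n \<in> D i. (\<lambda>n\<in>?U. X n \<omega>) n = k} = {n \<in> D i. X n \<omega> = k}" if "i < m" for \<omega> k i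
    using that by auto
  then have r: "(\<forall>i<m. \<forall>k\<in>J. card {n \<in> D i. (\<lambda>n\<in>?U. X n \<omega>) n = k} = a k i) \<longleftrightarrow>
      (\<forall>i<m. \<forall>k\<in>J. card {n \<in> D i. X n \<omega> = k} = a k i)" for \<omega>
    by (intro all_cong ball_cong refl) (simp only: c)
  have "{n \<in> D m. (\<lambda>n\<in>D m. X n \<omega>) n = k} = {n \<in> D m. X n \<omega> = k}" for \<omega> k by auto
  then have r': "(\<forall>k\<in>J. card {n \<in> D m. (\<lambda>n\<in>D m. X n \<omega>) n = k} = a k m) \<longleftrightarrow>
      (\<forall>k\<in>J. card {n \<in> D m. X n \<omega> = k} = a k m)" for \<omega>
    by (simp only:)
  have "prob {\<omega> \<in> space M. \<forall>i<Suc m. \<forall>k\<in>J. card {n \<in> D i. X n \<omega> = k} = a k i} =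
      prob {\<omega> \<in> space M. (\<forall>i<m. \<forall>k\<in>J. card {n \<in> D i. X n \<omega> = k} = a k i) \<and> (\<forall>k\<in>J. card {n \<in> D m. X n \<omega> = k} = a k m)}"
    by (intro arg_cong[where f=prob]) (auto simp: less_Suc_eq)
  also have "\<dots> = prob {\<omega> \<in> space M. \<forall>i<m. \<forall>k\<in>J. card {n \<in> D i. X n \<omega> = k} = a k i} *
      prob {\<omega> \<in> space M. \<forall>k\<in>J. card {n \<in> D m. X n \<omega> = k} = a k m}"
    using X_split[of ?U "D m" "\<lambda>f. \<forall>i<m. \<forall>k\<in>J. card {n \<in> D i. f n = k} = a k i"
        "\<lambda>f. \<forall>k\<in>J. card {n \<in> D m. f n = k} = a k m"] disj Suc.prems(1)
    unfolding r r' by simp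
  also have "\<dots> = (\<Prod>i<m. multinomial_prob p J (\<lambda>k. a k i) (card (D i))) * multinomial_prob p J (\<lambda>k. a k m) (card (D m))"
    using Suc.prems by (subst Suc.IH) (auto simp: multinomial J disjoint_family_on_def)
  finally show ?case by simp
qed

text \<open>
  Both arguments of \<open>indep_var\<close> have the same value type, so that \<open>X n\<close> enters
  the independence assumption of the locale through the coercion to the reals.
\<close>

lemma joint_counts:
  assumes \<tau>: "0 \<le> \<tau> 0" "strict_mono \<tau>" and J: "finite J"
  shows "prob {\<omega> \<in> space M. \<forall>i<m. \<forall>k\<in>J. cnt \<tau> (k, i) \<omega> = a k i} =
    (\<Prod>i<m. \<Prod>k\<in>J. pmf (pois_law (pmf p k * (\<tau> (Suc i) - \<tau> i))) (a k i))"
proof -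
  let ?MS = "\<Pi>\<^sub>M n\<in>(UNIV :: nat set). (borel :: real measure)"
  let ?MX = "\<Pi>\<^sub>M n\<in>(UNIV :: nat set). (count_space UNIV :: real measure)"
  let ?S = "\<lambda>\<omega> n. S n \<omega>" and ?X = "\<lambda>\<omega> n. real (X n \<omega>)"
  have rvS [measurable]: "?S \<in> measurable M ?MS" and rvX [measurable]: "?X \<in> measurable M ?MX"
    and dist: "distr M ?MS ?S \<Otimes>\<^sub>M distr M ?MX ?X = distr M (?MS \<Otimes>\<^sub>M ?MX) (\<lambda>\<omega>. (?S \<omega>, ?X \<omega>))"
    using arrivals_boxes_indep unfolding indep_var_distribution_eq by blast+
  interpret DX: prob_space "distr M ?MX ?X" by (rule prob_space_distr[OF rvX])
  define I where "I i = {\<tau> i<..\<tau> (Suc i)}" for i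
  \<comment> \<open>The event as a set of pairs of paths: under the product of the two laws, the
    labels can be integrated out while the arrival times are held fixed.\<close>
  define E where "E = {sx \<in> space (?MS \<Otimes>\<^sub>M ?MX). \<forall>i\<in>{..<m}. \<forall>k\<in>J. card {n. fst sx n \<in> I i \<and> snd sx n = real k} = a k i}"
  have [measurable]: "I i \<in> sets borel" for i unfolding I_def by simp
  have E [measurable]: "E \<in> sets (?MS \<Otimes>\<^sub>M ?MX)"
    unfolding E_def using J by measurable
  have "emeasure M {\<omega> \<in> space M. \<forall>i<m. \<forall>k\<in>J. cnt \<tau> (k, i) \<omega> = a k i} =
      emeasure (distr M (?MS \<Otimes>\<^sub>M ?MX) (\<lambda>\<omega>. (?S \<omega>, ?X \<omega>))) E"
    by (subst emeasure_distr[OF _ E], measurable)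
       (auto intro!: arg_cong[where f="emeasure M"] simp: E_def space_pair_measure space_PiM cnt_def I_def)
  also have "\<dots> = emeasure (distr M ?MS ?S \<Otimes>\<^sub>M distr M ?MX ?X) E" by (simp add: dist)
  also have "\<dots> = (\<integral>\<^sup>+s. emeasure (distr M ?MX ?X) (Pair s -` E) \<partial>distr M ?MS ?S)"
    by (rule DX.emeasure_pair_measure_alt) (simp add: E)
  also have "\<dots> = (\<integral>\<^sup>+\<omega>. emeasure (distr M ?MX ?X) (Pair (?S \<omega>) -` E) \<partial>M)"
    by (rule nn_integral_distr[OF rvS]) (use DX.measurable_emeasure_Pair[of E ?MS] E in simp)
  also have "\<dots> = (\<integral>\<^sup>+\<omega>. (\<Prod>i<m. ennreal (multinomial_prob p J (\<lambda>k. a k i) (card {n. S n \<omega> \<in> I i}))) \<partial>M)"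
  proof (intro nn_integral_cong_AE, use AE_arrivals AE_space in eventually_elim)
    fix \<omega> assume w: "0 < S 0 \<omega> \<and> strict_mono (\<lambda>n. S n \<omega>) \<and> filterlim (\<lambda>n. S n \<omega>) at_top sequentially" "\<omega> \<in> space M"
    \<comment> \<open>For almost all arrival times the balls thrown in the i-th interval form
      finite, pairwise disjoint index sets, to which the multinomial formula applies.\<close>
    define D where "D i = {n. S n \<omega> \<in> I i}" for i
    have fin: "finite (D i)" for i
      by (rule finite_subset[OF _ finite_arrivals[of "\<lambda>n. S n \<omega>" "\<tau> (Suc i)"]])
         (use w in \<open>auto simp: D_def I_def\<close>)
    have disj: "disjoint_family_on D {..<m}"
    proof -
      have "D i \<inter> D j = {}" if "i < j" for i j
      proof -
        have "\<tau> (Suc i) \<le> \<tau> j" using that \<tau>(2) by (simp add: strict_mono_less_eq)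
        then show ?thesis by (auto simp: D_def I_def)
      qed
      then show ?thesis unfolding disjoint_family_on_def by (metis Int_commute nat_neq_iff)
    qed
    have "emeasure (distr M ?MX ?X) (Pair (?S \<omega>) -` E) = emeasure M (?X -` (Pair (?S \<omega>) -` E) \<inter> space M)"
      by (rule emeasure_distr[OF rvX sets_Pair1[OF E]])
    also have "?X -` (Pair (?S \<omega>) -` E) \<inter> space M =
        {\<omega>' \<in> space M. \<forall>i<m. \<forall>k\<in>J. card {n \<in> D i. X n \<omega>' = k} = a k i}"
      by (auto simp: E_def D_def space_pair_measure space_PiM)
    also have "emeasure M \<dots> = ennreal (\<Prod>i<m. multinomial_prob p J (\<lambda>k. a k i) (card (D i)))"
      using fin disj J by (simp add: emeasure_eq_measure multinomial_blocks)
    finally show "emeasure (distr M ?MX ?X) (Pair (?S \<omega>) -` E) =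
        (\<Prod>i<m. ennreal (multinomial_prob p J (\<lambda>k. a k i) (card {n. S n \<omega> \<in> I i})))"
      by (simp add: D_def prod_ennreal multinomial_prob_nonneg J)
  qed
  also have "\<dots> = (\<Prod>i<m. \<integral>\<^sup>+\<omega>. ennreal (multinomial_prob p J (\<lambda>k. a k i) (card {n. S n \<omega> \<in> I i})) \<partial>M)"
  proof (rule indep_vars_nn_integral)
    have "indep_vars (\<lambda>_. count_space UNIV) (\<lambda>i \<omega>. card {n. S n \<omega> \<in> I i}) UNIV"
      using arrivals \<tau> unfolding poisson_arrivals_def I_def by blast
    then have "indep_vars (\<lambda>_. borel) (\<lambda>i \<omega>. ennreal (multinomial_prob p J (\<lambda>k. a k i) (card {n. S n \<omega> \<in> I i}))) UNIV"
      by (rule indep_vars_compose2) auto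
    then show "indep_vars (\<lambda>_. borel) (\<lambda>i \<omega>. ennreal (multinomial_prob p J (\<lambda>k. a k i) (card {n. S n \<omega> \<in> I i}))) {..<m}"
      by (rule indep_vars_subset) auto
  qed auto
  also have "\<dots> = (\<Prod>i<m. ennreal (\<Prod>k\<in>J. pmf (pois_law (pmf p k * (\<tau> (Suc i) - \<tau> i))) (a k i)))"
  proof (intro prod.cong refl)
    fix i
    have pos: "0 \<le> \<tau> i" "\<tau> i < \<tau> (Suc i)"
      using \<tau> strict_mono_less_eq[OF \<tau>(2), of 0 i] strict_monoD[OF \<tau>(2), of i "Suc i"] by auto
    have d: "distr M (count_space UNIV) (\<lambda>\<omega>. card {n. S n \<omega> \<in> I i}) = measure_pmf (poisson_pmf (\<tau> (Suc i) - \<tau> i))"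
      using arrivals pos unfolding poisson_arrivals_def I_def by simp
    have "(\<integral>\<^sup>+\<omega>. ennreal (multinomial_prob p J (\<lambda>k. a k i) (card {n. S n \<omega> \<in> I i})) \<partial>M) =
        (\<integral>\<^sup>+c. ennreal (multinomial_prob p J (\<lambda>k. a k i) c) \<partial>distr M (count_space UNIV) (\<lambda>\<omega>. card {n. S n \<omega> \<in> I i}))"
      by (subst nn_integral_distr) auto
    also have "\<dots> = ennreal (\<Prod>k\<in>J. pmf (pois_law (pmf p k * (\<tau> (Suc i) - \<tau> i))) (a k i))"
      unfolding d using J pos by (intro poisson_mixture_multinomial) auto
    finally show "(\<integral>\<^sup>+\<omega>. ennreal (multinomial_prob p J (\<lambda>k. a k i) (card {n. S n \<omega> \<in> I i})) \<partial>M) =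
      ennreal (\<Prod>k\<in>J. pmf (pois_law (pmf p k * (\<tau> (Suc i) - \<tau> i))) (a k i))" .
  qed
  also have "\<dots> = ennreal (\<Prod>i<m. \<Prod>k\<in>J. pmf (pois_law (pmf p k * (\<tau> (Suc i) - \<tau> i))) (a k i))"
    by (intro prod_ennreal prod_nonneg) auto
  finally show ?thesis
    by (simp add: emeasure_eq_measure prod_nonneg)
qed

text \<open>Every finite set of pairs lies in a rectangle \<open>J \<times> {..<m}\<close>, where
  the joint point masses are known.\<close>

lemma counts_indep_distr:
  assumes \<tau>: "0 \<le> \<tau> 0" "strict_mono \<tau>"
  shows "indep_vars (\<lambda>_. count_space UNIV) (cnt \<tau>) UNIV"
    and "distr M (count_space UNIV) (cnt \<tau> (k, i)) = measure_pmf (pois_law (pmf p k * (\<tau> (Suc i) - \<tau> i)))"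
proof -
  let ?P = "\<lambda>(k, i). pois_law (pmf p k * (\<tau> (Suc i) - \<tau> i))"
  have joint: "prob {\<omega> \<in> space M. \<forall>ki\<in>J \<times> {..<m}. cnt \<tau> ki \<omega> = a ki} = (\<Prod>ki\<in>J \<times> {..<m}. pmf (?P ki) (a ki))"
    if J: "finite J" for J m a
  proof -
    have "prob {\<omega> \<in> space M. \<forall>ki\<in>J \<times> {..<m}. cnt \<tau> ki \<omega> = a ki} =
        prob {\<omega> \<in> space M. \<forall>i<m. \<forall>k\<in>J. cnt \<tau> (k, i) \<omega> = a (k, i)}"
      by (intro arg_cong[where f=prob]) auto
    also have "\<dots> = (\<Prod>i<m. \<Prod>k\<in>J. pmf (?P (k, i)) (a (k, i)))"
      using joint_counts[OF \<tau> J, of m "\<lambda>k i. a (k, i)"] by simp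
    also have "\<dots> = (\<Prod>k\<in>J. \<Prod>i<m. pmf (?P (k, i)) (a (k, i)))" by (rule prod.swap)
    also have "\<dots> = (\<Prod>ki\<in>J \<times> {..<m}. pmf (?P ki) (a ki))"
      by (subst prod.cartesian_product) (auto intro!: prod.cong)
    finally show ?thesis .
  qed
  show "indep_vars (\<lambda>_. count_space UNIV) (cnt \<tau>) UNIV"
  proof (rule indep_vars_finite_index)
    fix R :: "(nat \<times> nat) set" assume R: "finite R" "R \<noteq> {}"
    define m where "m = Suc (Max (snd ` R))"
    have sub: "R \<subseteq> fst ` R \<times> {..<m}"
    proof
      fix x assume x: "x \<in> R"
      then have "snd x < m" using R by (auto simp: m_def less_Suc_eq_le)
      then show "x \<in> fst ` R \<times> {..<m}" using x by (cases x) force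
    qed
    show "indep_vars (\<lambda>_. count_space UNIV) (cnt \<tau>) R"
      by (rule indep_vars_subset[OF indep_vars_from_pmfs(1)[OF _ _ _ joint] sub]) (use R in \<open>auto simp: m_def\<close>)
  qed
  show "distr M (count_space UNIV) (cnt \<tau> (k, i)) = measure_pmf (pois_law (pmf p k * (\<tau> (Suc i) - \<tau> i)))"
    using indep_vars_from_pmfs(2)[OF _ _ _ joint[of "{k}" "Suc i"], of "(k, i)"] by auto
qed

lemma AE_balls_eq_sum:
  assumes \<tau>: "\<tau> 0 = 0" "strict_mono \<tau>"
  shows "AE \<omega> in M. \<forall>k i. balls k (\<tau> i) \<omega> = (\<Sum>l<i. cnt \<tau> (k, l) \<omega>)"
  using AE_arrivals
proof eventually_elim
  fix \<omega> assume w: "0 < S 0 \<omega> \<and> strict_mono (\<lambda>n. S n \<omega>) \<and> filterlim (\<lambda>n. S n \<omega>) at_top sequentially"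
  have pos: "0 < S n \<omega>" for n
    using w strict_mono_less_eq[of "\<lambda>n. S n \<omega>" 0 n] by auto
  show "\<forall>k i. balls k (\<tau> i) \<omega> = (\<Sum>l<i. cnt \<tau> (k, l) \<omega>)"
  proof (intro allI)
    fix k i
    show "balls k (\<tau> i) \<omega> = (\<Sum>l<i. cnt \<tau> (k, l) \<omega>)"
    proof (induction i)
      case 0
      have "{n. S n \<omega> \<le> \<tau> 0 \<and> X n \<omega> = k} = {}" using pos \<tau>(1) by (auto simp: not_le)
      then show ?case by (simp only: balls_in_box_def) simp
    next
      case (Suc i)
      have lt: "\<tau> i < \<tau> (Suc i)" using \<tau>(2) by (simp add: strict_mono_less)
      have "{n. S n \<omega> \<le> \<tau> (Suc i) \<and> X n \<omega> = k} = {n. S n \<omega> \<le> \<tau> i \<and> X n \<omega> = k} \<union>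
          {n. S n \<omega> \<in> {\<tau> i<..\<tau> (Suc i)} \<and> X n \<omega> = k}"
        using lt by auto
      then have "balls k (\<tau> (Suc i)) \<omega> = balls k (\<tau> i) \<omega> + cnt \<tau> (k, i) \<omega>"
        unfolding balls_in_box_def cnt_def prod.case
        by (simp only:, subst card_Un_disjoint)
           (use w in \<open>auto intro: finite_subset[OF _ finite_arrivals[of "\<lambda>n. S n \<omega>" "\<tau> (Suc i)"]]
             finite_subset[OF _ finite_arrivals[of "\<lambda>n. S n \<omega>" "\<tau> i"]]\<close>)
      then show ?case using Suc by simp
    qed
  qed
qed

text \<open>The length \<open>r k\<close> of the history may depend on the box because the lower
  half observes the boxes of different blocks at different times.\<close>

lemma box_histories_indep:
  fixes \<tau> :: "nat \<Rightarrow> real" and r :: "nat \<Rightarrow> nat"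
  assumes \<tau>: "\<tau> 0 = 0" "strict_mono \<tau>"
  shows "indep_vars (\<lambda>_. count_space UNIV) (\<lambda>k \<omega>. map (\<lambda>i. balls k (\<tau> i) \<omega>) [0..<r k]) UNIV"
proof -
  let ?K = "\<lambda>k. {k} \<times> {..<r k}"
  have ind: "indep_vars (\<lambda>_. count_space UNIV) (cnt \<tau>) UNIV" using \<tau> by (intro counts_indep_distr) auto
  have "indep_vars (\<lambda>k. PiM (?K k) (\<lambda>_. count_space UNIV)) (\<lambda>k \<omega>. restrict (\<lambda>ki. cnt \<tau> ki \<omega>) (?K k)) UNIV"
    by (rule indep_vars_restrict[OF ind]) (auto simp: disjoint_family_on_def)
  then have "indep_vars (\<lambda>_. count_space UNIV)
      (\<lambda>k \<omega>. (\<lambda>f. map (\<lambda>i. \<Sum>l<i. f (k, l)) [0..<r k]) (restrict (\<lambda>ki. cnt \<tau> ki \<omega>) (?K k))) UNIV"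
    by (rule indep_vars_compose2) (auto simp: count_space_PiM_finite)
  then show ?thesis
  proof (rule indep_vars_AE_cong)
    fix k
    show "AE \<omega> in M. map (\<lambda>i. \<Sum>l<i. (restrict (\<lambda>ki. cnt \<tau> ki \<omega>) (?K k)) (k, l)) [0..<r k] =
        map (\<lambda>i. balls k (\<tau> i) \<omega>) [0..<r k]"
      using AE_balls_eq_sum[OF \<tau>] by eventually_elim auto
    show "(\<lambda>\<omega>. map (\<lambda>i. balls k (\<tau> i) \<omega>) [0..<r k]) \<in> measurable M (count_space UNIV)"
      unfolding measurable_count_space_eq2_countable
    proof safe
      fix xs :: "nat list"
      have "(\<lambda>\<omega>. map (\<lambda>i. balls k (\<tau> i) \<omega>) [0..<r k]) -` {xs} \<inter> space M =
          {\<omega> \<in> space M. length xs = r k \<and> (\<forall>i\<in>{..<r k}. balls k (\<tau> i) \<omega> = xs ! i)}"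
        by (auto simp: list_eq_iff_nth_eq)
      also have "\<dots> \<in> sets M" by measurable
      finally show "(\<lambda>\<omega>. map (\<lambda>i. balls k (\<tau> i) \<omega>) [0..<r k]) -` {xs} \<inter> space M \<in> sets M" .
    qed auto
  qed
qed

lemma balls_distr:
  assumes t: "0 < t"
  shows "distr M (count_space UNIV) (balls k t) = measure_pmf (pois_law (pmf p k * t))"
proof -
  define \<tau> where "\<tau> i = real i * t" for i
  have \<tau>: "\<tau> 0 = 0" "strict_mono \<tau>" using t by (auto simp: \<tau>_def strict_mono_def)
  have "distr M (count_space UNIV) (balls k t) = distr M (count_space UNIV) (cnt \<tau> (k, 0))"
  proof (rule distr_cong_AE)
    show "AE \<omega> in M. balls k t \<omega> = cnt \<tau> (k, 0) \<omega>"
      using AE_balls_eq_sum[OF \<tau>]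
    proof eventually_elim
      fix \<omega> assume "\<forall>k i. balls k (\<tau> i) \<omega> = (\<Sum>l<i. cnt \<tau> (k, l) \<omega>)"
      then have "balls k (\<tau> 1) \<omega> = cnt \<tau> (k, 0) \<omega>" by simp
      then show "balls k t \<omega> = cnt \<tau> (k, 0) \<omega>" by (simp add: \<tau>_def)
    qed
  qed auto
  also have "\<dots> = measure_pmf (pois_law (pmf p k * t))"
    using counts_indep_distr(2)[of \<tau> k 0] \<tau> by (simp add: \<tau>_def)
  finally show ?thesis .
qed

end

section \<open>Regular variation\<close>

definition poisson_tail :: "nat \<Rightarrow> real \<Rightarrow> real" where
  "poisson_tail i x = 1 - (\<Sum>l<i. x ^ l / fact l * exp (- x))"

lemma poisson_tail_Suc: "poisson_tail (Suc i) x = poisson_tail i x - x ^ i / fact i * exp (- x)"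
  by (simp add: poisson_tail_def)

text \<open>Duality of counts and waiting times: at least i + 1 arrivals have occurred by time x
  exactly if the (i + 1)-st waiting time is at most x. It makes each tail an integral of an Erlang
  density.\<close>

lemma poisson_tail_erlang: "0 \<le> x \<Longrightarrow> poisson_tail (Suc i) x = erlang_CDF i 1 x"
  by (simp add: poisson_tail_def erlang_CDF_def lessThan_Suc_atMost)

lemma poisson_tail_nonneg: "0 \<le> x \<Longrightarrow> 0 \<le> poisson_tail i x"
  by (cases i) (simp_all add: poisson_tail_erlang, simp add: poisson_tail_def)

lemma poisson_tail_antimono: "i \<le> j \<Longrightarrow> 0 \<le> x \<Longrightarrow> poisson_tail j x \<le> poisson_tail i x"
  unfolding poisson_tail_def by (intro diff_left_mono sum_mono2) auto

lemma poisson_weight_le_1: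
  assumes "0 \<le> x" shows "x ^ n / fact n * exp (- x) \<le> (1 :: real)"
proof -
  have "poisson_tail 0 x = 1" by (simp add: poisson_tail_def)
  then show ?thesis
    using poisson_tail_nonneg[OF assms, of "Suc n"] poisson_tail_antimono[OF le0 assms, of n]
    unfolding poisson_tail_Suc by linarith
qed

lemma poisson_tail_le: "1 \<le> i \<Longrightarrow> 0 \<le> x \<Longrightarrow> poisson_tail i x \<le> x"
  using poisson_tail_antimono[of 1 i x] exp_ge_add_one_self[of "- x"]
  by (simp add: poisson_tail_def)

lemma summable_pmf: "summable (pmf (p :: nat pmf))"
  by (rule summableI_nonneg_bounded[where x=1]) (auto simp: sum_pmf_le_1)

lemma summable_box:
  fixes p :: "nat pmf"
  assumes "\<And>x. 0 \<le> x \<Longrightarrow> \<bar>f x\<bar> \<le> C * x" "0 \<le> t"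
  shows "summable (\<lambda>k. f (pmf p k * t) :: real)"
proof (rule summable_comparison_test'[where g="\<lambda>k. C * t * pmf p k" and N=0])
  show "summable (\<lambda>k. C * t * pmf p k)" by (intro summable_mult summable_pmf)
  show "norm (f (pmf p n * t)) \<le> C * t * pmf p n" for n
    using assms(1)[of "pmf p n * t"] assms(2) by (simp add: mult_ac)
qed

section \<open>Elementary properties of the counting function \<rho>\<close>

lemma rho_set_eq: "{k \<in> set_pmf p. 1 / pmf p k \<le> t} = {k. 1 \<le> pmf p k * t}"
proof (rule Collect_cong)
  fix k
  show "k \<in> set_pmf p \<and> 1 / pmf p k \<le> t \<longleftrightarrow> 1 \<le> pmf p k * t"
    using pmf_nonneg[of p k] by (cases "pmf p k = 0") (auto simp: set_pmf_iff divide_le_eq mult.commute)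
qed

lemma rho_eq: "\<rho> p t = card {k. 1 \<le> pmf p k * t}"
  by (simp add: \<rho>_def rho_set_eq)

text \<open>The probabilities sum to at most 1, so at most t boxes have probability 1/t or
  more.\<close>

lemma finite_rho_set: "finite {k. 1 \<le> pmf p k * t}"
proof (cases "0 \<le> t")
  case True
  have "card F \<le> nat \<lfloor>t\<rfloor>" if F: "finite F" "F \<subseteq> {k. 1 \<le> pmf p k * t}" for F
  proof -
    have "real (card F) \<le> (\<Sum>k\<in>F. pmf p k * t)"
      using sum_mono[of F "\<lambda>_. 1" "\<lambda>k. pmf p k * t"] F by auto
    also have "\<dots> = sum (pmf p) F * t" by (simp add: sum_distrib_right)
    also have "\<dots> \<le> 1 * t" using sum_pmf_le_1[OF F(1), of p] True by (intro mult_right_mono) auto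
    finally show ?thesis by (simp add: le_nat_floor)
  qed
  then show ?thesis by (intro finite_if_finite_subsets_card_bdd[of _ "nat \<lfloor>t\<rfloor>", THEN conjunct1]) auto
next
  case False
  have "\<not> 1 \<le> pmf p k * t" for k
    using mult_nonneg_nonpos[of "pmf p k" t] False by simp
  then show ?thesis by simp
qed

lemma mono_rho: "mono (\<lambda>t. real (\<rho> p t))"
proof (rule monoI)
  fix s t :: real assume st: "s \<le> t"
  have "pmf p k * s \<le> pmf p k * t" for k using st by (intro mult_left_mono) auto
  then have "{k. 1 \<le> pmf p k * s} \<subseteq> {k. 1 \<le> pmf p k * t}" by (auto intro: order_trans)
  then show "real (\<rho> p s) \<le> real (\<rho> p t)"
    by (simp add: rho_eq card_mono finite_rho_set)
qed

lemma rho_measurable [measurable]: "(\<lambda>t. real (\<rho> p t)) \<in> borel_measurable borel"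
  by (rule borel_measurable_mono[OF mono_rho])

lemma filterlim_rho:
  assumes "infinite (set_pmf p)"
  shows "filterlim (\<lambda>t. real (\<rho> p t)) at_top at_top"
  unfolding filterlim_at_top
proof
  fix Z :: real
  obtain F where F: "F \<subseteq> set_pmf p" "finite F" "card F = nat \<lceil>Z\<rceil>"
    using infinite_arbitrarily_large[OF assms] by blast
  have "\<forall>\<^sub>F t in at_top. \<forall>k\<in>F. 1 / pmf p k \<le> t"
    using F(2) by (intro eventually_ball_finite ballI eventually_ge_at_top) auto
  then show "\<forall>\<^sub>F t in at_top. Z \<le> real (\<rho> p t)"
  proof eventually_elim
    case (elim t)
    have "F \<subseteq> {k. 1 \<le> pmf p k * t}" using elim F(1) unfolding rho_set_eq[symmetric] by auto
    then have "card F \<le> \<rho> p t" unfolding rho_eq by (intro card_mono finite_rho_set)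
    then show ?case using F(3) by linarith
  qed
qed

text \<open>The mean number of boxes with at least i balls at time t, for i \<ge> 1; the series
  diverges for i = 0.\<close>

definition tail_mean :: "nat pmf \<Rightarrow> nat \<Rightarrow> real \<Rightarrow> real" where
  "tail_mean p i t = (\<Sum>k. poisson_tail i (pmf p k * t))"

lemma summable_poisson_tail:
  "1 \<le> i \<Longrightarrow> 0 \<le> t \<Longrightarrow> summable (\<lambda>k. poisson_tail i (pmf p k * t))"
  by (rule summable_box[where C=1]) (auto simp: poisson_tail_nonneg poisson_tail_le)

text \<open>Each tail is the Erlang integral up to \<open>pmf p k * t\<close>; after interchanging
  sum and integral, the number of k with \<open>x \<le> pmf p k * t\<close> is
  \<open>\<rho> p (t / x)\<close>. The order starts at 2 because the limit will involve the density
  divided by x, whose integral diverges at 0 for order 1.\<close>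

lemma tail_mean_integral:
  assumes t: "0 < t"
  shows "tail_mean p (l + 2) t = (\<integral>x. erlang_density (Suc l) 1 x * real (\<rho> p (t / x)) \<partial>lborel)"
proof -
  let ?h = "erlang_density (Suc l) 1"
  have "ennreal (tail_mean p (l + 2) t) = (\<Sum>k. ennreal (poisson_tail (l + 2) (pmf p k * t)))"
    unfolding tail_mean_def using t
    by (intro suminf_ennreal2[symmetric] summable_poisson_tail poisson_tail_nonneg) auto
  also have "\<dots> = (\<Sum>k. \<integral>\<^sup>+x. ennreal (?h x) * indicator {..pmf p k * t} x \<partial>lborel)"
    using t by (intro suminf_cong) (simp add: nn_integral_erlang_density poisson_tail_erlang)
  also have "\<dots> = (\<integral>\<^sup>+x. (\<Sum>k. ennreal (?h x) * indicator {..pmf p k * t} x) \<partial>lborel)"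
    by (rule nn_integral_suminf[symmetric]) auto
  also have "\<dots> = (\<integral>\<^sup>+x. ennreal (?h x * real (\<rho> p (t / x))) \<partial>lborel)"
  proof (rule nn_integral_cong)
    fix x :: real
    show "(\<Sum>k. ennreal (?h x) * indicator {..pmf p k * t} x) = ennreal (?h x * real (\<rho> p (t / x)))"
    proof (cases "0 < x")
      case True
      have iff: "1 \<le> pmf p k * (t / x) \<longleftrightarrow> x \<le> pmf p k * t" for k
        using True by (simp add: field_simps)
      define A where "A = {k. 1 \<le> pmf p k * (t / x)}"
      have A: "finite A" "A = {k. x \<le> pmf p k * t}" "\<rho> p (t / x) = card A"
        unfolding A_def iff[symmetric] by (auto simp only: finite_rho_set rho_eq)
      have "(\<Sum>k. ennreal (?h x) * indicator {..pmf p k * t} x) =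
          (\<Sum>k\<in>A. ennreal (?h x) * indicator {..pmf p k * t} x)"
        by (rule suminf_finite[OF A(1)]) (auto simp: A(2))
      also have "\<dots> = (\<Sum>k\<in>A. ennreal (?h x))"
        by (rule sum.cong) (auto simp: A(2))
      also have "\<dots> = ennreal (?h x * real (\<rho> p (t / x)))"
        by (simp add: A(3) ennreal_mult mult.commute ennreal_of_nat_eq_real_of_nat)
      finally show ?thesis .
    next
      case False
      then have "?h x = 0" by (auto simp: erlang_density_def)
      then show ?thesis by simp
    qed
  qed
  finally have eq: "ennreal (tail_mean p (l + 2) t) = (\<integral>\<^sup>+x. ennreal (?h x * real (\<rho> p (t / x))) \<partial>lborel)" .
  have "0 \<le> tail_mean p (l + 2) t"
    unfolding tail_mean_def using t by (intro suminf_nonneg summable_poisson_tail poisson_tail_nonneg) auto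
  then have "tail_mean p (l + 2) t = enn2real (\<integral>\<^sup>+x. ennreal (?h x * real (\<rho> p (t / x))) \<partial>lborel)"
    unfolding eq[symmetric] by simp
  also have "\<dots> = (\<integral>x. ?h x * real (\<rho> p (t / x)) \<partial>lborel)"
    by (rule integral_eq_nn_integral[symmetric]) auto
  finally show ?thesis .
qed

lemma integral_erlang_over_id:
  "(\<integral>x. erlang_density (Suc l) 1 x / x \<partial>lborel) = 1 / real (Suc l)"
proof -
  have "(\<integral>x. erlang_density (Suc l) 1 x / x \<partial>lborel) = (\<integral>x. erlang_density l 1 x / real (Suc l) \<partial>lborel)"
  proof (rule integral_cong_AE)
    show "AE x in lborel. erlang_density (Suc l) 1 x / x = erlang_density l 1 x / real (Suc l)"
      using AE_lborel_singleton[of "0::real"]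
      by eventually_elim (auto simp: erlang_density_def simp del: of_nat_Suc)
  qed auto
  also have "\<dots> = (\<integral>x. erlang_density l 1 x \<partial>lborel) / real (Suc l)" by simp
  also have "(\<integral>x. erlang_density l 1 x \<partial>lborel) = 1"
    by (subst integral_eq_nn_integral)
       (use nn_integral_erlang_ith_moment[of 1 l 0] in auto)
  finally show ?thesis .
qed

lemma integrable_erlang: "integrable lborel (erlang_density l 1)"
  by (rule integrableI_nonneg) (use nn_integral_erlang_ith_moment[of 1 l 0] in auto)

lemma power_interval:
  fixes b c :: real
  assumes b: "1 < b" and c: "1 \<le> c"
  obtains n where "b ^ n \<le> c" "c < b ^ Suc n"
proof -
  define m where "m = (LEAST m. c < b ^ m)"
  obtain n0 :: nat where "c < b ^ n0" using real_arch_pow[OF b] by auto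
  then have m: "c < b ^ m" unfolding m_def by (rule LeastI)
  then obtain n where n: "m = Suc n" using c by (cases m) auto
  have "\<not> c < b ^ n" using not_less_Least[of n "\<lambda>m. c < b ^ m"] n unfolding m_def by simp
  then show ?thesis using m n by (intro that[of n]) auto
qed

text \<open>Regular variation of \<rho> with index 1, expressed without reference to a slowly
  varying function.\<close>

locale regular_pmf =
  fixes p :: "nat pmf"
  assumes inf_support: "infinite (set_pmf p)"
    and rv: "0 < c \<Longrightarrow> ((\<lambda>t. real (\<rho> p (c * t)) / real (\<rho> p t)) \<longlongrightarrow> c) at_top"
begin

abbreviation R :: "real \<Rightarrow> real" where "R t \<equiv> real (\<rho> p t)"

lemma R_at_top: "filterlim R at_top at_top"
  by (rule filterlim_rho[OF inf_support])

lemma R_mono: "s \<le> t \<Longrightarrow> R s \<le> R t"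
  using mono_rho[of p] by (rule monoD)

lemma R_pos: "\<forall>\<^sub>F t in at_top. 0 < R t"
  using R_at_top unfolding filterlim_at_top_dense by blast

lemma R_scale_bounds:
  assumes "0 < c" "a < c" "c < b"
  shows "\<forall>\<^sub>F t in at_top. a * R t \<le> R (c * t) \<and> R (c * t) \<le> b * R t"
  using order_tendstoD(1)[OF rv[OF assms(1)] assms(2)] order_tendstoD(2)[OF rv[OF assms(1)] assms(3)] R_pos
  by eventually_elim (auto simp: field_simps)

text \<open>Iterate \<open>R (4 * t) \<le> 8 * R t\<close>. Since \<open>8 = 4 powr (3 / 2)\<close>,
  the exponent 3/2 results, small enough for \<open>x powr (- 3 / 2)\<close> times an Erlang density
  of order at least 2 to be integrable at 0. Monotonicity interpolates between the powers of 4 at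
  the cost of the leading 8.\<close>

lemma potter: "\<exists>T>0. \<forall>t\<ge>T. \<forall>c\<ge>1. R (c * t) \<le> 8 * (c * sqrt c) * R t"
proof -
  have "\<forall>\<^sub>F t in at_top. R (4 * t) \<le> 8 * R t"
    using R_scale_bounds[of 4 1 8] by (auto elim: eventually_mono)
  then obtain T0 where T0: "\<And>t. T0 \<le> t \<Longrightarrow> R (4 * t) \<le> 8 * R t"
    by (auto simp: eventually_at_top_linorder)
  define T where "T = max 1 T0"
  have it: "R (4 ^ n * t) \<le> 8 ^ n * R t" if t: "T \<le> t" for n t
  proof (induction n)
    case (Suc n)
    have "T0 \<le> 1 * t" "0 \<le> t" using t by (auto simp: T_def)
    then have "T0 \<le> 4 ^ n * t" using mult_right_mono[of 1 "4 ^ n" t] by (simp add: order_trans)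
    then have "R (4 * (4 ^ n * t)) \<le> 8 * R (4 ^ n * t)" by (rule T0)
    then show ?case using Suc by (simp add: mult.assoc)
  qed simp
  show ?thesis
  proof (intro exI[of _ T] conjI allI impI)
    show "0 < T" by (simp add: T_def)
    fix t c :: real assume t: "T \<le> t" and c: "1 \<le> c"
    obtain n where n: "4 ^ n \<le> c" "c < 4 ^ Suc n" using power_interval[of 4, OF _ c] by auto
    have t0: "0 \<le> t" using t by (auto simp: T_def)
    have e: "(8::real) ^ n = 4 ^ n * sqrt (4 ^ n)"
    proof -
      have "sqrt (4 ^ n) = 2 ^ n" by (simp add: real_sqrt_power)
      then show ?thesis by (simp add: power_mult_distrib[symmetric])
    qed
    have "R (c * t) \<le> R (4 ^ Suc n * t)" using n t0 by (intro R_mono mult_right_mono) auto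
    also have "\<dots> \<le> 8 ^ Suc n * R t" by (rule it[OF t])
    also have "\<dots> = 8 * (4 ^ n * sqrt (4 ^ n)) * R t" by (simp add: e)
    also have "\<dots> \<le> 8 * (c * sqrt c) * R t"
      using n by (intro mult_right_mono mult_left_mono mult_mono) auto
    finally show "R (c * t) \<le> 8 * (c * sqrt c) * R t" .
  qed
qed

text \<open>Iterate \<open>2 * R t \<le> R (4 * t)\<close>. The power is far from sharp, but any
  positive power of t has an iterated logarithm equivalent to that of t, and this is all the law of
  the iterated logarithm asks for.\<close>

lemma R_lower:
  obtains C where "0 < C" "\<forall>\<^sub>F t in at_top. C * sqrt t \<le> R t"
proof -
  have "\<forall>\<^sub>F t in at_top. 2 * R t \<le> R (4 * t)"
    using R_scale_bounds[of 4 2 8] by (auto elim: eventually_mono)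
  moreover have "\<forall>\<^sub>F t in at_top. 1 \<le> R t" using R_at_top unfolding filterlim_at_top by blast
  ultimately have "\<forall>\<^sub>F t in at_top. 2 * R t \<le> R (4 * t) \<and> 1 \<le> R t" by eventually_elim auto
  then obtain T0 where T0: "\<And>t. T0 \<le> t \<Longrightarrow> 2 * R t \<le> R (4 * t) \<and> 1 \<le> R t"
    by (auto simp: eventually_at_top_linorder)
  define T where "T = max 1 T0"
  have Tp: "0 < T" by (simp add: T_def)
  have it: "2 ^ n \<le> R (4 ^ n * T)" for n
  proof (induction n)
    case 0 show ?case using T0[of T] by (simp add: T_def)
  next
    case (Suc n)
    have "T0 \<le> 1 * T" "0 \<le> T" by (auto simp: T_def)
    then have "T0 \<le> 4 ^ n * T" using mult_right_mono[of 1 "4 ^ n" T] by (simp add: order_trans)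
    then have "2 * R (4 ^ n * T) \<le> R (4 * (4 ^ n * T))" using T0 by blast
    moreover have "2 * 2 ^ n \<le> 2 * R (4 ^ n * T)" using Suc by (rule mult_left_mono) simp
    ultimately show ?case unfolding power_Suc mult.assoc by (rule order_trans[rotated])
  qed
  show ?thesis
  proof (rule that[of "1 / (2 * sqrt T)"])
    show "0 < 1 / (2 * sqrt T)" using Tp by simp
    have "1 / (2 * sqrt T) * sqrt t \<le> R t" if t: "T \<le> t" for t
    proof -
      have "1 \<le> t / T" using t Tp by (simp add: field_simps)
      then obtain n where n: "4 ^ n \<le> t / T" "t / T < 4 ^ Suc n" using power_interval[of 4 "t / T"] by auto
      have s4: "sqrt (4 ^ Suc n) = 2 ^ Suc n" by (simp only: real_sqrt_power) simp
      have "sqrt (t / T) \<le> 2 ^ Suc n" using n(2) s4 by (metis less_imp_le real_sqrt_le_iff)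
      then have "sqrt (t / T) / 2 \<le> 2 ^ n" by simp
      also have "\<dots> \<le> R (4 ^ n * T)" by (rule it)
      also have "\<dots> \<le> R t" using n(1) Tp by (intro R_mono) (simp add: field_simps)
      finally show ?thesis by (simp add: real_sqrt_divide)
    qed
    then show "\<forall>\<^sub>F t in at_top. 1 / (2 * sqrt T) * sqrt t \<le> R t"
      by (auto simp: eventually_at_top_linorder)
  qed
qed

lemma tail_mean_asymp:
  "((\<lambda>t. tail_mean p (l + 2) t / R t) \<longlongrightarrow> 1 / real (Suc l)) at_top"
proof -
  let ?h = "erlang_density (Suc l) 1"
  obtain T where T: "0 < T" "\<And>t c. T \<le> t \<Longrightarrow> 1 \<le> c \<Longrightarrow> R (c * t) \<le> 8 * (c * sqrt c) * R t"
    using potter by blast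
  \<comment> \<open>The Gamma integrand \<open>x powr (l - 1 / 2) * exp (- x)\<close>: this is what
    the Potter bound leaves of the Erlang density for x \<le> 1. For x \<ge> 1 the density itself is
    a majorant, since \<open>R (t / x) \<le> R t\<close>.\<close>
  define g where "g x = indicator {0..} x * x powr (real l + 1 / 2 - 1) / exp x" for x :: real
  define w where "w x = ?h x + 8 / fact (Suc l) * g x" for x
  have [measurable]: "g \<in> borel_measurable borel" unfolding g_def by measurable
  have g_int: "integrable lborel g"
    by (rule integrableI_nonneg)
       (use Gamma_conv_nn_integral_real[of "real l + 1 / 2"] in \<open>auto simp: g_def less_top[symmetric]\<close>)
  have "((\<lambda>t. \<integral>x. ?h x * R (t / x) / R t \<partial>lborel) \<longlongrightarrow> (\<integral>x. ?h x / x \<partial>lborel)) at_top"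
  proof (rule integral_dominated_convergence_at_top[where w=w])
    show "integrable lborel w" unfolding w_def using g_int integrable_erlang by auto
    show "AE x in lborel. ((\<lambda>t. ?h x * R (t / x) / R t) \<longlongrightarrow> ?h x / x) at_top"
    proof (rule AE_I2)
      fix x :: real
      show "((\<lambda>t. ?h x * R (t / x) / R t) \<longlongrightarrow> ?h x / x) at_top"
      proof (cases "0 < x")
        case True
        have "((\<lambda>t. ?h x * (R (1 / x * t) / R t)) \<longlongrightarrow> ?h x * (1 / x)) at_top"
          using True by (intro tendsto_mult_left rv) auto
        then show ?thesis by (simp add: mult.commute)
      next
        case False
        then have "?h x = 0" by (auto simp: erlang_density_def)
        then show ?thesis by simp
      qed
    qed
    show "\<forall>\<^sub>F t in at_top. AE x in lborel. norm (?h x * R (t / x) / R t) \<le> w x"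
      using R_pos eventually_ge_at_top[of T]
    proof eventually_elim
      fix t assume t: "0 < R t" "T \<le> t"
      have t0: "0 < t" using t T(1) by linarith
      show "AE x in lborel. norm (?h x * R (t / x) / R t) \<le> w x"
      proof (rule AE_I2)
        fix x :: real
        have g0: "0 \<le> g x" by (simp add: g_def)
        consider "x \<le> 0" | "0 < x" "x \<le> 1" | "1 \<le> x" by linarith
        then show "norm (?h x * R (t / x) / R t) \<le> w x"
        proof cases
          case 1
          then have "?h x = 0" by (auto simp: erlang_density_def)
          then show ?thesis using g0 by (simp add: w_def)
        next
          case 2
          have "R (1 / x * t) \<le> 8 * (1 / x * sqrt (1 / x)) * R t" using 2 t by (intro T) auto
          then have "R (t / x) / R t \<le> 8 * (1 / x * sqrt (1 / x))"
            using t by (simp add: pos_divide_le_eq)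
          then have "?h x * (R (t / x) / R t) \<le> ?h x * (8 * (1 / x * sqrt (1 / x)))"
            by (intro mult_left_mono) auto
          then have "?h x * R (t / x) / R t \<le> ?h x * (8 * (1 / x * sqrt (1 / x)))" by simp
          also have "\<dots> = 8 / fact (Suc l) * g x"
          proof -
            have "x * x ^ l = x powr (real l + 1)"
              using 2 by (simp add: powr_realpow[symmetric] powr_add mult.commute)
            moreover have "1 / x * sqrt (1 / x) = x powr (- 3 / 2)"
            proof -
              have "sqrt (1 / x) = x powr (- 1 / 2)"
                using 2 by (simp add: powr_half_sqrt[symmetric] powr_minus_divide powr_divide flip: real_sqrt_divide)
              moreover have "1 / x = x powr (- 1)" using 2 by (simp add: powr_minus_divide)
              ultimately have "1 / x * sqrt (1 / x) = x powr (- 1) * x powr (- 1 / 2)" by simp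
              also have "\<dots> = x powr (- 3 / 2)" by (subst powr_add[symmetric]) simp
              finally show ?thesis .
            qed
            ultimately have "x * x ^ l * (1 / x * sqrt (1 / x)) = x powr (real l + 1 / 2 - 1)"
              by (simp add: powr_add[symmetric])
            then show ?thesis using 2
              by (simp add: erlang_density_def g_def exp_minus field_simps del: fact_Suc)
          qed
          finally show ?thesis using t by (simp add: w_def add_increasing)
        next
          case 3
          have "t / x \<le> t / 1" using 3 t0 by (intro divide_left_mono) auto
          then have "R (t / x) \<le> R t" by (intro R_mono) simp
          then have "R (t / x) / R t \<le> 1" using t by simp
          then have "?h x * (R (t / x) / R t) \<le> ?h x" by (intro mult_left_le) auto
          then show ?thesis using t g0 by (simp add: w_def add_increasing2)
        qed
      qed
    qed
  qed auto
  moreover have "\<forall>\<^sub>F t in at_top. (\<integral>x. ?h x * R (t / x) / R t \<partial>lborel) = tail_mean p (l + 2) t / R t"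
    using eventually_gt_at_top[of 0] by eventually_elim (simp only: tail_mean_integral integral_divide_zero)
  ultimately show ?thesis
    unfolding integral_erlang_over_id by (rule Lim_transform_eventually)
qed

text \<open>Up to a constant, each summand is the difference of two consecutive Poisson tails at
  time \<open>a * t\<close>. The parameter a is 1 for means, 2 for the squares in the variance, and
  large for sums concentrated on boxes with small \<open>pmf p k * t\<close>.\<close>

lemma power_exp_sum_asymp:
  assumes a: "0 < a"
  shows "((\<lambda>t. (\<Sum>k. (pmf p k * t) ^ (n + 2) * exp (- a * (pmf p k * t))) / R t) \<longlongrightarrow> fact n / a ^ (n + 1)) at_top"
proof -
  have at: "filterlim (\<lambda>t. a * t) at_top at_top"
    by (rule filterlim_tendsto_pos_mult_at_top[OF tendsto_const a filterlim_ident])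
  have lim: "((\<lambda>t. fact (n + 2) / a ^ (n + 2) *
      ((tail_mean p (n + 2) (a * t) / R (a * t) - tail_mean p (Suc n + 2) (a * t) / R (a * t)) * (R (a * t) / R t)))
    \<longlongrightarrow> fact (n + 2) / a ^ (n + 2) * ((1 / real (Suc n) - 1 / real (Suc (Suc n))) * a)) at_top"
    by (intro tendsto_intros rv[OF a] filterlim_compose[OF tail_mean_asymp at])
  have "((\<lambda>t. (\<Sum>k. (pmf p k * t) ^ (n + 2) * exp (- a * (pmf p k * t))) / R t)
    \<longlongrightarrow> fact (n + 2) / a ^ (n + 2) * ((1 / real (Suc n) - 1 / real (Suc (Suc n))) * a)) at_top"
  proof (rule Lim_transform_eventually[OF lim])
    have "\<forall>\<^sub>F t in at_top. 0 < R (a * t)" using filterlim_compose[OF R_at_top at] unfolding filterlim_at_top_dense by blast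
    then show "\<forall>\<^sub>F t in at_top. fact (n + 2) / a ^ (n + 2) *
      ((tail_mean p (n + 2) (a * t) / R (a * t) - tail_mean p (Suc n + 2) (a * t) / R (a * t)) * (R (a * t) / R t)) =
      (\<Sum>k. (pmf p k * t) ^ (n + 2) * exp (- a * (pmf p k * t))) / R t"
      using eventually_gt_at_top[of 0]
    proof eventually_elim
      case (elim t)
      have at0: "0 \<le> a * t" using elim a by simp
      have eq: "(pmf p k * t) ^ (n + 2) * exp (- a * (pmf p k * t)) = fact (n + 2) / a ^ (n + 2) *
          (poisson_tail (n + 2) (pmf p k * (a * t)) - poisson_tail (Suc n + 2) (pmf p k * (a * t)))" for k
        using a by (simp add: poisson_tail_Suc power_mult_distrib mult_ac)
      have sumeq: "(\<Sum>k. (pmf p k * t) ^ (n + 2) * exp (- a * (pmf p k * t))) = fact (n + 2) / a ^ (n + 2) *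
          (tail_mean p (n + 2) (a * t) - tail_mean p (Suc n + 2) (a * t))"
        unfolding eq tail_mean_def using at0
        by (subst suminf_mult, intro summable_diff summable_poisson_tail)
           (auto intro!: suminf_diff[symmetric] summable_poisson_tail)
      have gg: "(A / r - B / r) * (r / s) = (A - B) / s" if "r \<noteq> 0" for A B r s :: real
        using that by (simp flip: diff_divide_distrib)
      have "R (a * t) \<noteq> 0" using elim by simp
      from gg[OF this] show ?case by (simp only: sumeq) simp
    qed
  qed
  moreover have "fact (n + 2) / a ^ (n + 2) * ((1 / real (Suc n) - 1 / real (Suc (Suc n))) * a) = fact n / a ^ (n + 1)"
  proof -
    have 1: "1 / real (Suc n) - 1 / real (Suc (Suc n)) = 1 / (real (Suc n) * real (Suc (Suc n)))"
      by (subst diff_frac_eq) simp_all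
    have 2: "(fact (n + 2) :: real) = real (Suc n) * real (Suc (Suc n)) * fact n"
      by (simp add: mult.commute mult.left_commute del: of_nat_Suc)
    have 3: "a ^ (n + 2) = a ^ (n + 1) * a" by simp
    have 4: "x * y * z / (w * a) * (1 / (x * y) * a) = z / w" if "x \<noteq> 0" "y \<noteq> 0" "w \<noteq> 0" for x y z w :: real
      using that a by simp
    show ?thesis unfolding 1 2 3 using a by (intro 4) auto
  qed
  ultimately show ?thesis by simp
qed

lemma summable_pmf_power_exp:
  assumes "0 < a" "0 \<le> t"
  shows "summable (\<lambda>k. (pmf p k * t) ^ Suc n * exp (- a * (pmf p k * t)))"
proof (rule summable_box[where C="fact n / a ^ n", OF _ assms(2)])
  fix x :: real assume x: "0 \<le> x"
  have "(a * x) ^ n / fact n * exp (- (a * x)) \<le> 1"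
    using assms x by (intro poisson_weight_le_1) auto
  then have "x ^ n * exp (- (a * x)) \<le> fact n / a ^ n"
    using assms by (simp add: power_mult_distrib field_simps)
  then have "x * (x ^ n * exp (- (a * x))) \<le> x * (fact n / a ^ n)" using x by (intro mult_left_mono) auto
  then show "\<bar>x ^ Suc n * exp (- a * x)\<bar> \<le> fact n / a ^ n * x"
    using x by (simp add: mult_ac)
qed

text \<open>
  \<open>U t\<close> is the integral of \<open>\<rho> p y / y\<^sup>2\<close> over \<open>{t..}\<close> and thus the
  counterpart of \<open>L_hat\<close> that depends on \<open>p\<close> only.
\<close>

definition U :: "real \<Rightarrow> real" where "U t = (\<Sum>k. min (pmf p k) (1 / t))"

section \<open>Comparison of \<open>U\<close> with \<rho>\<close>

lemma summable_U: "0 < t \<Longrightarrow> summable (\<lambda>k. min (pmf p k) (1 / t))"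
  by (rule summable_comparison_test'[OF summable_pmf[of p], of 0]) auto

lemma sum_of_bool_rho:
  "(\<lambda>k. of_bool (1 \<le> pmf p k * t) :: real) sums R t"
  using sums_If_finite_set[OF finite_rho_set[of p t], of "\<lambda>_. 1::real"]
  by (simp add: rho_eq of_bool_def)

text \<open>Every box with probability at least 1/t loses \<open>1 / t - 1 / (2 * t)\<close> when t
  is doubled, and no other box gains.\<close>

lemma U_diff_lower:
  assumes "0 < t" shows "R t / (2 * t) \<le> U t - U (2 * t)"
proof -
  have "(\<Sum>k. 1 / (2 * t) * of_bool (1 \<le> pmf p k * t)) \<le> (\<Sum>k. min (pmf p k) (1 / t) - min (pmf p k) (1 / (2 * t)))"
  proof (rule suminf_le)
    fix k
    show "1 / (2 * t) * of_bool (1 \<le> pmf p k * t) \<le> min (pmf p k) (1 / t) - min (pmf p k) (1 / (2 * t))"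
    proof (cases "1 \<le> pmf p k * t")
      case True
      then have "1 / t \<le> pmf p k" "1 / (2 * t) \<le> 1 / t" using assms by (auto simp: field_simps)
      then have "min (pmf p k) (1 / t) = 1 / t" "min (pmf p k) (1 / (2 * t)) = 1 / (2 * t)" by auto
      then show ?thesis using True by simp
    next
      case False
      have "1 / (2 * t) \<le> 1 / t" using assms by (auto simp: field_simps)
      then show ?thesis using False by (auto simp: min_def)
    qed
  qed (use assms in \<open>auto intro!: summable_mult summable_diff summable_U sums_summable[OF sum_of_bool_rho]\<close>)
  moreover have "(\<Sum>k. 1 / (2 * t) * of_bool (1 \<le> pmf p k * t)) = 1 / (2 * t) * R t"
    by (intro sums_unique[symmetric] sums_mult sum_of_bool_rho)
  moreover have "(\<Sum>k. min (pmf p k) (1 / t) - min (pmf p k) (1 / (2 * t))) = U t - U (2 * t)"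
    unfolding U_def using assms by (intro suminf_diff[symmetric] summable_U) auto
  ultimately show ?thesis by simp
qed

lemma U_antimono:
  assumes "0 < s" "s \<le> t" shows "U t \<le> U s"
proof -
  have "1 / t \<le> 1 / s" using assms by (simp add: field_simps)
  then show ?thesis unfolding U_def using assms by (intro suminf_le summable_U) auto
qed

lemma U_diff_upper:
  assumes "0 < t" "1 \<le> c" shows "U t - U (c * t) \<le> R (c * t) / t"
proof -
  have ct: "0 < c * t" using assms by simp
  have "(\<Sum>k. min (pmf p k) (1 / t) - min (pmf p k) (1 / (c * t))) \<le> (\<Sum>k. 1 / t * of_bool (1 \<le> pmf p k * (c * t)))"
  proof (rule suminf_le)
    fix k
    show "min (pmf p k) (1 / t) - min (pmf p k) (1 / (c * t)) \<le> 1 / t * of_bool (1 \<le> pmf p k * (c * t))"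
    proof (cases "1 \<le> pmf p k * (c * t)")
      case True
      have "0 \<le> min (pmf p k) (1 / (c * t))" using ct by simp
      then have "min (pmf p k) (1 / t) - min (pmf p k) (1 / (c * t)) \<le> 1 / t" by linarith
      then show ?thesis using True by simp
    next
      case False
      then have "pmf p k \<le> 1 / (c * t)" using ct by (simp add: field_simps)
      then have "min (pmf p k) (1 / (c * t)) = pmf p k" by simp
      then show ?thesis using False by simp
    qed
  qed (use assms ct in \<open>auto intro!: summable_mult summable_diff summable_U sums_summable[OF sum_of_bool_rho]\<close>)
  moreover have "(\<Sum>k. 1 / t * of_bool (1 \<le> pmf p k * (c * t))) = 1 / t * R (c * t)"
    by (intro sums_unique[symmetric] sums_mult sum_of_bool_rho)
  moreover have "(\<Sum>k. min (pmf p k) (1 / t) - min (pmf p k) (1 / (c * t))) = U t - U (c * t)"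
    unfolding U_def using assms ct by (intro suminf_diff[symmetric] summable_U) auto
  ultimately show ?thesis by simp
qed

lemma U_nonneg: "0 < t \<Longrightarrow> 0 \<le> U t"
  unfolding U_def by (intro suminf_nonneg summable_U) auto

lemma U_lower_sum:
  assumes "0 < t" shows "(\<Sum>i<n. R (2 ^ i * t) / 2 ^ i) / 2 \<le> t * U t"
proof -
  have "(\<Sum>i<n. R (2 ^ i * t) / (2 * (2 ^ i * t))) \<le> U t - U (2 ^ n * t)"
  proof (induction n)
    case (Suc n)
    have "R (2 ^ n * t) / (2 * (2 ^ n * t)) \<le> U (2 ^ n * t) - U (2 * (2 ^ n * t))"
      using assms by (intro U_diff_lower) simp
    then show ?case using Suc by (simp add: mult.assoc)
  qed simp
  also have "\<dots> \<le> U t" using U_nonneg[of "2 ^ n * t"] assms by simp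
  finally have "t * (\<Sum>i<n. R (2 ^ i * t) / (2 * (2 ^ i * t))) \<le> t * U t"
    using assms by (intro mult_left_mono) auto
  moreover have "t * (\<Sum>i<n. R (2 ^ i * t) / (2 * (2 ^ i * t))) = (\<Sum>i<n. R (2 ^ i * t) / 2 ^ i) / 2"
    using assms by (simp add: sum_distrib_left sum_divide_distrib mult_ac)
  ultimately show ?thesis by simp
qed

text \<open>Regular variation with index 1 makes all dyadic scales equally important:
  \<open>R (2 ^ i * t) / 2 ^ i\<close> is asymptotic to \<open>R t\<close> for each i. With n scales
  the quotient eventually exceeds n/4, and n is arbitrary.\<close>

lemma U_dominates: "filterlim (\<lambda>t. t * U t / R t) at_top at_top"
  unfolding filterlim_at_top
proof
  fix Z :: real
  obtain n :: nat where "4 * Z \<le> real n" using real_arch_simple by blast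
  then have n: "Z \<le> real n / 4" by simp
  have "((\<lambda>t. (\<Sum>i<n. R (2 ^ i * t) / R t / 2 ^ i) / 2) \<longlongrightarrow> (\<Sum>i<n. 2 ^ i / 2 ^ i) / 2) at_top"
    by (intro tendsto_intros rv) auto
  then have lim: "((\<lambda>t. (\<Sum>i<n. R (2 ^ i * t) / R t / 2 ^ i) / 2) \<longlongrightarrow> real n / 2) at_top" by simp
  show "\<forall>\<^sub>F t in at_top. Z \<le> t * U t / R t"
  proof (cases "n = 0")
    case True
    show ?thesis using R_pos eventually_gt_at_top[of 0]
    proof eventually_elim
      case (elim t)
      have "0 \<le> t * U t / R t" using elim U_nonneg[of t] by simp
      then show ?case using True n by simp
    qed
  next
    case False
    then have "\<forall>\<^sub>F t in at_top. real n / 4 < (\<Sum>i<n. R (2 ^ i * t) / R t / 2 ^ i) / 2"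
      by (intro order_tendstoD(1)[OF lim]) simp
    then show ?thesis using R_pos eventually_gt_at_top[of 0]
    proof eventually_elim
      case (elim t)
      have "(\<Sum>i<n. R (2 ^ i * t) / R t / 2 ^ i) / 2 = (\<Sum>i<n. R (2 ^ i * t) / 2 ^ i) / 2 / R t"
        by (simp add: sum_divide_distrib mult_ac)
      also have "\<dots> \<le> t * U t / R t" using elim by (intro divide_right_mono U_lower_sum) auto
      finally show ?case using elim n by linarith
    qed
  qed
qed

lemma U_pos: "\<forall>\<^sub>F t in at_top. 0 < U t"
proof -
  have "\<forall>\<^sub>F t in at_top. 0 < t * U t / R t"
    using U_dominates unfolding filterlim_at_top_dense by blast
  then show ?thesis using R_pos eventually_gt_at_top[of 0]
    by eventually_elim (auto simp: zero_less_mult_iff zero_less_divide_iff)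
qed

lemma R_over_U: "((\<lambda>t. R t / (t * U t)) \<longlongrightarrow> 0) at_top"
proof -
  have "((\<lambda>t. inverse (t * U t / R t)) \<longlongrightarrow> 0) at_top"
    by (rule tendsto_inverse_0_at_top[OF U_dominates])
  then show ?thesis by (simp add: inverse_eq_divide)
qed

text \<open>For c \<ge> 1 the decrease of \<open>U\<close> from t to \<open>c * t\<close> is at most
  \<open>R (c * t) / t\<close>, of smaller order than \<open>U t\<close>. Values c < 1 follow by
  inverting the quotient at \<open>c * t\<close>.\<close>

lemma U_slowly_varying:
  assumes "0 < c" shows "((\<lambda>t. U (c * t) / U t) \<longlongrightarrow> 1) at_top"
proof -
  have ge1: "((\<lambda>t. U (c * t) / U t) \<longlongrightarrow> 1) at_top" if c: "1 \<le> c" for c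
  proof (rule tendsto_sandwich)
    have "((\<lambda>t. 1 - R (c * t) / R t * (R t / (t * U t))) \<longlongrightarrow> 1 - c * 0) at_top"
      using c by (intro tendsto_intros rv R_over_U) auto
    then show "((\<lambda>t. 1 - R (c * t) / R t * (R t / (t * U t))) \<longlongrightarrow> 1) at_top" by simp
    show "\<forall>\<^sub>F t in at_top. 1 - R (c * t) / R t * (R t / (t * U t)) \<le> U (c * t) / U t"
      using R_pos U_pos eventually_gt_at_top[of 0]
    proof eventually_elim
      case (elim t)
      have "R (c * t) / R t * (R t / (t * U t)) = R (c * t) / t / U t" using elim by simp
      moreover have "(U t - R (c * t) / t) / U t \<le> U (c * t) / U t"
        using U_diff_upper[of t c] elim c by (intro divide_right_mono) auto
      moreover have "(U t - R (c * t) / t) / U t = 1 - R (c * t) / t / U t"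
        using elim by (simp add: diff_divide_distrib)
      ultimately show ?case by linarith
    qed
    show "\<forall>\<^sub>F t in at_top. U (c * t) / U t \<le> 1"
      using U_pos eventually_gt_at_top[of 0]
    proof eventually_elim
      case (elim t)
      have "1 * t \<le> c * t" using c elim by (intro mult_right_mono) auto
      then show ?case using U_antimono[of t "c * t"] elim by simp
    qed
  qed auto
  show ?thesis
  proof (cases "1 \<le> c")
    case False
    have fl: "filterlim (\<lambda>t. c * t) at_top at_top"
      by (rule filterlim_tendsto_pos_mult_at_top[OF tendsto_const assms filterlim_ident])
    have "((\<lambda>t. inverse (U (1 / c * (c * t)) / U (c * t))) \<longlongrightarrow> inverse 1) at_top"
      using False assms by (intro tendsto_inverse filterlim_compose[OF ge1 fl]) auto
    then show ?thesis using assms by simp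
  qed (rule ge1)
qed

section \<open>The mean number of boxes with exactly one ball\<close>

definition occ1_mean :: "real \<Rightarrow> real" where
  "occ1_mean t = (\<Sum>k. (pmf p k * t) * exp (- (pmf p k * t)))"

text \<open>Replace \<open>y * exp (- y)\<close> by \<open>min y 1\<close>. For y \<le> 1 the error
  is at most \<open>y\<^sup>2\<close>, hence at most \<open>3 * (y\<^sup>2 * exp (- y))\<close>
  because e \<le> 3; for y \<ge> 1 it is at most 1, and \<open>R t\<close> counts these boxes. Both
  errors have the order of \<rho>, which is negligible against \<open>t * U t\<close>.\<close>

lemma occ1_mean_approx:
  assumes "0 < t"
  shows "\<bar>occ1_mean t - t * U t\<bar> \<le> 3 * (\<Sum>k. (pmf p k * t) ^ 2 * exp (- (pmf p k * t))) + R t"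
proof -
  define x where "x k = pmf p k * t" for k
  have x0: "0 \<le> x k" for k using assms by (simp add: x_def)
  have s1: "summable (\<lambda>k. x k * exp (- x k))"
    using summable_pmf_power_exp[of 1 t 0] assms by (simp add: x_def)
  have s2: "summable (\<lambda>k. (x k)\<^sup>2 * exp (- x k))"
    using summable_pmf_power_exp[of 1 t 1] assms by (simp add: x_def numeral_2_eq_2)
  have minx: "t * min (pmf p k) (1 / t) = min (x k) 1" for k
    using assms by (auto simp: min_def x_def field_simps)
  have s3: "summable (\<lambda>k. min (x k) 1)"
    using summable_mult[OF summable_U[OF assms], of t] by (simp add: minx)
  have tU: "t * U t = (\<Sum>k. min (x k) 1)"
    unfolding U_def using suminf_mult[OF summable_U[OF assms], of t] by (simp add: minx)
  have pt: "\<bar>y * exp (- y) - min y 1\<bar> \<le> 3 * (y\<^sup>2 * exp (- y)) + of_bool (1 \<le> y)" if "0 \<le> y" for y :: real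
  proof (cases "y \<le> 1")
    case True
    have "1 - exp (- y) \<le> y" using exp_ge_add_one_self[of "- y"] by simp
    then have "y * (1 - exp (- y)) \<le> y * y" using that by (intro mult_left_mono) auto
    also have "\<dots> \<le> y * y * (3 * exp (- y))"
    proof -
      have "exp y \<le> exp 1" using True by simp
      then have "exp y \<le> 3" using exp_le by linarith
      then have "1 \<le> 3 * exp (- y)" by (simp add: exp_minus field_simps)
      then show ?thesis using mult_left_mono[of 1 "3 * exp (- y)" "y * y"] by simp
    qed
    finally have "y - y * exp (- y) \<le> 3 * (y\<^sup>2 * exp (- y))" by (simp add: power2_eq_square algebra_simps)
    moreover have "y * exp (- y) \<le> y" using that by (intro mult_left_le) auto
    moreover have "0 \<le> 3 * (y\<^sup>2 * exp (- y))" by simp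
    ultimately show ?thesis using True by (auto simp: abs_if)
  next
    case False
    have "y \<le> exp y" using exp_ge_add_one_self[of y] by linarith
    then have "y * exp (- y) \<le> 1" by (simp add: exp_minus field_simps)
    moreover have "0 \<le> y * exp (- y)" using that by simp
    moreover have "0 \<le> y\<^sup>2 * exp (- y)" by simp
    moreover have "min y 1 = 1" "of_bool (1 \<le> y) = (1::real)" using False by auto
    ultimately show ?thesis unfolding abs_le_iff by linarith
  qed
  have sd: "summable (\<lambda>k. 3 * ((x k)\<^sup>2 * exp (- x k)) + of_bool (1 \<le> x k))"
    using s2 sums_summable[OF sum_of_bool_rho[of t]] by (intro summable_add summable_mult) (auto simp: x_def)
  have sn: "summable (\<lambda>k. \<bar>x k * exp (- x k) - min (x k) 1\<bar>)"
    by (rule summable_comparison_test'[OF sd, of 0]) (use pt x0 in auto)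
  have "occ1_mean t - t * U t = (\<Sum>k. x k * exp (- x k) - min (x k) 1)"
    unfolding tU occ1_mean_def x_def[symmetric] by (rule suminf_diff[OF s1 s3])
  also have "\<bar>\<dots>\<bar> \<le> (\<Sum>k. \<bar>x k * exp (- x k) - min (x k) 1\<bar>)"
    by (rule summable_rabs[OF sn])
  also have "\<dots> \<le> (\<Sum>k. 3 * ((x k)\<^sup>2 * exp (- x k)) + of_bool (1 \<le> x k))"
    by (rule suminf_le[OF pt[OF x0] sn sd])
  also have "\<dots> = 3 * (\<Sum>k. (x k)\<^sup>2 * exp (- x k)) + R t"
    using sums_add[OF sums_mult[OF summable_sums[OF s2], of 3] sum_of_bool_rho[of t]]
    by (simp add: x_def sums_iff)
  finally show ?thesis by (simp add: x_def)
qed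

lemma occ1_mean_asymp: "((\<lambda>t. occ1_mean t / (t * U t)) \<longlongrightarrow> 1) at_top"
proof -
  let ?Q = "\<lambda>t. \<Sum>k. (pmf p k * t) ^ 2 * exp (- (pmf p k * t))"
  have "((\<lambda>t. ?Q t / R t) \<longlongrightarrow> 1) at_top" using power_exp_sum_asymp[of 1 0] by (simp add: numeral_2_eq_2)
  then have "((\<lambda>t. (3 * (?Q t / R t) + 1) * (R t / (t * U t))) \<longlongrightarrow> (3 * 1 + 1) * 0) at_top"
    by (intro tendsto_intros R_over_U)
  then have lim: "((\<lambda>t. (3 * (?Q t / R t) + 1) * (R t / (t * U t))) \<longlongrightarrow> 0) at_top" by simp
  have "((\<lambda>t. occ1_mean t / (t * U t) - 1) \<longlongrightarrow> 0) at_top"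
  proof (rule Lim_null_comparison[OF _ lim])
    show "\<forall>\<^sub>F t in at_top. norm (occ1_mean t / (t * U t) - 1) \<le> (3 * (?Q t / R t) + 1) * (R t / (t * U t))"
      using R_pos U_pos eventually_gt_at_top[of 0]
    proof eventually_elim
      case (elim t)
      have tu: "0 < t * U t" using elim by simp
      have "occ1_mean t / (t * U t) - 1 = (occ1_mean t - t * U t) / (t * U t)"
        using elim by (simp add: diff_divide_distrib)
      then have "norm (occ1_mean t / (t * U t) - 1) = \<bar>occ1_mean t - t * U t\<bar> / (t * U t)"
        using tu by (simp add: abs_divide)
      also have "\<dots> \<le> (3 * ?Q t + R t) / (t * U t)"
        using elim tu by (intro divide_right_mono occ1_mean_approx) auto
      also have "\<dots> = (3 * (?Q t / R t) + 1) * (R t / (t * U t))" using elim by (simp add: field_simps)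
      finally show ?case .
    qed
  qed
  then show ?thesis by (rule LIM_zero_cancel)
qed

end

section \<open>Deviations of the occupancy counts\<close>

definition poisson_weight :: "nat \<Rightarrow> real \<Rightarrow> real" where
  "poisson_weight j x = x ^ j / fact j * exp (- x)"

lemma poisson_weight_tail: "poisson_weight j x = poisson_tail j x - poisson_tail (Suc j) x"
  by (simp add: poisson_weight_def poisson_tail_Suc)

lemma poisson_weight_nonneg: "0 \<le> x \<Longrightarrow> 0 \<le> poisson_weight j x"
  by (simp add: poisson_weight_def)

lemma poisson_weight_le: "1 \<le> j \<Longrightarrow> 0 \<le> x \<Longrightarrow> poisson_weight j x \<le> x"
  using poisson_tail_le[of j x] poisson_tail_nonneg[of x "Suc j"] by (simp add: poisson_weight_tail)

lemma poisson_weight_le_one: "0 \<le> x \<Longrightarrow> poisson_weight j x \<le> 1"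
  using poisson_weight_le_1[of x j] by (simp add: poisson_weight_def)

lemma pmf_pois_law_weight: "0 \<le> x \<Longrightarrow> pmf (pois_law x) j = poisson_weight j x"
  by (simp add: pmf_pois_law poisson_weight_def)

lemma prob_pois_law_atLeast: "0 \<le> x \<Longrightarrow> measure_pmf.prob (pois_law x) {i..} = poisson_tail i x"
proof -
  assume x: "0 \<le> x"
  have "{i..} = UNIV - {..<i}" by auto
  then have "measure_pmf.prob (pois_law x) {i..} = 1 - measure_pmf.prob (pois_law x) {..<i}"
    using measure_pmf.prob_compl[of "{..<i}" "pois_law x"] by simp
  then show ?thesis
    using x by (simp add: measure_measure_pmf_finite pmf_pois_law poisson_tail_def)
qed

lemma summable_poisson_weight:
  "1 \<le> j \<Longrightarrow> 0 \<le> t \<Longrightarrow> summable (\<lambda>k. poisson_weight j (pmf p k * t))"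
  by (rule summable_box[where C=1]) (auto simp: poisson_weight_nonneg poisson_weight_le)

definition weight_mean :: "nat pmf \<Rightarrow> nat \<Rightarrow> real \<Rightarrow> real" where
  "weight_mean p j t = (\<Sum>k. poisson_weight j (pmf p k * t))"

definition weight_var :: "nat pmf \<Rightarrow> nat \<Rightarrow> real \<Rightarrow> real" where
  "weight_var p j t = (\<Sum>k. poisson_weight j (pmf p k * t) * (1 - poisson_weight j (pmf p k * t)))"

lemma (in bernoulli_family) occ_lower_tail:
  assumes A: "finite A" "\<And>k \<omega>. B k \<omega> \<Longrightarrow> k \<in> A"
    and d: "0 < \<delta>" "\<delta> \<le> 1" and t: "0 < \<theta>" "\<theta> \<le> \<delta>\<^sup>2 / 40" and big: "8 \<le> \<delta>\<^sup>2 * (\<theta>\<^sup>2 * occ_var)"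
  shows "exp (- (1 + 4 * \<delta>) * (\<theta>\<^sup>2 * occ_var / 2))
    \<le> prob {\<omega> \<in> space M. (1 - \<delta>) * (\<theta> * occ_var) \<le> occ \<omega> - occ_mean}"
proof -
  obtain n where n: "A \<subseteq> {..<n}" using finite_nat_bounded[OF A(1)] by auto
  have q0: "q k = 0" if "\<not> k < n" for k
  proof -
    have e: "{\<omega> \<in> space M. B k \<omega>} = {}" using A(2) n that by blast
    show ?thesis unfolding q_def e by simp
  qed
  have v: "occ_var = (\<Sum>k<n. q k * (1 - q k))" "occ_mean = (\<Sum>k<n. q k)"
  proof -
    have z: "q k * (1 - q k) = 0" "q k = 0" if "k \<notin> {..<n}" for k using q0[of k] that by auto
    show "occ_var = (\<Sum>k<n. q k * (1 - q k))" unfolding occ_var_def by (rule suminf_finite[OF _ z(1)]) auto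
    show "occ_mean = (\<Sum>k<n. q k)" unfolding occ_mean_def by (rule suminf_finite[OF _ z(2)]) auto
  qed
  have "psum n \<omega> = occ \<omega>" for \<omega>
  proof -
    have "{..<n} \<inter> {k. B k \<omega>} = {k. B k \<omega>}" using A(2) n by blast
    then show ?thesis by (simp add: psum_def occ_def of_bool_def sum.If_cases)
  qed
  then show ?thesis using psum_lower_tail[OF d t, of n] big unfolding v by simp
qed

section \<open>Poisson probabilities and deviation bounds for the counts\<close>

context poissonized_karlin_scheme
begin

lemma prob_balls:
  assumes "0 < t"
  shows "prob {\<omega> \<in> space M. balls k t \<omega> \<in> A} = measure_pmf.prob (pois_law (pmf p k * t)) A"
proof -
  have "prob {\<omega> \<in> space M. balls k t \<omega> \<in> A} = prob (balls k t -` A \<inter> space M)"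
    by (intro arg_cong[where f=prob]) auto
  also have "\<dots> = measure (distr M (count_space UNIV) (balls k t)) A"
    by (rule measure_distr[symmetric]) auto
  also have "\<dots> = measure_pmf.prob (pois_law (pmf p k * t)) A" by (simp add: balls_distr[OF assms])
  finally show ?thesis .
qed

lemma prob_balls_eq: "0 < t \<Longrightarrow> prob {\<omega> \<in> space M. balls k t \<omega> = j} = poisson_weight j (pmf p k * t)"
  using prob_balls[of t k "{j}"] by (simp add: measure_pmf_single pmf_pois_law_weight)

lemma prob_balls_ge: "0 < t \<Longrightarrow> prob {\<omega> \<in> space M. i \<le> balls k t \<omega>} = poisson_tail i (pmf p k * t)"
  using prob_balls[of t k "{i..}"] by (simp add: prob_pois_law_atLeast)

text \<open>One condition, free of t, under which all counts are finite and monotone in time; the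
  exceptional null set is thus the same for all times.\<close>

definition regular_outcome :: "'a \<Rightarrow> bool" where
  "regular_outcome \<omega> \<longleftrightarrow> filterlim (\<lambda>n. S n \<omega>) at_top sequentially"

lemma AE_regular: "AE \<omega> in M. regular_outcome \<omega>"
  using AE_arrivals by eventually_elim (simp add: regular_outcome_def)

lemma balls_mono:
  assumes "regular_outcome \<omega>" "s \<le> t"
  shows "balls k s \<omega> \<le> balls k t \<omega>"
  unfolding balls_in_box_def
  by (intro card_mono finite_subset[OF _ finite_arrivals[of "\<lambda>n. S n \<omega>" t]])
     (use assms in \<open>auto simp: regular_outcome_def\<close>)

lemma finite_occupied:
  assumes "regular_outcome \<omega>" "1 \<le> i"
  shows "finite {k. i \<le> balls k t \<omega>}"
proof (rule finite_subset)
  have fin: "finite {n. S n \<omega> \<le> t}" using assms(1) finite_arrivals by (simp add: regular_outcome_def)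
  show "finite ((\<lambda>n. X n \<omega>) ` {n. S n \<omega> \<le> t})" using fin by simp
  show "{k. i \<le> balls k t \<omega>} \<subseteq> (\<lambda>n. X n \<omega>) ` {n. S n \<omega> \<le> t}"
  proof
    fix k assume "k \<in> {k. i \<le> balls k t \<omega>}"
    then have "card {n. S n \<omega> \<le> t \<and> X n \<omega> = k} \<noteq> 0" using assms(2) by (simp add: balls_in_box_def)
    then have "{n. S n \<omega> \<le> t \<and> X n \<omega> = k} \<noteq> {}" by force
    then show "k \<in> (\<lambda>n. X n \<omega>) ` {n. S n \<omega> \<le> t}" by auto
  qed
qed

definition K_ge :: "nat \<Rightarrow> real \<Rightarrow> 'a \<Rightarrow> real" where
  "K_ge i t \<omega> = real (card {k. i \<le> balls k t \<omega>})"

lemma K_ge_measurable [measurable]: "K_ge i t \<in> borel_measurable M"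
  unfolding K_ge_def by measurable

lemma K_ge_increment:
  assumes "regular_outcome \<omega>" "1 \<le> i" "s \<le> t"
  shows "K_ge i t \<omega> - K_ge i s \<omega> = real (card {k. balls k s \<omega> < i \<and> i \<le> balls k t \<omega>})"
proof -
  have sub: "{k. i \<le> balls k s \<omega>} \<subseteq> {k. i \<le> balls k t \<omega>}"
    using balls_mono[OF assms(1,3)] by (auto intro: order_trans)
  have "{k. balls k s \<omega> < i \<and> i \<le> balls k t \<omega>} = {k. i \<le> balls k t \<omega>} - {k. i \<le> balls k s \<omega>}"
    by auto
  then have "card {k. balls k s \<omega> < i \<and> i \<le> balls k t \<omega>} = card {k. i \<le> balls k t \<omega>} - card {k. i \<le> balls k s \<omega>}"
    using card_Diff_subset[OF finite_occupied[OF assms(1,2)] sub] by simp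
  moreover have "card {k. i \<le> balls k s \<omega>} \<le> card {k. i \<le> balls k t \<omega>}"
    by (rule card_mono[OF finite_occupied[OF assms(1,2)] sub])
  ultimately show ?thesis by (simp add: K_ge_def of_nat_diff)
qed

lemma K_ge_mono:
  assumes "regular_outcome \<omega>" "1 \<le> i" "s \<le> t"
  shows "K_ge i s \<omega> \<le> K_ge i t \<omega>"
  using K_ge_increment[OF assms] by simp

lemma K_star_K_ge:
  assumes "regular_outcome \<omega>" "1 \<le> j"
  shows "K_star S X j t \<omega> = K_ge j t \<omega> - K_ge (Suc j) t \<omega>"
proof -
  have sub: "{k. Suc j \<le> balls k t \<omega>} \<subseteq> {k. j \<le> balls k t \<omega>}" by auto
  have eq: "{k. balls k t \<omega> = j} = {k. j \<le> balls k t \<omega>} - {k. Suc j \<le> balls k t \<omega>}" by auto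
  have "finite {k. Suc j \<le> balls k t \<omega>}" by (rule finite_occupied[OF assms(1)]) simp
  then have "card {k. balls k t \<omega> = j} = card {k. j \<le> balls k t \<omega>} - card {k. Suc j \<le> balls k t \<omega>}"
    unfolding eq by (rule card_Diff_subset[OF _ sub])
  moreover have "card {k. Suc j \<le> balls k t \<omega>} \<le> card {k. j \<le> balls k t \<omega>}"
    by (rule card_mono[OF finite_occupied[OF assms] sub])
  ultimately show ?thesis by (simp add: K_star_def K_ge_def of_nat_diff)
qed

lemma weight_family:
  assumes t: "0 < t" and j: "1 \<le> j"
  shows "bernoulli_family M (\<lambda>k \<omega>. balls k t \<omega> = j)"
proof
  define \<tau> where "\<tau> i = real i * t" for i
  have \<tau>: "\<tau> 0 = 0" "strict_mono \<tau>" using t by (auto simp: \<tau>_def strict_mono_def)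
  have "indep_vars (\<lambda>_. count_space UNIV) (\<lambda>k \<omega>. map (\<lambda>i. balls k (\<tau> i) \<omega>) [0..<2] ! 1 = j) UNIV"
    by (rule indep_vars_compose2[OF box_histories_indep[OF \<tau>, of "\<lambda>_. 2"], where Y="\<lambda>_ xs. xs ! 1 = j"]) auto
  then show "indep_vars (\<lambda>_. count_space UNIV) (\<lambda>k \<omega>. balls k t \<omega> = j) UNIV"
    by (simp add: \<tau>_def)
  show "summable (\<lambda>k. prob {\<omega> \<in> space M. balls k t \<omega> = j})"
    using t j by (simp add: prob_balls_eq summable_poisson_weight)
qed

lemma
  assumes t: "0 < t" and j: "1 \<le> j"
  shows expectation_K_star: "expectation (K_star S X j t) = weight_mean p j t"
    and variance_K_star: "variance (K_star S X j t) = weight_var p j t"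
proof -
  interpret F: bernoulli_family M "\<lambda>k \<omega>. balls k t \<omega> = j" by (rule weight_family[OF assms])
  have q: "F.q k = poisson_weight j (pmf p k * t)" for k
    unfolding F.q_def by (rule prob_balls_eq[OF t])
  have o: "F.occ = K_star S X j t" by (auto simp: F.occ_def K_star_def)
  show "expectation (K_star S X j t) = weight_mean p j t"
    using F.expectation_occ unfolding o F.occ_mean_def weight_mean_def q .
  show "variance (K_star S X j t) = weight_var p j t"
    using F.variance_occ unfolding o F.occ_var_def weight_var_def q .
qed

text \<open>The set A is \<open>UNIV\<close> at the grid points of the upper half and the complement
  of a block in the lower half; there D is only a fraction of the full variance.\<close>

lemma chernoff_weight:
  assumes t: "0 < t" and j: "1 \<le> j" and th: "0 < \<theta>" "\<theta> \<le> 1" and D: "(\<Sum>k. of_bool (k \<in> A) * poisson_weight j (pmf p k * t) * (1 - poisson_weight j (pmf p k * t))) \<le> D"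
  shows "prob {\<omega> \<in> space M. y \<le> \<bar>real (card {k \<in> A. balls k t \<omega> = j}) - (\<Sum>k. of_bool (k \<in> A) * poisson_weight j (pmf p k * t))\<bar>}
    \<le> 2 * exp (- \<theta> * y + D * (\<theta>\<^sup>2 / 2 * (1 + 2 * \<theta>)))"
proof -
  interpret F0: bernoulli_family M "\<lambda>k \<omega>. balls k t \<omega> = j" by (rule weight_family[OF t j])
  interpret F: bernoulli_family M "\<lambda>k \<omega>. k \<in> A \<and> balls k t \<omega> = j" by (rule F0.restrict)
  have q: "F.q k = of_bool (k \<in> A) * poisson_weight j (pmf p k * t)" for k
    by (cases "k \<in> A") (auto simp: F.q_def prob_balls_eq[OF t])
  have v: "F.occ_var = (\<Sum>k. of_bool (k \<in> A) * poisson_weight j (pmf p k * t) * (1 - poisson_weight j (pmf p k * t)))"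
    unfolding F.occ_var_def q by (intro suminf_cong) auto
  have "prob {\<omega> \<in> space M. y \<le> \<bar>F.occ \<omega> - F.occ_mean\<bar>} \<le> 2 * exp (- \<theta> * y + F.occ_var * (\<theta>\<^sup>2 / 2 * (1 + 2 * \<theta>)))"
    by (rule F.chernoff[OF th])
  also have "\<dots> \<le> 2 * exp (- \<theta> * y + D * (\<theta>\<^sup>2 / 2 * (1 + 2 * \<theta>)))"
    using D th unfolding v by (auto intro!: mult_right_mono)
  finally show ?thesis unfolding F.occ_mean_def q F.occ_def .
qed

lemma increment_family:
  assumes s: "0 < s" "s < t" and i: "1 \<le> i"
  shows "bernoulli_family M (\<lambda>k \<omega>. balls k s \<omega> < i \<and> i \<le> balls k t \<omega>)"
    and "prob {\<omega> \<in> space M. balls k s \<omega> < i \<and> i \<le> balls k t \<omega>} = poisson_tail i (pmf p k * t) - poisson_tail i (pmf p k * s)"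
proof -
  \<comment> \<open>Only the times 0, s and t are used; unit steps continue them to an infinite
    strictly increasing sequence.\<close>
  define \<tau> where "\<tau> i = (if i = 0 then 0 else if i = 1 then s else t + real (i - 2))" for i :: nat
  have \<tau>: "\<tau> 0 = 0" "strict_mono \<tau>"
    using s by (auto simp: \<tau>_def strict_mono_Suc_iff Suc_diff_le)
  have [simp]: "\<tau> 1 = s" "\<tau> (Suc 0) = s" "\<tau> 2 = t" "\<tau> (Suc (Suc 0)) = t" by (simp_all add: \<tau>_def)
  have "indep_vars (\<lambda>_. count_space UNIV) (\<lambda>k \<omega>. map (\<lambda>i. balls k (\<tau> i) \<omega>) [0..<3] ! 1 < i \<and> i \<le> map (\<lambda>i. balls k (\<tau> i) \<omega>) [0..<3] ! 2) UNIV"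
    by (rule indep_vars_compose2[OF box_histories_indep[OF \<tau>, of "\<lambda>_. 3"], where Y="\<lambda>_ xs. xs ! 1 < i \<and> i \<le> xs ! 2"]) auto
  then have ind: "indep_vars (\<lambda>_. count_space UNIV) (\<lambda>k \<omega>. balls k s \<omega> < i \<and> i \<le> balls k t \<omega>) UNIV"
    by simp
  show pr: "prob {\<omega> \<in> space M. balls k s \<omega> < i \<and> i \<le> balls k t \<omega>} = poisson_tail i (pmf p k * t) - poisson_tail i (pmf p k * s)" for k
  proof -
    have "prob {\<omega> \<in> space M. i \<le> balls k t \<omega>} =
        prob ({\<omega> \<in> space M. balls k s \<omega> < i \<and> i \<le> balls k t \<omega>} \<union> {\<omega> \<in> space M. i \<le> balls k s \<omega>})"
    proof (rule finite_measure_eq_AE)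
      show "AE \<omega> in M. \<omega> \<in> {\<omega> \<in> space M. i \<le> balls k t \<omega>} \<longleftrightarrow>
          \<omega> \<in> {\<omega> \<in> space M. balls k s \<omega> < i \<and> i \<le> balls k t \<omega>} \<union> {\<omega> \<in> space M. i \<le> balls k s \<omega>}"
        using AE_regular
      proof eventually_elim
        case (elim \<omega>)
        have "balls k s \<omega> \<le> balls k t \<omega>" by (rule balls_mono[OF elim]) (use s in simp)
        then show ?case by auto
      qed
    qed auto
    also have "\<dots> = prob {\<omega> \<in> space M. balls k s \<omega> < i \<and> i \<le> balls k t \<omega>} + prob {\<omega> \<in> space M. i \<le> balls k s \<omega>}"
      by (rule finite_measure_Union) auto
    finally show ?thesis using s by (simp add: prob_balls_ge)
  qed
  show "bernoulli_family M (\<lambda>k \<omega>. balls k s \<omega> < i \<and> i \<le> balls k t \<omega>)"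
  proof
    show "summable (\<lambda>k. prob {\<omega> \<in> space M. balls k s \<omega> < i \<and> i \<le> balls k t \<omega>})"
      unfolding pr using s i by (intro summable_diff summable_poisson_tail) auto
  qed (rule ind)
qed

text \<open>A sum of independent indicators has variance at most its mean, so a bound on the
  increment of the means, which is easy to differentiate in time, takes the place of the
  variance.\<close>

lemma chernoff_increment:
  assumes s: "0 < s" "s < t" and i: "1 \<le> i" and th: "0 < \<theta>" "\<theta> \<le> 1"
    and D: "tail_mean p i t - tail_mean p i s \<le> D"
  shows "prob {\<omega> \<in> space M. y \<le> \<bar>(K_ge i t \<omega> - tail_mean p i t) - (K_ge i s \<omega> - tail_mean p i s)\<bar>}
    \<le> 2 * exp (- \<theta> * y + D * (\<theta>\<^sup>2 / 2 * (1 + 2 * \<theta>)))"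
proof -
  interpret F: bernoulli_family M "\<lambda>k \<omega>. balls k s \<omega> < i \<and> i \<le> balls k t \<omega>"
    by (rule increment_family[OF s i])
  have q: "F.q k = poisson_tail i (pmf p k * t) - poisson_tail i (pmf p k * s)" for k
    unfolding F.q_def by (rule increment_family[OF s i])
  have m: "F.occ_mean = tail_mean p i t - tail_mean p i s"
    unfolding F.occ_mean_def q tail_mean_def
    using s i by (intro suminf_diff[symmetric] summable_poisson_tail) auto
  have "F.occ_var \<le> F.occ_mean"
    unfolding F.occ_var_def F.occ_mean_def
    by (intro suminf_le F.summable_qv F.summable_q) (auto simp: F.q_bounds mult_left_le)
  then have v: "F.occ_var \<le> D" using D m by simp
  have "prob {\<omega> \<in> space M. y \<le> \<bar>(K_ge i t \<omega> - tail_mean p i t) - (K_ge i s \<omega> - tail_mean p i s)\<bar>}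
      = prob {\<omega> \<in> space M. y \<le> \<bar>F.occ \<omega> - F.occ_mean\<bar>}"
  proof (rule finite_measure_eq_AE)
    show "AE \<omega> in M. \<omega> \<in> {\<omega> \<in> space M. y \<le> \<bar>(K_ge i t \<omega> - tail_mean p i t) - (K_ge i s \<omega> - tail_mean p i s)\<bar>} \<longleftrightarrow>
        \<omega> \<in> {\<omega> \<in> space M. y \<le> \<bar>F.occ \<omega> - F.occ_mean\<bar>}"
      using AE_regular
    proof eventually_elim
      case (elim \<omega>)
      have "(K_ge i t \<omega> - tail_mean p i t) - (K_ge i s \<omega> - tail_mean p i s) = F.occ \<omega> - F.occ_mean"
        using K_ge_increment[OF elim i, of s t] s by (simp add: F.occ_def m)
      then show ?case by simp
    qed
  qed auto
  also have "\<dots> \<le> 2 * exp (- \<theta> * y + F.occ_var * (\<theta>\<^sup>2 / 2 * (1 + 2 * \<theta>)))"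
    by (rule F.chernoff[OF th])
  also have "\<dots> \<le> 2 * exp (- \<theta> * y + D * (\<theta>\<^sup>2 / 2 * (1 + 2 * \<theta>)))"
    using v th by (auto intro!: mult_right_mono)
  finally show ?thesis .
qed

lemma block_events_indep:
  fixes t :: "nat \<Rightarrow> real" and A :: "nat \<Rightarrow> nat set" and P :: "nat \<Rightarrow> real \<Rightarrow> bool"
  assumes t: "0 < t 0" "strict_mono t" and A: "\<And>n. finite (A n)" "disjoint_family A"
  shows "indep_vars (\<lambda>_. count_space UNIV) (\<lambda>n \<omega>. P n (real (card {k \<in> A n. balls k (t n) \<omega> = j}))) UNIV"
proof -
  \<comment> \<open>The sequence t preceded by time 0: the time of block n has index n + 1, so a
    history of length n + 2 reaches it.\<close>
  define \<tau> where "\<tau> i = (case i of 0 \<Rightarrow> 0 | Suc n \<Rightarrow> t n)" for i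
  have \<tau>: "\<tau> 0 = 0" "strict_mono \<tau>"
    using t by (auto simp: \<tau>_def strict_mono_Suc_iff split: nat.splits)
  \<comment> \<open>The blocks are disjoint, so the block of a box is unique; boxes in no block
    receive an arbitrary index whose value never matters.\<close>
  define idx where "idx k = (SOME n. k \<in> A n)" for k
  have idx: "idx k = n" if "k \<in> A n" for k n
  proof -
    have "k \<in> A (idx k)" unfolding idx_def by (rule someI[of "\<lambda>n. k \<in> A n", OF that])
    then show ?thesis using A(2) that unfolding disjoint_family_on_def by blast
  qed
  have "indep_vars (\<lambda>_. count_space UNIV) (\<lambda>k \<omega>. map (\<lambda>i. balls k (\<tau> i) \<omega>) [0..<idx k + 2] ! (idx k + 1)) UNIV"
    by (rule indep_vars_compose2[OF box_histories_indep[OF \<tau>, of "\<lambda>k. idx k + 2"], where Y="\<lambda>k xs. xs ! (idx k + 1)"]) auto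
  then have ind: "indep_vars (\<lambda>_. count_space UNIV) (\<lambda>k \<omega>. balls k (t (idx k)) \<omega>) UNIV"
    by (simp add: \<tau>_def del: upt_Suc)
  have "indep_vars (\<lambda>n. PiM (A n) (\<lambda>_. count_space UNIV)) (\<lambda>n \<omega>. restrict (\<lambda>k. balls k (t (idx k)) \<omega>) (A n)) UNIV"
    by (rule indep_vars_restrict[OF ind _ A(2)]) auto
  then have "indep_vars (\<lambda>_. count_space UNIV)
      (\<lambda>n \<omega>. (\<lambda>f. P n (real (card {k \<in> A n. f k = j}))) (restrict (\<lambda>k. balls k (t (idx k)) \<omega>) (A n))) UNIV"
    by (rule indep_vars_compose2) (auto simp: count_space_PiM_finite A(1))
  moreover have "{k \<in> A n. restrict (\<lambda>k. balls k (t (idx k)) \<omega>) (A n) k = j} = {k \<in> A n. balls k (t n) \<omega> = j}" for n \<omega>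
    using idx by auto
  ultimately show ?thesis by simp
qed

lemma lower_tail_weight:
  assumes t: "0 < t" and j: "1 \<le> j" and A: "finite A"
  defines "v \<equiv> \<Sum>k\<in>A. poisson_weight j (pmf p k * t) * (1 - poisson_weight j (pmf p k * t))"
  assumes d: "0 < \<delta>" "\<delta> \<le> 1" and th: "0 < \<theta>" "\<theta> \<le> \<delta>\<^sup>2 / 40" and big: "8 \<le> \<delta>\<^sup>2 * (\<theta>\<^sup>2 * v)"
  shows "exp (- (1 + 4 * \<delta>) * (\<theta>\<^sup>2 * v / 2))
    \<le> prob {\<omega> \<in> space M. (1 - \<delta>) * (\<theta> * v) \<le> real (card {k \<in> A. balls k t \<omega> = j}) - (\<Sum>k\<in>A. poisson_weight j (pmf p k * t))}"
proof -
  interpret F0: bernoulli_family M "\<lambda>k \<omega>. balls k t \<omega> = j" by (rule weight_family[OF t j])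
  interpret F: bernoulli_family M "\<lambda>k \<omega>. k \<in> A \<and> balls k t \<omega> = j" by (rule F0.restrict)
  have q: "F.q k = of_bool (k \<in> A) * poisson_weight j (pmf p k * t)" for k
    by (cases "k \<in> A") (auto simp: F.q_def prob_balls_eq[OF t])
  have v: "F.occ_var = v" unfolding F.occ_var_def q v_def by (subst suminf_finite[OF A]) auto
  have m: "F.occ_mean = (\<Sum>k\<in>A. poisson_weight j (pmf p k * t))"
    unfolding F.occ_mean_def q by (subst suminf_finite[OF A]) auto
  show ?thesis
    using F.occ_lower_tail[OF A _ d th] big unfolding v m F.occ_def by auto
qed

end

section \<open>The upper half of the law of the iterated logarithm\<close>

text \<open>
  Chaining along the partitions of \<open>{a..a + h}\<close> into \<open>16 ^ r\<close> equal parts, each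
  point being compared with its left neighbour of the previous level. The finest level \<open>R\<close> is
  reached when the mean increment over one part falls below \<open>sqrt V\<close>; there the monotonicity of
  \<open>N\<close> takes over. Only the first half of the interval is covered, so that the right
  neighbour of a point is again a point of the partition.
\<close>

lemma (in prob_space) chaining:
  fixes N :: "real \<Rightarrow> 'a \<Rightarrow> real" and m :: "real \<Rightarrow> real"
  assumes meas [measurable]: "\<And>t. N t \<in> borel_measurable M"
    and V: "0 < V" and l: "1 \<le> l" and h: "0 < h" and eta: "0 < \<eta>" and kap: "0 < \<kappa>"
    and slope: "\<And>s t. a \<le> s \<Longrightarrow> s \<le> t \<Longrightarrow> t \<le> a + h \<Longrightarrow> m t - m s \<le> \<kappa> * V / h * (t - s)"
    and m_mono: "\<And>s t. a \<le> s \<Longrightarrow> s \<le> t \<Longrightarrow> m s \<le> m t"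
    and tail: "\<And>s t y \<theta> D. a \<le> s \<Longrightarrow> s < t \<Longrightarrow> 0 < \<theta> \<Longrightarrow> \<theta> \<le> 1 \<Longrightarrow> m t - m s \<le> D \<Longrightarrow>
      prob {\<omega> \<in> space M. y \<le> \<bar>(N t \<omega> - m t) - (N s \<omega> - m s)\<bar>} \<le> 2 * exp (- \<theta> * y + D * (\<theta>\<^sup>2 / 2 * (1 + 2 * \<theta>)))"
    and small: "384 * \<kappa> \<le> \<eta>\<^sup>2" "\<kappa> \<le> \<eta>"
    and R: "1 \<le> R" "sqrt V \<le> 16 ^ R" "4 ^ R * (4 / \<eta>) * sqrt (l / V) \<le> 1"
  shows "\<exists>G\<in>events. prob (space M - G) \<le> 2 * exp (- 3 * l) \<and>
    (\<forall>\<omega>\<in>G. (\<forall>s t. s \<le> t \<longrightarrow> N s \<omega> \<le> N t \<omega>) \<longrightarrow>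
      (\<forall>t\<in>{a..a + h / 2}. \<bar>(N t \<omega> - m t) - (N a \<omega> - m a)\<bar> \<le> 2 * \<eta> * sqrt (V * l)))"
proof -
  define \<phi> where "\<phi> = sqrt (V * l)"
  define x where "x = sqrt (l / V)"
  define Z where "Z t \<omega> = N t \<omega> - m t" for t \<omega>
  define pt where "pt r q = a + h * (real q / 16 ^ r)" for r q :: nat
  define y where "y r = \<eta> * \<phi> / 2 ^ r" for r :: nat
  define E where "E r q = {\<omega> \<in> space M. y r \<le> \<bar>Z (pt r q) \<omega> - Z (pt (r - 1) (q div 16)) \<omega>\<bar>}" for r q
  define bad where "bad = (\<Union>r\<in>{1..R}. \<Union>q\<in>{..<16 ^ r}. E r q)"
  have [measurable]: "Z t \<in> borel_measurable M" for t unfolding Z_def by measurable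
  have E_meas [measurable]: "E r q \<in> events" for r q unfolding E_def by measurable
  have bad_meas [measurable]: "bad \<in> events" unfolding bad_def by measurable
  have phi: "0 < \<phi>" "sqrt V \<le> \<phi>" using V l by (auto simp: \<phi>_def)
  have x0: "0 < x" using V l by (simp add: x_def)
  have x\<phi>: "x * \<phi> = l" using V l by (simp add: x_def \<phi>_def real_sqrt_mult[symmetric])
  have x2: "x\<^sup>2 * V = l" using V l by (simp add: x_def)
  have PE: "prob (E r q) \<le> 2 * exp (- 3 * l) / 32 ^ r" if r: "1 \<le> r" "r \<le> R" and q: "q < 16 ^ r" for r q
  \<comment> \<open>A multiple of 16 belongs to the previous level already and is its own left
    neighbour, so its increment vanishes.\<close>
  proof (cases "q mod 16 = 0")
    case True
    have "real q = 16 * real (q div 16)" using True by (metis add.right_neutral div_mult_mod_eq mult.commute of_nat_mult of_nat_numeral)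
    then have "pt r q = pt (r - 1) (q div 16)" using r by (cases r) (auto simp: pt_def)
    then have "E r q = {}" using eta phi by (auto simp: E_def y_def not_le)
    then show ?thesis by simp
  next
    case False
    have qe: "real q = 16 * real (q div 16) + real (q mod 16)"
      by (metis div_mult_mod_eq mult.commute of_nat_add of_nat_mult of_nat_numeral)
    obtain r' where r': "r = Suc r'" using r by (cases r) auto
    have diff: "pt r q - pt (r - 1) (q div 16) = h * (real (q mod 16) / 16 ^ r)"
      unfolding r' by (simp add: pt_def qe field_simps)
    have mod: "0 < real (q mod 16)" "real (q mod 16) \<le> 16" using False by (auto intro: less_imp_le)
    \<comment> \<open>With this choice \<open>\<theta> * y r = 4 * 2 ^ r * l\<close>, while the
      quadratic term is at most \<open>384 * \<kappa> / \<eta>\<^sup>2 * l \<le> l\<close>: the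
      factor \<open>4 ^ r\<close> compensates exactly the decrease \<open>16 ^ r\<close> of
      \<open>D\<close>. Since \<open>2 ^ r \<ge> r + 1\<close>, the exponent is at most
      \<open>- 3 * l - 4 * r\<close>, and \<open>exp (- 4) \<le> 1 / 32\<close> beats the
      \<open>16 ^ r\<close> points of level r by a factor \<open>2 ^ r\<close>.\<close>
    define \<theta> where "\<theta> = 4 ^ r * (4 / \<eta>) * x"
    define D where "D = \<kappa> * V * 16 / 16 ^ r"
    have th: "0 < \<theta>" "\<theta> \<le> 1"
    proof -
      show "0 < \<theta>" using eta x0 by (simp add: \<theta>_def)
      have "\<theta> \<le> 4 ^ R * (4 / \<eta>) * x"
        unfolding \<theta>_def using eta x0 r by (intro mult_right_mono power_increasing) auto
      then show "\<theta> \<le> 1" using R(3) by (simp add: x_def)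
    qed
    have lt: "pt (r - 1) (q div 16) < pt r q"
      using diff mod(1) h by (smt (verit, ccfv_SIG) divide_pos_pos mult_pos_pos zero_less_power)
    have a_le: "a \<le> pt (r - 1) (q div 16)" using h by (simp add: pt_def)
    have le: "pt r q \<le> a + h"
    proof -
      have "real q \<le> 16 ^ r" using q by (metis less_imp_le of_nat_le_iff of_nat_numeral of_nat_power)
      then have "real q / 16 ^ r \<le> 1" by simp
      from mult_left_le[OF this, of h] show ?thesis using h by (simp add: pt_def)
    qed
    have "m (pt r q) - m (pt (r - 1) (q div 16)) \<le> \<kappa> * V / h * (h * (real (q mod 16) / 16 ^ r))"
      using slope[OF a_le _ le] lt unfolding diff by simp
    also have "\<dots> = \<kappa> * V * real (q mod 16) / 16 ^ r" using h by simp
    also have "\<dots> \<le> D"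
      unfolding D_def using mod kap V by (intro divide_right_mono mult_left_mono) auto
    finally have "prob (E r q) \<le> 2 * exp (- \<theta> * y r + D * (\<theta>\<^sup>2 / 2 * (1 + 2 * \<theta>)))"
      unfolding E_def Z_def by (rule tail[OF a_le lt th])
    also have "\<dots> \<le> 2 * exp (- 3 * l + real r * (- 4))"
    proof -
      have "(4::real) ^ r = 2 ^ r * 2 ^ r" by (simp add: power_mult_distrib[symmetric])
      then have "\<theta> * y r = 4 * 2 ^ r * (x * \<phi>)"
        using eta by (simp add: \<theta>_def y_def)
      then have ty: "- \<theta> * y r = - (4 * 2 ^ r * l)" by (simp add: x\<phi>)
      have "D * (\<theta>\<^sup>2 / 2 * (1 + 2 * \<theta>)) \<le> D * (\<theta>\<^sup>2 / 2 * 3)"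
        using th kap V by (intro mult_left_mono) (auto simp: D_def)
      also have "\<dots> = 384 * \<kappa> / \<eta>\<^sup>2 * (x\<^sup>2 * V)"
      proof -
        have "((4::real) ^ r)\<^sup>2 = 16 ^ r" by (simp add: power2_eq_square power_mult_distrib[symmetric])
        then have "\<theta>\<^sup>2 = 16 ^ r * (16 / \<eta>\<^sup>2) * x\<^sup>2"
          by (simp add: \<theta>_def power_mult_distrib power_divide)
        then show ?thesis by (simp add: D_def)
      qed
      also have "\<dots> \<le> 1 * l"
        unfolding x2 using small(1) eta l by (intro mult_right_mono) (auto simp: divide_le_eq)
      finally have d: "D * (\<theta>\<^sup>2 / 2 * (1 + 2 * \<theta>)) \<le> l" by simp
      have "Suc r \<le> 2 ^ r" using less_exp[of r] by (rule Suc_leI)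
      then have "real (Suc r) \<le> real (2 ^ r)" by (simp only: of_nat_le_iff)
      then have "real r + 1 \<le> 2 ^ r" by simp
      then have "(4 * (real r + 1)) * l \<le> (4 * 2 ^ r) * l" using l by (intro mult_right_mono) auto
      moreover have "(4 * (real r + 1)) * l = 4 * (real r * l) + 4 * l" by (simp add: algebra_simps)
      moreover have "real r * 1 \<le> real r * l" using l by (intro mult_left_mono) auto
      ultimately have "- \<theta> * y r + D * (\<theta>\<^sup>2 / 2 * (1 + 2 * \<theta>)) \<le> - 3 * l + real r * (- 4)"
        using d unfolding ty by linarith
      then show ?thesis by simp
    qed
    also have "exp (- 3 * l + real r * (- 4)) = exp (- 3 * l) * exp (- 4) ^ r"
      by (simp only: exp_add exp_of_nat_mult)
    also have "2 * (exp (- 3 * l) * exp (- 4) ^ r) \<le> 2 * (exp (- 3 * l) * (1 / 32) ^ r)"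
    proof -
      have "1 + 1 + 1\<^sup>2 / 2 \<le> exp (1::real)" by (rule exp_lower_Taylor_quadratic) simp
      then have "(5 / 2) ^ 4 \<le> exp (1::real) ^ 4" by (intro power_mono) auto
      also have "exp (1::real) ^ 4 = exp 4" using exp_of_nat_mult[of 4 "1::real"] by simp
      finally have "32 \<le> exp (4::real)" by (simp add: power4_eq_xxxx)
      then have "exp (- 4) \<le> (1 / 32 :: real)" by (simp add: exp_minus field_simps)
      then show ?thesis by (intro mult_left_mono power_mono) auto
    qed
    finally show ?thesis by (simp add: power_one_over)
  qed
  have bad_le: "prob bad \<le> 2 * exp (- 3 * l)"
  proof -
    have "prob bad \<le> (\<Sum>r\<in>{1..R}. prob (\<Union>q\<in>{..<16 ^ r}. E r q))"
      unfolding bad_def by (rule measure_UNION_le) auto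
    also have "\<dots> \<le> (\<Sum>r\<in>{1..R}. 2 * exp (- 3 * l) * (1 / 2) ^ r)"
    proof (rule sum_mono)
      fix r assume r: "r \<in> {1..R}"
      have "prob (\<Union>q\<in>{..<16 ^ r}. E r q) \<le> (\<Sum>q\<in>{..<16 ^ r}. prob (E r q))"
        by (rule measure_UNION_le) auto
      also have "\<dots> \<le> (\<Sum>q\<in>{..<16 ^ r::nat}. 2 * exp (- 3 * l) / 32 ^ r)"
        using r by (intro sum_mono PE) auto
      also have "\<dots> = 2 * exp (- 3 * l) * (16 ^ r / 32 ^ r)" by simp
      also have "(16::real) ^ r / 32 ^ r = (1 / 2) ^ r" by (simp add: power_divide[symmetric])
      finally show "prob (\<Union>q\<in>{..<16 ^ r}. E r q) \<le> 2 * exp (- 3 * l) * (1 / 2) ^ r" .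
    qed
    also have "\<dots> = 2 * exp (- 3 * l) * (\<Sum>r\<in>{1..R}. (1 / 2) ^ r)" by (rule sum_distrib_left[symmetric])
    also have "(\<Sum>r\<in>{1..R}. (1 / 2) ^ r) = 1 - (1 / 2 :: real) ^ R"
      by (induction R) auto
    also have "2 * exp (- 3 * l) * (1 - (1 / 2) ^ R) \<le> 2 * exp (- 3 * l)"
      by (intro mult_left_le) auto
    finally show ?thesis .
  qed
  show ?thesis
  proof (intro bexI[of _ "space M - bad"] conjI ballI impI)
    have "space M - (space M - bad) = bad" using sets.sets_into_space[OF bad_meas] by auto
    then show "prob (space M - (space M - bad)) \<le> 2 * exp (- 3 * l)" using bad_le by simp
    fix \<omega> t
    assume w: "\<omega> \<in> space M - bad" and mono: "\<forall>s t. s \<le> t \<longrightarrow> N s \<omega> \<le> N t \<omega>" and t: "t \<in> {a..a + h / 2}"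
    have step: "\<bar>Z (pt r q) \<omega> - Z (pt (r - 1) (q div 16)) \<omega>\<bar> < y r" if "1 \<le> r" "r \<le> R" "q < 16 ^ r" for r q
    proof -
      have "\<omega> \<notin> E r q" using w that by (auto simp: bad_def)
      then show ?thesis using w by (simp add: E_def not_le)
    qed
    have net: "\<bar>Z (pt r q) \<omega> - Z a \<omega>\<bar> \<le> \<eta> * \<phi> * (1 - 1 / 2 ^ r)" if "r \<le> R" "q < 16 ^ r" for r q
      using that
    proof (induction r arbitrary: q)
      case 0 then show ?case by (simp add: pt_def)
    next
      case (Suc r)
      have "q div 16 < 16 ^ r" using Suc.prems(2) by (simp add: less_mult_imp_div_less mult.commute)
      then have "\<bar>Z (pt r (q div 16)) \<omega> - Z a \<omega>\<bar> \<le> \<eta> * \<phi> * (1 - 1 / 2 ^ r)"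
        using Suc.prems(1) by (intro Suc.IH) auto
      moreover have "\<bar>Z (pt (Suc r) q) \<omega> - Z (pt r (q div 16)) \<omega>\<bar> < y (Suc r)"
        using step[of "Suc r" q] Suc.prems by simp
      moreover have "\<eta> * \<phi> * (1 - 1 / 2 ^ r) + y (Suc r) = \<eta> * \<phi> * (1 - 1 / 2 ^ Suc r)"
        by (simp add: y_def field_simps)
      ultimately show ?case by linarith
    qed
    have net': "\<bar>Z (pt R q) \<omega> - Z a \<omega>\<bar> \<le> \<eta> * \<phi>" if "q < 16 ^ R" for q
    proof -
      have "\<eta> * \<phi> * (1 - 1 / 2 ^ R) \<le> \<eta> * \<phi>" using eta phi by (intro mult_left_le) auto
      then show ?thesis using net[OF order_refl that] by linarith
    qed
    define z where "z = (t - a) / h * 16 ^ R"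
    define q where "q = nat \<lfloor>z\<rfloor>"
    have z0: "0 \<le> z" using t h by (simp add: z_def)
    have "(t - a) / h \<le> 1 / 2" using t h by (simp add: field_simps)
    then have z1: "z \<le> 1 / 2 * 16 ^ R" unfolding z_def by (intro mult_right_mono) auto
    have q: "real q \<le> z" "z < real q + 1"
      using z0 unfolding q_def by linarith+
    have "(16::real) ^ 1 \<le> 16 ^ R" using R(1) by (intro power_increasing) auto
    then have "real (q + 1) < 16 ^ R" using q(1) z1 by simp
    then have qR: "q < 16 ^ R" "q + 1 < 16 ^ R"
      by (metis Suc_eq_plus1 lessI less_trans of_nat_less_iff of_nat_numeral of_nat_power)+
    have tz: "t = a + h * (z / 16 ^ R)" using h by (simp add: z_def)
    have ut: "pt R q \<le> t" unfolding tz pt_def using h q by (intro add_left_mono mult_left_mono divide_right_mono) auto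
    have tu: "t \<le> pt R (q + 1)" unfolding tz pt_def using h q by (intro add_left_mono mult_left_mono divide_right_mono) auto
    have au: "a \<le> pt R q" using h by (simp add: pt_def)
    have ub: "pt R (q + 1) \<le> a + h"
    proof -
      have "real (q + 1) / 16 ^ R \<le> 1" using \<open>real (q + 1) < 16 ^ R\<close> by simp
      from mult_left_le[OF this, of h] show ?thesis using h by (simp add: pt_def)
    qed
    have gap: "m (pt R (q + 1)) - m (pt R q) \<le> \<eta> * \<phi>"
    proof -
      have "pt R (q + 1) - pt R q = h / 16 ^ R" by (simp add: pt_def field_simps)
      then have "m (pt R (q + 1)) - m (pt R q) \<le> \<kappa> * V / h * (h / 16 ^ R)"
        using slope[OF au _ ub] ut tu by simp
      also have "\<dots> = \<kappa> * (V / 16 ^ R)" using h by simp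
      also have "\<dots> \<le> \<eta> * \<phi>"
      proof (rule mult_mono)
        have "V = sqrt V * sqrt V" using V by simp
        also have "\<dots> \<le> sqrt V * 16 ^ R" using R(2) V by (intro mult_left_mono) auto
        finally have "V / 16 ^ R \<le> sqrt V" by (simp add: divide_le_eq)
        then show "V / 16 ^ R \<le> \<phi>" using phi(2) by linarith
      qed (use small(2) eta V in auto)
      finally show ?thesis .
    qed
    have "N (pt R q) \<omega> \<le> N t \<omega>" "N t \<omega> \<le> N (pt R (q + 1)) \<omega>" using mono ut tu by auto
    moreover have "m (pt R q) \<le> m t" "m t \<le> m (pt R (q + 1))" using m_mono ut tu au t by auto
    ultimately have "\<bar>Z t \<omega> - Z a \<omega>\<bar> \<le> 2 * (\<eta> * \<phi>)"
      using net'[OF qR(1)] net'[OF qR(2)] gap unfolding Z_def by linarith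
    then show "\<bar>(N t \<omega> - m t) - (N a \<omega> - m a)\<bar> \<le> 2 * \<eta> * sqrt (V * l)"
      by (simp add: Z_def \<phi>_def)
  qed measurable
qed

section \<open>Growth of the mean counts in time\<close>

lemma DERIV_poisson_tail:
  "DERIV (poisson_tail (Suc i)) x :> x ^ i / fact i * exp (- x)"
proof (induction i)
  case 0
  have "DERIV (\<lambda>x. 1 - exp (- x)) x :> exp (- x)"
    by (auto intro!: derivative_eq_intros)
  then show ?case by (simp add: poisson_tail_def[abs_def])
next
  case (Suc i)
  have "DERIV (\<lambda>x. x ^ Suc i / fact (Suc i) * exp (- x)) x :> x ^ i / fact i * exp (- x) - x ^ Suc i / fact (Suc i) * exp (- x)"
  proof -
    have d1: "DERIV (\<lambda>x. x ^ Suc i / fact (Suc i)) x :> real (Suc i) * x ^ i / fact (Suc i)"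
      using DERIV_cdivide[OF DERIV_pow[of "Suc i" x], of "fact (Suc i)"] by simp
    have e: "real (Suc i) * x ^ i / fact (Suc i) = x ^ i / fact i" by (simp del: of_nat_Suc)
    have d2: "DERIV (\<lambda>x. exp (- x)) x :> - exp (- x)" by (auto intro!: derivative_eq_intros)
    from DERIV_mult[OF d1 d2] show ?thesis unfolding e by (simp add: mult.commute)
  qed
  from DERIV_diff[OF Suc this] show ?case
    unfolding poisson_tail_Suc[abs_def, of "Suc i"] by simp
qed

text \<open>Mean value theorem. For z between a and \<open>2 * a\<close> the derivative
  \<open>c * (c * z) ^ i / fact i * exp (- (c * z))\<close> is at most \<open>2 ^ i\<close> times
  its value at a, and this value is \<open>(i + 1) / a\<close> times the probability of exactly i +
  1 balls at time a. In this way the mean increments become comparable to the variance.\<close>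

lemma tail_mean_slope:
  assumes a: "0 < a" and s: "a \<le> s" "s \<le> t" "t \<le> 2 * a"
  shows "tail_mean p (Suc i) t - tail_mean p (Suc i) s \<le> real (Suc i) * 2 ^ i * weight_mean p (Suc i) a / a * (t - s)"
proof -
  let ?C = "real (Suc i) * 2 ^ i / a * (t - s)"
  have pt: "poisson_tail (Suc i) (c * t) - poisson_tail (Suc i) (c * s) \<le> ?C * poisson_weight (Suc i) (c * a)"
    if c: "0 \<le> c" for c
  proof (cases "s = t")
    case False
    have "\<exists>z>s. z < t \<and> poisson_tail (Suc i) (c * t) - poisson_tail (Suc i) (c * s) =
        (t - s) * ((c * z) ^ i / fact i * exp (- (c * z)) * c)"
    proof (rule MVT2)
      show "DERIV (\<lambda>z. poisson_tail (Suc i) (c * z)) z :> (c * z) ^ i / fact i * exp (- (c * z)) * c" for z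
        by (rule DERIV_chain2[OF DERIV_poisson_tail]) (auto intro!: derivative_eq_intros)
    qed (use s False in auto)
    then obtain z where z: "s < z" "z < t" and
      eq: "poisson_tail (Suc i) (c * t) - poisson_tail (Suc i) (c * s) = (t - s) * ((c * z) ^ i / fact i * exp (- (c * z)) * c)"
      by blast
    have cz: "c * z \<le> c * (2 * a)" "c * a \<le> c * z" "0 \<le> c * z"
      using z s a c by (auto intro!: mult_left_mono)
    have "(c * z) ^ i / fact i * exp (- (c * z)) * c \<le> (c * (2 * a)) ^ i / fact i * exp (- (c * a)) * c"
      using cz c z s a by (intro mult_mono mult_right_mono divide_right_mono power_mono) auto
    also have "\<dots> = real (Suc i) * 2 ^ i / a * poisson_weight (Suc i) (c * a)"
      using a by (simp add: poisson_weight_def power_mult_distrib del: of_nat_Suc)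
    finally have "(t - s) * ((c * z) ^ i / fact i * exp (- (c * z)) * c) \<le>
        (t - s) * (real (Suc i) * 2 ^ i / a * poisson_weight (Suc i) (c * a))"
      using s by (intro mult_left_mono) auto
    then show ?thesis unfolding eq by (simp only: mult_ac times_divide_eq_left times_divide_eq_right)
  qed simp
  have sm: "summable (\<lambda>k. poisson_tail (Suc i) (pmf p k * t))" "summable (\<lambda>k. poisson_tail (Suc i) (pmf p k * s))"
    "summable (\<lambda>k. poisson_weight (Suc i) (pmf p k * a))"
    using a s by (auto intro!: summable_poisson_tail summable_poisson_weight)
  have "tail_mean p (Suc i) t - tail_mean p (Suc i) s =
      (\<Sum>k. poisson_tail (Suc i) (pmf p k * t) - poisson_tail (Suc i) (pmf p k * s))"
    unfolding tail_mean_def by (rule suminf_diff[OF sm(1,2)])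
  also have "\<dots> \<le> (\<Sum>k. ?C * poisson_weight (Suc i) (pmf p k * a))"
    by (intro suminf_le summable_diff summable_mult sm pt) auto
  also have "\<dots> = ?C * weight_mean p (Suc i) a"
    unfolding weight_mean_def by (rule suminf_mult[OF sm(3)])
  finally show ?thesis by (simp only: mult_ac times_divide_eq_left times_divide_eq_right)
qed

lemma tail_mean_mono:
  assumes "1 \<le> i" "0 < s" "s \<le> t"
  shows "tail_mean p i s \<le> tail_mean p i t"
proof -
  obtain i' where i: "i = Suc i'" using assms(1) by (cases i) auto
  have "poisson_tail i (pmf p k * s) \<le> poisson_tail i (pmf p k * t)" for k
    unfolding i
  proof (rule DERIV_nonneg_imp_nondecreasing[where f="poisson_tail (Suc i')"])
    show "pmf p k * s \<le> pmf p k * t" using assms by (intro mult_left_mono) auto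
    fix x assume "pmf p k * s \<le> x" "x \<le> pmf p k * t"
    moreover have "0 \<le> pmf p k * s" using assms by simp
    ultimately have "0 \<le> x" by linarith
    then show "\<exists>y. DERIV (poisson_tail (Suc i')) x :> y \<and> 0 \<le> y"
      by (intro exI[of _ "x ^ i' / fact i' * exp (- x)"] conjI DERIV_poisson_tail) auto
  qed
  then show ?thesis unfolding tail_mean_def using assms
    by (intro suminf_le summable_poisson_tail) auto
qed

lemma weight_mean_tail: "1 \<le> j \<Longrightarrow> 0 < t \<Longrightarrow> weight_mean p j t = tail_mean p j t - tail_mean p (Suc j) t"
  unfolding weight_mean_def tail_mean_def poisson_weight_tail
  by (intro suminf_diff[symmetric] summable_poisson_tail) auto

lemma (in prob_space) borel_cantelli_bound:
  assumes A: "\<And>n. A n \<in> events" and f: "\<forall>\<^sub>F n in sequentially. prob (A n) \<le> f n" "summable f"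
  shows "AE \<omega> in M. \<forall>\<^sub>F n in sequentially. \<omega> \<notin> A n"
proof -
  have "summable (\<lambda>n. prob (A n))"
    by (rule summable_comparison_test_ev[OF _ f(2)]) (use f(1) in \<open>auto elim: eventually_mono\<close>)
  then have "AE \<omega> in M. \<forall>\<^sub>F n in sequentially. \<omega> \<in> space M - A n"
    using A by (intro borel_cantelli_AE1) (auto simp: emeasure_eq_measure)
  then show ?thesis by (rule AE_mp) (auto intro!: AE_I2 elim: eventually_mono)
qed

lemma summable_scaled_powr:
  assumes "0 < c" "1 < s"
  shows "summable (\<lambda>n. C * (c * real n) powr (- s))"
proof -
  have "summable (\<lambda>n. C * c powr (- s) * real n powr (- s))"
    using assms by (intro summable_mult) (simp add: summable_real_powr_iff)
  then show ?thesis using assms by (simp add: powr_mult mult.assoc)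
qed


lemma loglog_limits:
  shows "\<forall>\<^sub>F v::real in at_top. 1 \<le> ln (ln v)"
    and "((\<lambda>v::real. sqrt (ln (ln v) / v)) \<longlongrightarrow> 0) at_top"
    and "((\<lambda>v::real. sqrt (sqrt v) * sqrt (ln (ln v) / v)) \<longlongrightarrow> 0) at_top"
  by real_asymp+

lemma loglog_scale:
  fixes c :: real
  assumes "0 < c"
  shows "((\<lambda>v. ln (ln (c * v)) / ln (ln v)) \<longlongrightarrow> 1) at_top"
  using assms by real_asymp

section \<open>From the grid to all times\<close>

context poissonized_karlin_scheme
begin

definition lil_scale :: "nat \<Rightarrow> real \<Rightarrow> real" where
  "lil_scale j t = sqrt (weight_var p j t * ln (ln (weight_var p j t)))"

lemma weight_var_filterlim:
  assumes "\<forall>\<^sub>F t in at_top. t powr (1 / 4) \<le> weight_var p j t"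
  shows "filterlim (weight_var p j) at_top at_top"
proof (rule filterlim_at_top_mono[OF _ assms])
  show "filterlim (\<lambda>t::real. t powr (1 / 4)) at_top at_top" by real_asymp
qed

lemma loglog_var_lower:
  assumes "\<forall>\<^sub>F t in at_top. t powr (1 / 4) \<le> weight_var p j t"
  shows "\<forall>\<^sub>F t in at_top. ln (ln t / 4) \<le> ln (ln (weight_var p j t))"
  using assms eventually_gt_at_top[of 1]
proof eventually_elim
  case (elim t)
  have "0 < t powr (1 / 4)" using elim by simp
  then have "ln (t powr (1 / 4)) \<le> ln (weight_var p j t)" using elim by (intro ln_mono) auto
  then have "ln t / 4 \<le> ln (weight_var p j t)" using elim by (simp add: ln_powr)
  moreover have "0 < ln t / 4" using elim by simp
  ultimately show ?case by (intro ln_mono) auto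
qed

lemma geometric_at_top:
  assumes b: "1 < b" shows "filterlim (\<lambda>n. b ^ n :: real) at_top sequentially"
  unfolding filterlim_at_top
proof
  fix Z :: real
  obtain N where N: "Z < b ^ N" using real_arch_pow[OF b] by blast
  have "Z \<le> b ^ n" if "N \<le> n" for n
  proof -
    have "b ^ N \<le> b ^ n" using that b by (intro power_increasing) auto
    then show ?thesis using N by linarith
  qed
  then show "\<forall>\<^sub>F n in sequentially. Z \<le> b ^ n" by (auto simp: eventually_sequentially)
qed

lemma loglog_var_geometric:
  assumes G: "\<forall>\<^sub>F t in at_top. t powr (1 / 4) \<le> weight_var p j t" and b: "1 < b"
  shows "\<forall>\<^sub>F n in sequentially. ln (ln b / 4 * real n) \<le> ln (ln (weight_var p j (b ^ n)))"
  using eventually_compose_filterlim[OF loglog_var_lower[OF G] geometric_at_top[OF b]]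
  by eventually_elim (use b in \<open>simp add: ln_realpow mult.commute\<close>)

text \<open>Along \<open>b ^ n\<close>, power growth of the variance gives an iterated logarithm of
  at least \<open>ln n\<close> plus a constant, so the left side is bounded by a constant times
  \<open>n powr (- s)\<close>.\<close>

lemma exp_loglog_summable_bound:
  assumes G: "\<forall>\<^sub>F t in at_top. t powr (1 / 4) \<le> weight_var p j t" and b: "1 < b" and s: "1 < s"
  shows "\<exists>f. summable f \<and> (\<forall>\<^sub>F n in sequentially. exp (- s * ln (ln (weight_var p j (b ^ n)))) \<le> f n)"
proof (intro exI conjI)
  have c: "0 < ln b / 4" using b by simp
  show "summable (\<lambda>n. 1 * (ln b / 4 * real n) powr (- s))" by (rule summable_scaled_powr[OF c s])
  show "\<forall>\<^sub>F n in sequentially. exp (- s * ln (ln (weight_var p j (b ^ n)))) \<le> 1 * (ln b / 4 * real n) powr (- s)"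
    using loglog_var_geometric[OF G b] eventually_gt_at_top[of 0]
  proof eventually_elim
    case (elim n)
    have "exp (- s * ln (ln (weight_var p j (b ^ n)))) \<le> exp (- s * ln (ln b / 4 * real n))"
      using elim s by simp
    also have "\<dots> = (ln b / 4 * real n) powr (- s)" using c elim by (simp add: powr_def)
    finally show ?case by simp
  qed
qed

lemma upper_lil_grid:
  assumes j: "1 \<le> j" and G: "\<forall>\<^sub>F t in at_top. t powr (1 / 4) \<le> weight_var p j t"
    and eps: "0 < \<epsilon>" and b: "1 < b"
  shows "AE \<omega> in M. \<forall>\<^sub>F n in sequentially.
    \<bar>K_star S X j (b ^ n) \<omega> - weight_mean p j (b ^ n)\<bar> \<le> (sqrt 2 + \<epsilon>) * lil_scale j (b ^ n)"
proof -
  define V where "V n = weight_var p j (b ^ n)" for n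
  define l where "l n = ln (ln (V n))" for n
  define A where "A n = {\<omega> \<in> space M. (sqrt 2 + \<epsilon>) * lil_scale j (b ^ n) \<le>
      \<bar>K_star S X j (b ^ n) \<omega> - weight_mean p j (b ^ n)\<bar>}" for n
  have [measurable]: "K_star S X j t \<in> borel_measurable M" for t unfolding K_star_def by measurable
  have VT: "filterlim V at_top sequentially"
    unfolding V_def by (rule filterlim_compose[OF weight_var_filterlim[OF G] geometric_at_top[OF b]])
  obtain f where f: "summable f" "\<forall>\<^sub>F n in sequentially. exp (- (1 + \<epsilon>) * l n) \<le> f n"
    using exp_loglog_summable_bound[OF G b, of "1 + \<epsilon>"] eps unfolding l_def V_def by auto
  have lim: "((\<lambda>n. sqrt (l n / V n)) \<longlongrightarrow> 0) sequentially"
    unfolding l_def by (rule filterlim_compose[OF loglog_limits(2) VT])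
  have ev1: "\<forall>\<^sub>F n in sequentially. sqrt (l n / V n) < min (1 / 2) (\<epsilon> / 10)"
    using eps by (intro order_tendstoD(2)[OF lim]) auto
  have ev2: "\<forall>\<^sub>F n in sequentially. 1 \<le> l n"
    unfolding l_def by (rule eventually_compose_filterlim[OF loglog_limits(1) VT])
  have ev3: "\<forall>\<^sub>F n in sequentially. 0 < V n" using VT unfolding filterlim_at_top_dense by blast
  have "\<forall>\<^sub>F n in sequentially. prob (A n) \<le> 2 * f n"
    using ev1 ev2 ev3 f(2)
  proof eventually_elim
    case (elim n)
    define x where "x = sqrt (l n / V n)"
    \<comment> \<open>The minimiser of \<open>- \<theta> * y + V * \<theta>\<^sup>2 / 2\<close> for
      \<open>y = sqrt (2 * V * l)\<close>. The exponent becomes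
      \<open>- (1 + sqrt 2 * \<epsilon> - 2 * \<theta>) * l\<close>; since
      \<open>sqrt 2 \<ge> 7 / 5\<close> and \<open>2 * \<theta> \<le> 3 / 10 * \<epsilon>\<close>,
      its factor is at least \<open>1 + \<epsilon>\<close>.\<close>
    define \<theta> where "\<theta> = sqrt 2 * x"
    have x0: "0 < x" using elim by (simp add: x_def)
    have s2: "sqrt 2 \<le> (3 / 2 :: real)" by (rule real_le_lsqrt) (auto simp: power2_eq_square)
    have s3: "7 / 5 \<le> sqrt (2::real)" by (rule real_le_rsqrt) (auto simp: power2_eq_square)
    have th: "0 < \<theta>" "\<theta> \<le> 1" "2 * \<theta> \<le> 3 / 10 * \<epsilon>"
    proof -
      have "\<theta> \<le> 3 / 2 * x" unfolding \<theta>_def using s2 x0 by (intro mult_right_mono) auto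
      moreover have "x < 1 / 2" "x < \<epsilon> / 10" using elim by (auto simp: x_def)
      ultimately show "\<theta> \<le> 1" "2 * \<theta> \<le> 3 / 10 * \<epsilon>" by linarith+
    qed (simp add: \<theta>_def x0)
    have x\<phi>: "x * lil_scale j (b ^ n) = l n"
    proof -
      have "x * lil_scale j (b ^ n) = sqrt (l n / V n) * sqrt (V n * l n)"
        by (simp add: lil_scale_def x_def l_def V_def)
      then show ?thesis using elim by (simp add: real_sqrt_mult[symmetric])
    qed
    have x2: "V n * x\<^sup>2 = l n" using elim by (simp add: x_def)
    have "prob (A n) \<le> 2 * exp (- \<theta> * ((sqrt 2 + \<epsilon>) * lil_scale j (b ^ n)) + V n * (\<theta>\<^sup>2 / 2 * (1 + 2 * \<theta>)))"
      using chernoff_weight[of "b ^ n" j \<theta> UNIV "V n" "(sqrt 2 + \<epsilon>) * lil_scale j (b ^ n)"] b j th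
      by (simp add: A_def K_star_def weight_mean_def V_def weight_var_def)
    also have "- \<theta> * ((sqrt 2 + \<epsilon>) * lil_scale j (b ^ n)) + V n * (\<theta>\<^sup>2 / 2 * (1 + 2 * \<theta>)) =
        - (1 + sqrt 2 * \<epsilon> - 2 * \<theta>) * l n"
    proof -
      have "\<theta> * ((sqrt 2 + \<epsilon>) * lil_scale j (b ^ n)) = sqrt 2 * (sqrt 2 + \<epsilon>) * (x * lil_scale j (b ^ n))"
        by (simp add: \<theta>_def)
      moreover have "V n * (\<theta>\<^sup>2 / 2 * (1 + 2 * \<theta>)) = (V n * x\<^sup>2) * (1 + 2 * \<theta>)"
        by (simp add: \<theta>_def power_mult_distrib)
      ultimately show ?thesis unfolding x\<phi> x2 by (simp add: algebra_simps)
    qed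
    also have "2 * exp (- (1 + sqrt 2 * \<epsilon> - 2 * \<theta>) * l n) \<le> 2 * exp (- (1 + \<epsilon>) * l n)"
    proof -
      have "7 / 5 * \<epsilon> \<le> sqrt 2 * \<epsilon>" using s3 eps by (intro mult_right_mono) auto
      then have "1 + \<epsilon> \<le> 1 + sqrt 2 * \<epsilon> - 2 * \<theta>" using th(3) eps by linarith
      then have "(1 + \<epsilon>) * l n \<le> (1 + sqrt 2 * \<epsilon> - 2 * \<theta>) * l n" using elim by (intro mult_right_mono) auto
      then have "- (1 + sqrt 2 * \<epsilon> - 2 * \<theta>) * l n \<le> - (1 + \<epsilon>) * l n"
        by (simp only: mult_minus_left neg_le_iff_le)
      then show ?thesis by (intro mult_left_mono iffD2[OF exp_le_cancel_iff]) auto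
    qed
    finally show ?case using elim by linarith
  qed
  moreover have "summable (\<lambda>n. 2 * f n)" using f(1) by (rule summable_mult)
  moreover have "A n \<in> events" for n unfolding A_def by measurable
  ultimately have "AE \<omega> in M. \<forall>\<^sub>F n in sequentially. \<omega> \<notin> A n" by (intro borel_cantelli_bound)
  then show ?thesis using AE_space
    by eventually_elim (auto simp: A_def not_le elim!: eventually_mono)
qed

text \<open>Here \<kappa> is the mean increment over \<open>2 * \<delta> * b ^ n\<close> in units of
  the variance at \<open>b ^ n\<close>, where \<open>b = 1 + \<delta>\<close>. It is proportional to
  \<delta>, so a fine grid meets the conditions of \<open>chaining\<close> for any given
  \<eta>.\<close>

lemma chain_grid:
  fixes i j :: nat
  assumes G: "\<forall>\<^sub>F t in at_top. t powr (1 / 4) \<le> weight_var p j t"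
    and EC: "\<forall>\<^sub>F t in at_top. weight_mean p (Suc i) t \<le> C * weight_var p j t" and C: "0 < C"
    and eta: "0 < \<eta>" and d: "0 < \<delta>" "\<delta> \<le> 1 / 2"
  defines "\<kappa> \<equiv> 2 * \<delta> * (real (Suc i) * 2 ^ i * C)"
  assumes small: "384 * \<kappa> \<le> \<eta>\<^sup>2" "\<kappa> \<le> \<eta>"
  shows "AE \<omega> in M. \<forall>\<^sub>F n in sequentially. \<forall>t\<in>{(1 + \<delta>) ^ n..(1 + \<delta>) ^ Suc n}.
    \<bar>(K_ge (Suc i) t \<omega> - tail_mean p (Suc i) t) - (K_ge (Suc i) ((1 + \<delta>) ^ n) \<omega> - tail_mean p (Suc i) ((1 + \<delta>) ^ n))\<bar>
      \<le> 2 * \<eta> * lil_scale j ((1 + \<delta>) ^ n)"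
proof -
  define b where "b = 1 + \<delta>"
  have b: "1 < b" using d by (simp add: b_def)
  define V where "V n = weight_var p j (b ^ n)" for n
  define l where "l n = ln (ln (V n))" for n
  define Q where "Q n G \<longleftrightarrow> G \<in> events \<and> prob (space M - G) \<le> 2 * exp (- 3 * l n) \<and>
    (\<forall>\<omega>\<in>G. (\<forall>s t. s \<le> t \<longrightarrow> K_ge (Suc i) s \<omega> \<le> K_ge (Suc i) t \<omega>) \<longrightarrow>
      (\<forall>t\<in>{b ^ n..b ^ n + 2 * \<delta> * b ^ n / 2}.
        \<bar>(K_ge (Suc i) t \<omega> - tail_mean p (Suc i) t) - (K_ge (Suc i) (b ^ n) \<omega> - tail_mean p (Suc i) (b ^ n))\<bar>
          \<le> 2 * \<eta> * sqrt (V n * l n)))" for n G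
  have kap: "0 < \<kappa>" using d C by (simp add: \<kappa>_def)
  have VT: "filterlim V at_top sequentially"
    unfolding V_def by (rule filterlim_compose[OF weight_var_filterlim[OF G] geometric_at_top[OF b]])
  have lim: "((\<lambda>n. sqrt (sqrt (V n)) * sqrt (l n / V n)) \<longlongrightarrow> 0) sequentially"
    unfolding l_def by (rule filterlim_compose[OF loglog_limits(3) VT])
  have ev1: "\<forall>\<^sub>F n in sequentially. sqrt (sqrt (V n)) * sqrt (l n / V n) < \<eta> / 16"
    using eta by (intro order_tendstoD(2)[OF lim]) auto
  have ev2: "\<forall>\<^sub>F n in sequentially. 1 \<le> l n"
    unfolding l_def by (rule eventually_compose_filterlim[OF loglog_limits(1) VT])
  have ev3: "\<forall>\<^sub>F n in sequentially. 1 < V n" using VT unfolding filterlim_at_top_dense by blast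
  have ev4: "\<forall>\<^sub>F n in sequentially. weight_mean p (Suc i) (b ^ n) \<le> C * V n"
    unfolding V_def by (rule eventually_compose_filterlim[OF EC geometric_at_top[OF b]])
  have ex: "\<forall>\<^sub>F n in sequentially. \<exists>G. Q n G"
    using ev1 ev2 ev3 ev4
  proof eventually_elim
    case (elim n)
    have a0: "0 < b ^ n" using b by simp
    have V1: "1 < sqrt (V n)" using elim by simp
    define R where "R = (LEAST r. sqrt (V n) \<le> 16 ^ r)"
    obtain r0 :: nat where "sqrt (V n) < 16 ^ r0" using real_arch_pow[of 16 "sqrt (V n)"] by auto
    then have R: "sqrt (V n) \<le> 16 ^ R" unfolding R_def by (rule LeastI[OF less_imp_le])
    then obtain R' where R': "R = Suc R'" using V1 by (cases R) auto
    have lt: "16 ^ R' < sqrt (V n)"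
      using not_less_Least[of R' "\<lambda>r. sqrt (V n) \<le> 16 ^ r"] R' unfolding R_def by (simp add: not_le)
    \<comment> \<open>For the least R with \<open>sqrt (V n) \<le> 16 ^ R\<close>, the power
      \<open>4 ^ R\<close> is below four times the fourth root of the variance, and that root times
      \<open>sqrt (l n / V n)\<close> tends to 0: the tilts stay below 1 up to the finest
      level.\<close>
    have R4: "4 ^ R * (4 / \<eta>) * sqrt (l n / V n) \<le> 1"
    proof -
      have "sqrt (16 ^ R') = 4 ^ R'" by (simp add: real_sqrt_power)
      then have "4 ^ R' \<le> sqrt (sqrt (V n))" using lt by (metis less_imp_le real_sqrt_le_iff)
      then have "4 ^ R' * sqrt (l n / V n) \<le> sqrt (sqrt (V n)) * sqrt (l n / V n)"
        using elim by (intro mult_right_mono) auto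
      then have "4 ^ R' * sqrt (l n / V n) \<le> \<eta> / 16" using elim by linarith
      then have "16 / \<eta> * (4 ^ R' * sqrt (l n / V n)) \<le> 16 / \<eta> * (\<eta> / 16)"
        using eta by (intro mult_left_mono) auto
      then show ?thesis using eta by (simp add: R' mult_ac)
    qed
    have "\<exists>G\<in>events. prob (space M - G) \<le> 2 * exp (- 3 * l n) \<and>
      (\<forall>\<omega>\<in>G. (\<forall>s t. s \<le> t \<longrightarrow> K_ge (Suc i) s \<omega> \<le> K_ge (Suc i) t \<omega>) \<longrightarrow>
        (\<forall>t\<in>{b ^ n..b ^ n + 2 * \<delta> * b ^ n / 2}.
          \<bar>(K_ge (Suc i) t \<omega> - tail_mean p (Suc i) t) - (K_ge (Suc i) (b ^ n) \<omega> - tail_mean p (Suc i) (b ^ n))\<bar>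
            \<le> 2 * \<eta> * sqrt (V n * l n)))"
    \<comment> \<open>Chaining covers only half of its interval, so its length is
      \<open>2 * \<delta> * b ^ n\<close>, twice the distance to \<open>b ^ Suc n\<close>. By
      \<delta> \<le> 1/2 the interval ends before \<open>2 * b ^ n\<close>, as
      \<open>tail_mean_slope\<close> demands.\<close>
    proof (rule chaining[where \<kappa>=\<kappa> and R=R])
      show "0 < 2 * \<delta> * b ^ n" using d a0 by simp
      show "1 \<le> R" by (simp add: R')
      fix s t assume st: "b ^ n \<le> s" "s \<le> t" "t \<le> b ^ n + 2 * \<delta> * b ^ n"
      have "2 * \<delta> * b ^ n \<le> 1 * b ^ n" using d a0 by (intro mult_right_mono) auto
      then have "t \<le> 2 * b ^ n" using st by simp
      then have "tail_mean p (Suc i) t - tail_mean p (Suc i) s \<le>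
          real (Suc i) * 2 ^ i * weight_mean p (Suc i) (b ^ n) / b ^ n * (t - s)"
        using st by (intro tail_mean_slope[OF a0])
      also have "\<dots> \<le> real (Suc i) * 2 ^ i * (C * V n) / b ^ n * (t - s)"
        using elim a0 st by (intro mult_right_mono divide_right_mono mult_left_mono) auto
      also have "\<dots> = \<kappa> * V n / (2 * \<delta> * b ^ n) * (t - s)"
        using d a0 by (simp add: \<kappa>_def)
      finally show "tail_mean p (Suc i) t - tail_mean p (Suc i) s \<le> \<kappa> * V n / (2 * \<delta> * b ^ n) * (t - s)" .
    next
      fix s t assume "b ^ n \<le> s" "s \<le> t"
      then show "tail_mean p (Suc i) s \<le> tail_mean p (Suc i) t" using a0 by (intro tail_mean_mono) auto
    next
      fix s t y \<theta> D :: real assume "b ^ n \<le> s" "s < t" "0 < \<theta>" "\<theta> \<le> 1" "tail_mean p (Suc i) t - tail_mean p (Suc i) s \<le> D"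
      then show "prob {\<omega> \<in> space M. y \<le> \<bar>(K_ge (Suc i) t \<omega> - tail_mean p (Suc i) t) - (K_ge (Suc i) s \<omega> - tail_mean p (Suc i) s)\<bar>}
          \<le> 2 * exp (- \<theta> * y + D * (\<theta>\<^sup>2 / 2 * (1 + 2 * \<theta>)))"
        using a0 by (intro chernoff_increment) auto
    qed (use elim eta kap small R R4 in auto)
    then show ?case unfolding Q_def by blast
  qed
  \<comment> \<open>The default \<open>space M\<close> makes every term of the sequence measurable
    and is taken for finitely many n only.\<close>
  define G' where "G' n = (if \<exists>G. Q n G then SOME G. Q n G else space M)" for n
  have Q: "Q n (G' n)" if "\<exists>G. Q n G" for n
    using someI_ex[OF that] that by (simp add: G'_def)
  have G'_ev: "G' n \<in> events" for n
    using Q[of n] by (cases "\<exists>G. Q n G") (auto simp: Q_def G'_def)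
  obtain f where f: "summable f" "\<forall>\<^sub>F n in sequentially. exp (- 3 * l n) \<le> f n"
    using exp_loglog_summable_bound[OF G b, of 3] unfolding l_def V_def by auto
  have "\<forall>\<^sub>F n in sequentially. prob (space M - G' n) \<le> 2 * f n"
    using ex f(2) by eventually_elim (use Q in \<open>fastforce simp: Q_def\<close>)
  then have "AE \<omega> in M. \<forall>\<^sub>F n in sequentially. \<omega> \<notin> space M - G' n"
    using G'_ev f(1) by (intro borel_cantelli_bound[where f="\<lambda>n. 2 * f n"] summable_mult) auto
  then show ?thesis using AE_regular AE_space
  proof eventually_elim
    fix \<omega> assume w: "\<forall>\<^sub>F n in sequentially. \<omega> \<notin> space M - G' n" "regular_outcome \<omega>" "\<omega> \<in> space M"
    show "\<forall>\<^sub>F n in sequentially. \<forall>t\<in>{(1 + \<delta>) ^ n..(1 + \<delta>) ^ Suc n}.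
      \<bar>(K_ge (Suc i) t \<omega> - tail_mean p (Suc i) t) - (K_ge (Suc i) ((1 + \<delta>) ^ n) \<omega> - tail_mean p (Suc i) ((1 + \<delta>) ^ n))\<bar>
      \<le> 2 * \<eta> * lil_scale j ((1 + \<delta>) ^ n)"
      using w(1) ex
    proof eventually_elim
      case (elim n)
      have "\<omega> \<in> G' n" using elim w by auto
      moreover have "\<forall>s t. s \<le> t \<longrightarrow> K_ge (Suc i) s \<omega> \<le> K_ge (Suc i) t \<omega>" using K_ge_mono[OF w(2)] by simp
      moreover have "b ^ n + 2 * \<delta> * b ^ n / 2 = b ^ Suc n" by (simp add: b_def algebra_simps)
      ultimately show ?case using Q[OF elim(2)] unfolding Q_def lil_scale_def V_def l_def b_def[symmetric] by auto
    qed
  qed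
qed

lemma upper_lil_eps:
  assumes j: "1 \<le> j" and G: "\<forall>\<^sub>F t in at_top. t powr (1 / 4) \<le> weight_var p j t"
    and C: "0 < C" and EC: "\<forall>\<^sub>F t in at_top. weight_mean p j t \<le> C * weight_var p j t"
      "\<forall>\<^sub>F t in at_top. weight_mean p (Suc j) t \<le> C * weight_var p j t"
    and almost_mono: "\<And>\<epsilon>. 0 < \<epsilon> \<Longrightarrow> \<forall>\<^sub>F t in at_top. \<forall>s\<ge>t. (1 - \<epsilon>) * weight_var p j t \<le> weight_var p j s"
    and eps: "0 < \<epsilon>" "\<epsilon> \<le> 1 / 2"
  shows "AE \<omega> in M. \<forall>\<^sub>F t in at_top.
    \<bar>K_star S X j t \<omega> - weight_mean p j t\<bar> \<le> (sqrt 2 + 13 * \<epsilon>) * lil_scale j t"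
proof -
  obtain j' where j': "j = Suc j'" using j by (cases j) auto
  define cc where "cc = real (Suc j) * 2 ^ j * C"
  have cc: "0 < cc" using C by (simp add: cc_def)
  \<comment> \<open>The two quotients are the conditions
    \<open>384 * \<kappa> \<le> \<epsilon>\<^sup>2\<close> and
    \<open>\<kappa> \<le> \<epsilon>\<close> for the level j + 1; the constant of the level j is
    smaller.\<close>
  define \<delta> where "\<delta> = min (1 / 2) (min (\<epsilon>\<^sup>2 / (768 * cc)) (\<epsilon> / (2 * cc)))"
  have d: "0 < \<delta>" "\<delta> \<le> 1 / 2" using eps cc by (auto simp: \<delta>_def)
  have d1: "2 * \<delta> * cc * 384 \<le> \<epsilon>\<^sup>2" "2 * \<delta> * cc \<le> \<epsilon>"
  proof -
    have "\<delta> \<le> \<epsilon>\<^sup>2 / (768 * cc)" "\<delta> \<le> \<epsilon> / (2 * cc)" by (auto simp: \<delta>_def)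
    then show "2 * \<delta> * cc * 384 \<le> \<epsilon>\<^sup>2" "2 * \<delta> * cc \<le> \<epsilon>" using cc by (simp_all add: field_simps)
  qed
  have cj: "real (Suc j') * 2 ^ j' * C \<le> cc"
    unfolding cc_def j' using C by (intro mult_right_mono mult_mono) auto
  have k1: "2 * \<delta> * (real (Suc j') * 2 ^ j' * C) \<le> 2 * \<delta> * cc" using cj d by (intro mult_left_mono) auto
  define b where "b = 1 + \<delta>"
  have b: "1 < b" using d by (simp add: b_def)
  have VT: "filterlim (weight_var p j) at_top at_top" by (rule weight_var_filterlim[OF G])
  have scale: "((\<lambda>t. ln (ln ((1 - \<epsilon>) * weight_var p j t)) / ln (ln (weight_var p j t))) \<longlongrightarrow> 1) at_top"
    by (rule filterlim_compose[OF loglog_scale VT]) (use eps in simp)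
  have ev1: "\<forall>\<^sub>F t in at_top. 1 - \<epsilon> < ln (ln ((1 - \<epsilon>) * weight_var p j t)) / ln (ln (weight_var p j t))"
    using eps by (intro order_tendstoD(1)[OF scale]) auto
  have ev2: "\<forall>\<^sub>F t in at_top. 1 \<le> ln (ln (weight_var p j t))"
    by (rule eventually_compose_filterlim[OF loglog_limits(1) VT])
  have ev3: "\<forall>\<^sub>F t in at_top. 4 < weight_var p j t" using VT unfolding filterlim_at_top_dense by blast
  \<comment> \<open>The grid bounds are stated at \<open>b ^ n\<close>, the claim at t. Under the
    root, one factor \<open>1 - \<epsilon>\<close> comes from the almost increasing variance and one
    from its iterated logarithm.\<close>
  have "\<forall>\<^sub>F t in at_top. \<forall>s\<ge>t. (1 - \<epsilon>) * lil_scale j t \<le> lil_scale j s"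
    using ev1 ev2 ev3 almost_mono[OF eps(1)]
  proof eventually_elim
    case (elim t)
    show ?case
    proof (intro allI impI)
      fix s assume s: "t \<le> s"
      let ?V = "weight_var p j t" and ?W = "weight_var p j s"
      have W: "(1 - \<epsilon>) * ?V \<le> ?W" using elim s by blast
      have "1 / 2 * 4 < (1 - \<epsilon>) * ?V" using elim eps by (intro mult_le_less_imp_less) auto
      then have W1: "1 < (1 - \<epsilon>) * ?V" by simp
      have l: "(1 - \<epsilon>) * ln (ln ?V) \<le> ln (ln ((1 - \<epsilon>) * ?V))"
      proof -
        have "0 < ln (ln ?V)" using elim(2) by linarith
        from elim(1)[unfolded pos_less_divide_eq[OF this]] show ?thesis by simp
      qed
      have "ln (ln ((1 - \<epsilon>) * ?V)) \<le> ln (ln ?W)" using W W1 by (intro ln_mono) auto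
      then have ll: "(1 - \<epsilon>) * ln (ln ?V) \<le> ln (ln ?W)" using l by linarith
      have "((1 - \<epsilon>) * ?V) * ((1 - \<epsilon>) * ln (ln ?V)) \<le> ?W * ln (ln ?W)"
      proof (rule mult_mono[OF W ll])
        show "0 \<le> ?W" using W W1 by linarith
        show "0 \<le> (1 - \<epsilon>) * ln (ln ?V)" using elim(2) eps by (intro mult_nonneg_nonneg) linarith+
      qed
      then have "sqrt ((1 - \<epsilon>)\<^sup>2 * (?V * ln (ln ?V))) \<le> sqrt (?W * ln (ln ?W))"
        by (simp add: power2_eq_square mult_ac)
      then show "(1 - \<epsilon>) * lil_scale j t \<le> lil_scale j s"
        using eps by (simp add: lil_scale_def real_sqrt_mult)
    qed
  qed
  from eventually_compose_filterlim[OF this geometric_at_top[OF b]]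
  have scale_ev: "\<forall>\<^sub>F n in sequentially. \<forall>s\<ge>b ^ n. (1 - \<epsilon>) * lil_scale j (b ^ n) \<le> lil_scale j s" .
  have "AE \<omega> in M. \<forall>\<^sub>F n in sequentially. \<forall>t\<in>{b ^ n..b ^ Suc n}.
    \<bar>(K_ge (Suc j') t \<omega> - tail_mean p (Suc j') t) - (K_ge (Suc j') (b ^ n) \<omega> - tail_mean p (Suc j') (b ^ n))\<bar>
      \<le> 2 * \<epsilon> * lil_scale j (b ^ n)"
    unfolding b_def by (rule chain_grid[OF G _ C eps(1) d]) (use EC(1) k1 d1 j' in \<open>auto intro: order_trans\<close>)
  moreover have "AE \<omega> in M. \<forall>\<^sub>F n in sequentially. \<forall>t\<in>{b ^ n..b ^ Suc n}.
    \<bar>(K_ge (Suc j) t \<omega> - tail_mean p (Suc j) t) - (K_ge (Suc j) (b ^ n) \<omega> - tail_mean p (Suc j) (b ^ n))\<bar>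
      \<le> 2 * \<epsilon> * lil_scale j (b ^ n)"
    unfolding b_def by (rule chain_grid[OF G EC(2) C eps(1) d]) (use d1 in \<open>auto simp: cc_def mult_ac\<close>)
  moreover have "AE \<omega> in M. \<forall>\<^sub>F n in sequentially.
    \<bar>K_star S X j (b ^ n) \<omega> - weight_mean p j (b ^ n)\<bar> \<le> (sqrt 2 + \<epsilon>) * lil_scale j (b ^ n)"
    by (rule upper_lil_grid[OF j G eps(1) b])
  ultimately show ?thesis using AE_regular
  proof eventually_elim
    case (elim \<omega>)
    define Z where "Z t = K_star S X j t \<omega> - weight_mean p j t" for t
    have Z: "Z t = (K_ge (Suc j') t \<omega> - tail_mean p (Suc j') t) - (K_ge (Suc j) t \<omega> - tail_mean p (Suc j) t)" if "0 < t" for t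
      using K_star_K_ge[OF elim(4) j, of t] weight_mean_tail[OF j that, of p] by (simp add: Z_def j')
    have "\<forall>\<^sub>F n in sequentially. \<forall>t\<in>{b ^ n..b ^ Suc n}. \<bar>Z t\<bar> \<le> (sqrt 2 + 13 * \<epsilon>) * lil_scale j t"
      using elim(1,2,3) scale_ev
    proof eventually_elim
      case (elim n)
      show ?case
      proof
        fix t assume t: "t \<in> {b ^ n..b ^ Suc n}"
        have b0: "0 < b ^ n" using b by simp
        have t0: "0 < t" using t b0 by auto
        let ?\<phi> = "lil_scale j (b ^ n)"
        have sc: "(1 - \<epsilon>) * ?\<phi> \<le> lil_scale j t" using elim(4) t by auto
        have "\<bar>Z t\<bar> \<le> (sqrt 2 + \<epsilon>) * ?\<phi> + 2 * \<epsilon> * ?\<phi> + 2 * \<epsilon> * ?\<phi>"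
          using elim(1)[rule_format, OF t] elim(2)[rule_format, OF t] elim(3) Z[OF t0] Z[OF b0]
          unfolding Z_def[of "b ^ n", symmetric] by linarith
        also have "\<dots> = (sqrt 2 + 5 * \<epsilon>) * ?\<phi>" by (simp add: algebra_simps)
        finally have 1: "\<bar>Z t\<bar> \<le> (sqrt 2 + 5 * \<epsilon>) * ?\<phi>" .
        have \<phi>0: "0 \<le> ?\<phi>"
        proof -
          have "0 \<le> (sqrt 2 + 5 * \<epsilon>) * ?\<phi>" using 1 by (rule order_trans[OF abs_ge_zero])
          moreover have "0 < sqrt 2 + 5 * \<epsilon>" using eps by (simp add: add_pos_pos)
          ultimately show ?thesis by (simp add: zero_le_mult_iff)
        qed
        \<comment> \<open>So far the bound is \<open>sqrt 2 + 5 * \<epsilon>\<close>: one \<epsilon>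
          from the grid and two from each monotone part. The 13 makes up for the division by
          \<open>1 - \<epsilon>\<close>: the surplus is
          \<open>\<epsilon> * (8 - sqrt 2 - 13 * \<epsilon>)\<close>, nonnegative up to \<epsilon> =
          1/2.\<close>
        have "sqrt 2 \<le> (3 / 2 :: real)" by (rule real_le_lsqrt) (auto simp: power2_eq_square)
        then have "0 \<le> \<epsilon> * (8 - sqrt 2 - 13 * \<epsilon>)" using eps by (intro mult_nonneg_nonneg) auto
        then have "sqrt 2 + 5 * \<epsilon> \<le> (sqrt 2 + 13 * \<epsilon>) * (1 - \<epsilon>)" by (simp add: algebra_simps)
        then have "(sqrt 2 + 5 * \<epsilon>) * ?\<phi> \<le> (sqrt 2 + 13 * \<epsilon>) * (1 - \<epsilon>) * ?\<phi>"
          using \<phi>0 by (rule mult_right_mono)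
        also have "\<dots> \<le> (sqrt 2 + 13 * \<epsilon>) * lil_scale j t"
          unfolding mult.assoc using sc eps by (intro mult_left_mono) auto
        finally show "\<bar>Z t\<bar> \<le> (sqrt 2 + 13 * \<epsilon>) * lil_scale j t" using 1 by linarith
      qed
    qed
    then obtain N where N: "\<forall>n\<ge>N. \<forall>t\<in>{b ^ n..b ^ Suc n}. \<bar>Z t\<bar> \<le> (sqrt 2 + 13 * \<epsilon>) * lil_scale j t"
      unfolding eventually_sequentially by blast
    have "\<bar>Z t\<bar> \<le> (sqrt 2 + 13 * \<epsilon>) * lil_scale j t" if t: "b ^ N \<le> t" for t
    proof -
      have "1 \<le> b ^ N" using b by simp
      then have "1 \<le> t" using t by linarith
      then obtain n where n: "b ^ n \<le> t" "t < b ^ Suc n" using power_interval[OF b] by blast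
      have "b ^ N < b ^ Suc n" using t n by linarith
      then have "N \<le> n" using b by (simp add: power_strict_increasing_iff del: power_Suc)
      then show ?thesis using n N by auto
    qed
    then show ?case unfolding Z_def eventually_at_top_linorder by blast
  qed
qed

end

section \<open>The lower half of the law of the iterated logarithm\<close>

context poissonized_karlin_scheme
begin

text \<open>
  The boxes outside the block \<open>A n\<close> carry at most the fraction \<open>\<delta>\<close> of the variance
  at time \<open>t n\<close>; discarding them costs \<open>4 * sqrt \<delta>\<close>.
\<close>

lemma lower_lil_blocks:
  fixes t :: "nat \<Rightarrow> real" and A :: "nat \<Rightarrow> nat set"
  assumes j: "1 \<le> j" and t: "0 < t 0" "strict_mono t"
    and A: "\<And>n. finite (A n)" "disjoint_family A"
    and VT: "filterlim (\<lambda>n. weight_var p j (t n)) at_top sequentially"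
    and up: "\<forall>\<^sub>F n in sequentially. ln (ln (weight_var p j (t n))) \<le> \<kappa> * ln (real n)"
    and lo: "\<forall>\<^sub>F n in sequentially. ln (real n) / 2 \<le> ln (ln (weight_var p j (t n)))"
    and rest: "\<forall>\<^sub>F n in sequentially. (\<Sum>k. of_bool (k \<in> - A n) * poisson_weight j (pmf p k * t n)) \<le> \<delta> * weight_var p j (t n)"
    and par: "0 < \<kappa>" "0 < \<delta>" "\<delta> < 1" "0 < d" "d < 1" "0 < \<alpha>"
      "(1 + 4 * d) * \<alpha>\<^sup>2 * \<kappa> \<le> 2 * ((1 - d)\<^sup>2 * (1 - \<delta>))"
  shows "AE \<omega> in M. \<exists>\<^sub>F n in sequentially.
    (\<alpha> - 4 * sqrt \<delta>) * lil_scale j (t n) \<le> K_star S X j (t n) \<omega> - weight_mean p j (t n)"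
proof -
  define w where "w k n = poisson_weight j (pmf p k * t n)" for k n
  define V where "V n = weight_var p j (t n)" for n
  define l where "l n = ln (ln (V n))" for n
  define \<phi> where "\<phi> n = lil_scale j (t n)" for n
  define vA where "vA n = (\<Sum>k\<in>A n. w k n * (1 - w k n))" for n
  define vB where "vB n = (\<Sum>k. of_bool (k \<in> - A n) * w k n * (1 - w k n))" for n
  define P where "P n c \<longleftrightarrow> \<alpha> * \<phi> n \<le> c - (\<Sum>k\<in>A n. w k n)" for n c
  define B where "B n = {\<omega> \<in> space M. 4 * sqrt \<delta> * \<phi> n \<le>
    \<bar>real (card {k \<in> - A n. balls k (t n) \<omega> = j}) - (\<Sum>k. of_bool (k \<in> - A n) * w k n)\<bar>}" for n
  have t0: "0 < t n" for n using t strict_mono_less_eq[OF t(2), of 0 n] by simp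
  have w: "0 \<le> w k n" "w k n \<le> 1" for k n
    using t0[of n] by (auto simp: w_def poisson_weight_nonneg poisson_weight_le_one)
  have sw: "summable (\<lambda>k. w k n)" for n
    unfolding w_def using j t0[of n] by (intro summable_poisson_weight) auto
  have swv: "summable (\<lambda>k. w k n * (1 - w k n))" for n
    by (rule summable_comparison_test'[OF sw[of n], of 0]) (auto simp: w mult_left_le)
  have sB: "summable (\<lambda>k. of_bool (k \<in> - A n) * w k n)" for n
    by (rule summable_comparison_test'[OF sw[of n], of 0]) (auto simp: w)
  have sBv: "summable (\<lambda>k. of_bool (k \<in> - A n) * w k n * (1 - w k n))" for n
    by (rule summable_comparison_test'[OF sw[of n], of 0]) (auto simp: w mult_left_le)
  have split: "(\<Sum>k. f k) = (\<Sum>k\<in>A n. f k) + (\<Sum>k. of_bool (k \<in> - A n) * f k)"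
    if "summable f" "summable (\<lambda>k. of_bool (k \<in> - A n) * f k)" for f :: "nat \<Rightarrow> real" and n
  proof -
    have s: "(\<lambda>k. of_bool (k \<in> A n) * f k) sums (\<Sum>k\<in>A n. f k)"
      using sums_If_finite_set[OF A(1)[of n], of f] by (simp add: of_bool_def if_distrib[of "\<lambda>x. x * _"] cong: if_cong)
    have "(\<lambda>k. of_bool (k \<in> A n) * f k + of_bool (k \<in> - A n) * f k) sums ((\<Sum>k\<in>A n. f k) + (\<Sum>k. of_bool (k \<in> - A n) * f k))"
      by (rule sums_add[OF s summable_sums[OF that(2)]])
    moreover have "of_bool (k \<in> A n) * f k + of_bool (k \<in> - A n) * f k = f k" for k by auto
    ultimately show ?thesis by (simp add: sums_iff)
  qed
  have Vsplit: "V n = vA n + vB n" for n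
    using split[of "\<lambda>k. w k n * (1 - w k n)" n] swv[of n] sBv[of n]
    by (simp add: V_def weight_var_def vA_def vB_def w_def mult.assoc)
  have Msplit: "weight_mean p j (t n) = (\<Sum>k\<in>A n. w k n) + (\<Sum>k. of_bool (k \<in> - A n) * w k n)" for n
    using split[OF sw sB] by (simp add: weight_mean_def w_def)
  have vB0: "0 \<le> vB n" for n unfolding vB_def by (intro suminf_nonneg sBv) (auto simp: w)
  have vB: "\<forall>\<^sub>F n in sequentially. vB n \<le> \<delta> * V n"
    using rest
  proof eventually_elim
    case (elim n)
    have "vB n \<le> (\<Sum>k. of_bool (k \<in> - A n) * w k n)"
      unfolding vB_def by (intro suminf_le sBv sB) (auto simp: w mult_left_le)
    then show ?case using elim by (simp add: V_def w_def)
  qed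
  have VT': "filterlim V at_top sequentially" using VT unfolding V_def .
  have lT: "filterlim l at_top sequentially"
    unfolding l_def by (rule filterlim_compose[OF _ VT']) real_asymp
  have lim: "((\<lambda>n. sqrt (l n / V n)) \<longlongrightarrow> 0) sequentially"
    unfolding l_def by (rule filterlim_compose[OF loglog_limits(2) VT'])
  have ev_x: "\<forall>\<^sub>F n in sequentially. sqrt (l n / V n) < c" if "0 < c" for c
    using that by (rule order_tendstoD(2)[OF lim])
  have ev_l: "\<forall>\<^sub>F n in sequentially. c \<le> l n" for c
    using lT unfolding filterlim_at_top by blast
  have ev_V: "\<forall>\<^sub>F n in sequentially. 0 < V n" using VT' unfolding filterlim_at_top_dense by blast
  have \<phi>_eq: "\<phi> n = sqrt (V n * l n)" for n by (simp add: \<phi>_def lil_scale_def V_def l_def)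
  have AEA: "AE \<omega> in M. \<exists>\<^sub>F n in sequentially. P n (real (card {k \<in> A n. balls k (t n) \<omega> = j}))"
  proof (rule second_borel_cantelli)
    show "indep_vars (\<lambda>_. count_space UNIV) (\<lambda>n \<omega>. P n (real (card {k \<in> A n. balls k (t n) \<omega> = j}))) UNIV"
      by (rule block_events_indep[OF t A])
    have c1: "0 < d\<^sup>2 / 40 * ((1 - d) * (1 - \<delta>) / \<alpha>)" using par by simp
    have ev: "\<forall>\<^sub>F n in sequentially. 1 / real n \<le> prob {\<omega> \<in> space M. P n (real (card {k \<in> A n. balls k (t n) \<omega> = j}))}"
      using vB ev_x[OF c1] ev_l[of 1] ev_l[of "8 / (d\<^sup>2 * \<alpha>\<^sup>2)"] ev_V up eventually_gt_at_top[of 0]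
    proof eventually_elim
      case (elim n)
      have V0: "0 < V n" and l1: "1 \<le> l n" using elim by auto
      have vA: "(1 - \<delta>) * V n \<le> vA n" "vA n \<le> V n" using elim(1) Vsplit[of n] vB0[of n] by (auto simp: algebra_simps)
      have dV: "0 < (1 - \<delta>) * V n" using par V0 by simp
      have vA0: "0 < vA n" using vA(1) dV by linarith
      have \<phi>2: "(\<phi> n)\<^sup>2 = V n * l n" using V0 l1 by (simp add: \<phi>_eq)
      have \<phi>0: "0 < \<phi> n" using V0 l1 by (simp add: \<phi>_eq)
      \<comment> \<open>Chosen so that the threshold \<open>(1 - d) * (\<theta> * vA n)\<close> of
        the tilting bound is exactly \<open>\<alpha> * \<phi> n\<close>. It is of order
        \<open>sqrt (l n / V n)\<close> and so eventually as small as that bound requires.\<close>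
      define \<theta> where "\<theta> = \<alpha> * \<phi> n / ((1 - d) * vA n)"
      have th0: "0 < \<theta>" using par \<phi>0 vA0 by (simp add: \<theta>_def)
      have eq: "(1 - d) * (\<theta> * vA n) = \<alpha> * \<phi> n" using par vA0 by (simp add: \<theta>_def)
      have thv: "\<theta>\<^sup>2 * vA n = \<alpha>\<^sup>2 * (V n * l n) / ((1 - d)\<^sup>2 * vA n)"
        using vA0 by (simp add: \<theta>_def power_divide power_mult_distrib \<phi>2) (simp add: power2_eq_square mult_ac)
      have th_le: "\<theta> \<le> d\<^sup>2 / 40"
      proof -
        have "\<theta> \<le> \<alpha> * \<phi> n / ((1 - d) * ((1 - \<delta>) * V n))"
          unfolding \<theta>_def using par \<phi>0 vA dV by (intro divide_left_mono mult_left_mono mult_pos_pos) auto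
        also have "\<dots> = \<alpha> / ((1 - d) * (1 - \<delta>)) * (\<phi> n / V n)" by simp
        also have "\<phi> n / V n = sqrt (l n / V n)"
          using V0 l1 by (simp add: \<phi>_eq real_sqrt_mult real_sqrt_divide real_div_sqrt field_simps)
        also have "\<alpha> / ((1 - d) * (1 - \<delta>)) * sqrt (l n / V n) \<le> \<alpha> / ((1 - d) * (1 - \<delta>)) * (d\<^sup>2 / 40 * ((1 - d) * (1 - \<delta>) / \<alpha>))"
          using elim(2) par by (intro mult_left_mono) auto
        also have "\<dots> = d\<^sup>2 / 40" using par by simp
        finally show ?thesis .
      qed
      have big: "8 \<le> d\<^sup>2 * (\<theta>\<^sup>2 * vA n)"
      proof -
        have "(1 - d)\<^sup>2 * vA n \<le> 1 * V n" using par vA vA0 by (intro mult_mono power_le_one) auto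
        then have "\<alpha>\<^sup>2 * (V n * l n) / (1 * V n) \<le> \<theta>\<^sup>2 * vA n"
          unfolding thv using par vA0 V0 l1 by (intro divide_left_mono mult_pos_pos) auto
        then have "\<alpha>\<^sup>2 * l n \<le> \<theta>\<^sup>2 * vA n" using V0 by simp
        then have "d\<^sup>2 * (\<alpha>\<^sup>2 * l n) \<le> d\<^sup>2 * (\<theta>\<^sup>2 * vA n)" by (intro mult_left_mono) auto
        moreover have "8 \<le> d\<^sup>2 * (\<alpha>\<^sup>2 * l n)" using elim(4) par by (simp add: field_simps)
        ultimately show ?thesis by linarith
      qed
      \<comment> \<open>The last parameter condition is made for this estimate: an exponent of at
        most \<open>ln n\<close> gives event n a probability of at least 1/n, and the harmonic
        series diverges.\<close>
      have expo: "(1 + 4 * d) * (\<theta>\<^sup>2 * vA n / 2) \<le> ln (real n)"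
      proof -
        have "\<theta>\<^sup>2 * vA n \<le> \<alpha>\<^sup>2 * (V n * l n) / ((1 - d)\<^sup>2 * ((1 - \<delta>) * V n))"
          unfolding thv using par vA dV vA0 V0 l1 by (intro divide_left_mono mult_left_mono mult_pos_pos) auto
        also have "\<dots> = \<alpha>\<^sup>2 * l n / ((1 - d)\<^sup>2 * (1 - \<delta>))" using V0 by simp
        finally have "(1 + 4 * d) * (\<theta>\<^sup>2 * vA n / 2) \<le> (1 + 4 * d) * ((\<alpha>\<^sup>2 * l n / ((1 - d)\<^sup>2 * (1 - \<delta>))) / 2)"
          using par by (intro mult_left_mono) auto
        also have "\<dots> = ((1 + 4 * d) * \<alpha>\<^sup>2 * \<kappa>) / (2 * ((1 - d)\<^sup>2 * (1 - \<delta>))) * (l n / \<kappa>)"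
          using par by simp
        also have "\<dots> \<le> 1 * (l n / \<kappa>)"
          using par l1 by (intro mult_right_mono) auto
        also have "\<dots> \<le> ln (real n)" using elim(6) par by (simp add: l_def V_def field_simps)
        finally show ?thesis .
      qed
      have "1 / real n = exp (- ln (real n))" using elim(7) by (simp add: exp_minus inverse_eq_divide)
      also have "\<dots> \<le> exp (- (1 + 4 * d) * (\<theta>\<^sup>2 * vA n / 2))"
        using expo by (simp only: exp_le_cancel_iff mult_minus_left neg_le_iff_le)
      also have "\<dots> \<le> prob {\<omega> \<in> space M. (1 - d) * (\<theta> * vA n) \<le>
          real (card {k \<in> A n. balls k (t n) \<omega> = j}) - (\<Sum>k\<in>A n. w k n)}"
        unfolding vA_def w_def
        by (rule lower_tail_weight[OF t0 j A(1)])
           (use par th0 th_le big in \<open>auto simp: vA_def w_def\<close>)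
      finally show ?case unfolding eq P_def .
    qed
    show "\<not> summable (\<lambda>n. prob {\<omega> \<in> space M. P n (real (card {k \<in> A n. balls k (t n) \<omega> = j}))})"
    proof
      assume "summable (\<lambda>n. prob {\<omega> \<in> space M. P n (real (card {k \<in> A n. balls k (t n) \<omega> = j}))})"
      then have "summable (\<lambda>n. 1 / real n)"
        by (rule summable_comparison_test_ev[rotated]) (use ev in \<open>auto elim: eventually_mono\<close>)
      then have "summable (\<lambda>n. real n powr (- 1))"
        by (simp add: powr_minus_divide)
      then show False by (simp only: summable_real_powr_iff)
    qed
  qed
  have [measurable]: "{\<omega> \<in> space M. k \<in> - A n \<and> balls k (t n) \<omega> = j} \<in> events" for k n by measurable
  have "AE \<omega> in M. \<forall>\<^sub>F n in sequentially. \<omega> \<notin> B n"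
  proof (rule borel_cantelli_bound)
    show "B n \<in> events" for n unfolding B_def by measurable
    show "summable (\<lambda>n. 2 * (1 * real n) powr (- 2))" by (rule summable_scaled_powr) auto
    have c: "0 < sqrt \<delta> / 4" using par by simp
    show "\<forall>\<^sub>F n in sequentially. prob (B n) \<le> 2 * (1 * real n) powr (- 2)"
      using vB ev_x[OF c] ev_l[of 1] ev_V lo eventually_gt_at_top[of 0]
    proof eventually_elim
      case (elim n)
      define x where "x = sqrt (l n / V n)"
      \<comment> \<open>The linear term becomes \<open>8 * l n\<close> and the quadratic one at most
        \<open>4 * l n\<close>, since the variance outside the block is at most
        \<open>\<delta> * V n\<close>. The remaining \<open>exp (- 4 * l n)\<close> is at most
        \<open>n powr (- 2)\<close> by the lower bound on the iterated logarithm.\<close>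
      define \<theta> where "\<theta> = 2 / sqrt \<delta> * x"
      have x0: "0 < x" using elim by (simp add: x_def)
      have x\<phi>: "x * \<phi> n = l n" using elim by (simp add: x_def \<phi>_eq real_sqrt_mult[symmetric])
      have x2: "V n * x\<^sup>2 = l n" using elim by (simp add: x_def)
      have th: "0 < \<theta>" "\<theta> \<le> 1 / 2"
      proof -
        show "0 < \<theta>" using x0 par by (simp add: \<theta>_def)
        have "\<theta> \<le> 2 / sqrt \<delta> * (sqrt \<delta> / 4)"
          unfolding \<theta>_def using elim(2) par by (intro mult_left_mono) (auto simp: x_def)
        then show "\<theta> \<le> 1 / 2" using par by simp
      qed
      have "prob (B n) \<le> 2 * exp (- \<theta> * (4 * sqrt \<delta> * \<phi> n) + (\<delta> * V n) * (\<theta>\<^sup>2 / 2 * (1 + 2 * \<theta>)))"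
        unfolding B_def w_def using elim(1) th
        by (intro chernoff_weight[OF t0 j]) (auto simp: vB_def w_def)
      also have "\<dots> \<le> 2 * exp (- 4 * l n)"
      proof -
        have "\<theta> * (4 * sqrt \<delta> * \<phi> n) = 8 * (x * \<phi> n)" using par by (simp add: \<theta>_def)
        moreover have "(\<delta> * V n) * (\<theta>\<^sup>2 / 2 * (1 + 2 * \<theta>)) \<le> (\<delta> * V n) * (\<theta>\<^sup>2 / 2 * 2)"
          using th par elim by (intro mult_left_mono) auto
        moreover have "(\<delta> * V n) * (\<theta>\<^sup>2 / 2 * 2) = 4 * (V n * x\<^sup>2)"
          using par by (simp add: \<theta>_def power_mult_distrib power_divide)
        ultimately have "- \<theta> * (4 * sqrt \<delta> * \<phi> n) + (\<delta> * V n) * (\<theta>\<^sup>2 / 2 * (1 + 2 * \<theta>)) \<le> - 4 * l n"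
          unfolding x\<phi> x2 by linarith
        then show ?thesis by (intro mult_left_mono iffD2[OF exp_le_cancel_iff]) auto
      qed
      also have "\<dots> \<le> 2 * exp (- 2 * ln (real n))"
        using elim(5) by (intro mult_left_mono iffD2[OF exp_le_cancel_iff]) (auto simp: l_def V_def)
      also have "exp (- 2 * ln (real n)) = (1 * real n) powr (- 2)" using elim(6) by (simp add: powr_def)
      finally show ?case .
    qed
  qed
  with AEA show ?thesis using AE_regular AE_space
  proof eventually_elim
    case (elim \<omega>)
    have "\<exists>\<^sub>F n in sequentially. P n (real (card {k \<in> A n. balls k (t n) \<omega> = j})) \<and> \<omega> \<notin> B n"
      by (rule frequently_eventually_frequently[OF elim(1,2)])
    then show ?case
    proof (rule frequently_elim1)
      fix n assume n: "P n (real (card {k \<in> A n. balls k (t n) \<omega> = j})) \<and> \<omega> \<notin> B n"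
      have "finite {k. balls k (t n) \<omega> = j}"
        by (rule finite_subset[OF _ finite_occupied[OF elim(3) j, of "t n"]]) auto
      moreover have "{k. balls k (t n) \<omega> = j} = {k \<in> A n. balls k (t n) \<omega> = j} \<union> {k \<in> - A n. balls k (t n) \<omega> = j}" by auto
      ultimately have "card {k. balls k (t n) \<omega> = j} = card {k \<in> A n. balls k (t n) \<omega> = j} + card {k \<in> - A n. balls k (t n) \<omega> = j}"
        by (metis (no_types, lifting) card_Un_disjoint finite_Un disjoint_iff ComplD mem_Collect_eq)
      then have K: "K_star S X j (t n) \<omega> = real (card {k \<in> A n. balls k (t n) \<omega> = j}) + real (card {k \<in> - A n. balls k (t n) \<omega> = j})"
        by (simp add: K_star_def)
      have b: "\<bar>real (card {k \<in> - A n. balls k (t n) \<omega> = j}) - (\<Sum>k. of_bool (k \<in> - A n) * w k n)\<bar> < 4 * sqrt \<delta> * \<phi> n"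
        using n elim(4) unfolding B_def by (simp only: mem_Collect_eq not_le) simp
      have a: "\<alpha> * \<phi> n \<le> real (card {k \<in> A n. balls k (t n) \<omega> = j}) - (\<Sum>k\<in>A n. w k n)"
        using n unfolding P_def by blast
      have "(\<alpha> - 4 * sqrt \<delta>) * \<phi> n = \<alpha> * \<phi> n - 4 * sqrt \<delta> * \<phi> n" by (simp add: algebra_simps)
      then show "(\<alpha> - 4 * sqrt \<delta>) * lil_scale j (t n) \<le> K_star S X j (t n) \<omega> - weight_mean p j (t n)"
        using a b unfolding K Msplit \<phi>_def[symmetric] by linarith
    qed
  qed
qed

end

section \<open>Asymptotics of means and variances\<close>

context regular_pmf
begin

lemma weight_mean_asymp:
  assumes j: "2 \<le> j"
  shows "((\<lambda>t. weight_mean p j t / R t) \<longlongrightarrow> 1 / (real j * (real j - 1))) at_top"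
proof -
  obtain n where n: "j = n + 2" using j by (metis add.commute le_Suc_ex)
  have A: "((\<lambda>t. 1 / fact (n + 2) * ((\<Sum>k. (pmf p k * t) ^ (n + 2) * exp (- 1 * (pmf p k * t))) / R t))
      \<longlongrightarrow> 1 / fact (n + 2) * (fact n / 1 ^ (n + 1))) at_top"
    by (intro tendsto_intros power_exp_sum_asymp) simp
  have B: "\<forall>\<^sub>F t in at_top. 1 / fact (n + 2) * ((\<Sum>k. (pmf p k * t) ^ (n + 2) * exp (- 1 * (pmf p k * t))) / R t)
      = weight_mean p j t / R t"
    using eventually_gt_at_top[of 0]
  proof eventually_elim
    case (elim t)
    have s: "summable (\<lambda>k. (pmf p k * t) ^ (n + 2) * exp (- 1 * (pmf p k * t)))"
      using summable_pmf_power_exp[of 1 t "n + 1"] elim by simp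
    have "weight_mean p j t = 1 / fact (n + 2) * (\<Sum>k. (pmf p k * t) ^ (n + 2) * exp (- 1 * (pmf p k * t)))"
      unfolding weight_mean_def poisson_weight_def n by (subst suminf_mult[OF s, symmetric]) simp
    then show ?case by simp
  qed
  have C: "1 / fact (n + 2) * (fact n / 1 ^ (n + 1)) = 1 / (real j * (real j - 1))"
  proof -
    have "(fact (n + 2) :: real) = real j * (real j - 1) * fact n" by (simp add: n algebra_simps)
    then show ?thesis by simp
  qed
  from Lim_transform_eventually[OF A B] show ?thesis unfolding C .
qed

definition weight_sq :: "nat \<Rightarrow> real \<Rightarrow> real" where
  "weight_sq j t = (\<Sum>k. (poisson_weight j (pmf p k * t))\<^sup>2)"

lemma weight_var_eq:
  assumes "1 \<le> j" "0 \<le> t"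
  shows "weight_var p j t = weight_mean p j t - weight_sq j t"
proof -
  have s1: "summable (\<lambda>k. poisson_weight j (pmf p k * t))" using assms by (rule summable_poisson_weight)
  have s2: "summable (\<lambda>k. (poisson_weight j (pmf p k * t))\<^sup>2)"
    by (rule summable_comparison_test'[OF s1, of 0])
       (use assms in \<open>auto simp: power2_eq_square poisson_weight_nonneg poisson_weight_le_one mult_left_le\<close>)
  show ?thesis
    unfolding weight_var_def weight_mean_def weight_sq_def
    by (subst suminf_diff[OF s1 s2]) (simp add: power2_eq_square algebra_simps)
qed

text \<open>Squaring a Poisson weight gives the power \<open>2 * j\<close> and the rate 2. This
  covers j = 1 as well, where the squares have the order of \<rho> and hence a smaller order than
  the mean.\<close>

lemma weight_sq_asymp:
  assumes j: "1 \<le> j"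
  shows "((\<lambda>t. weight_sq j t / R t) \<longlongrightarrow> fact (2 * j - 2) / (2 ^ (2 * j - 1) * (fact j)\<^sup>2)) at_top"
proof -
  obtain n where n: "j = Suc n" using j by (cases j) auto
  have "((\<lambda>t. 1 / (fact j)\<^sup>2 * ((\<Sum>k. (pmf p k * t) ^ (2 * n + 2) * exp (- 2 * (pmf p k * t))) / R t))
      \<longlongrightarrow> 1 / (fact j)\<^sup>2 * (fact (2 * n) / 2 ^ (2 * n + 1))) at_top"
    by (intro tendsto_intros power_exp_sum_asymp) simp
  moreover have "\<forall>\<^sub>F t in at_top. 1 / (fact j)\<^sup>2 * ((\<Sum>k. (pmf p k * t) ^ (2 * n + 2) * exp (- 2 * (pmf p k * t))) / R t)
      = weight_sq j t / R t"
    using eventually_gt_at_top[of 0]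
  proof eventually_elim
    case (elim t)
    have s: "summable (\<lambda>k. (pmf p k * t) ^ (2 * n + 2) * exp (- 2 * (pmf p k * t)))"
      using summable_pmf_power_exp[of 2 t "2 * n + 1"] elim by simp
    have "(poisson_weight j x)\<^sup>2 = 1 / (fact j)\<^sup>2 * (x ^ (2 * n + 2) * exp (- 2 * x))" for x :: real
    proof -
      have "(exp (- x))\<^sup>2 = exp (- 2 * x)" by (simp add: power2_eq_square exp_add[symmetric])
      moreover have "(x ^ j)\<^sup>2 = x ^ (2 * n + 2)"
      proof -
        have "2 * n + 2 = Suc n * 2" by simp
        then show ?thesis by (simp only: n power_mult)
      qed
      ultimately show ?thesis by (simp add: poisson_weight_def power_mult_distrib power_divide)
    qed
    then have "weight_sq j t = 1 / (fact j)\<^sup>2 * (\<Sum>k. (pmf p k * t) ^ (2 * n + 2) * exp (- 2 * (pmf p k * t)))"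
      unfolding weight_sq_def by (simp only:) (rule suminf_mult[OF s])
    then show ?case by simp
  qed
  ultimately have "((\<lambda>t. weight_sq j t / R t) \<longlongrightarrow> 1 / (fact j)\<^sup>2 * (fact (2 * n) / 2 ^ (2 * n + 1))) at_top"
    by (rule Lim_transform_eventually)
  moreover have "1 / (fact j)\<^sup>2 * (fact (2 * n) / 2 ^ (2 * n + 1)) = (fact (2 * j - 2) / (2 ^ (2 * j - 1) * (fact j)\<^sup>2) :: real)"
    by (simp add: n del: fact_Suc)
  ultimately show ?thesis by simp
qed

definition var_const :: "nat \<Rightarrow> real" where
  "var_const j = 1 / (real j * (real j - 1)) - fact (2 * j - 2) / (2 ^ (2 * j - 1) * (fact j)\<^sup>2)"

lemma weight_var_asymp:
  assumes j: "2 \<le> j"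
  shows "((\<lambda>t. weight_var p j t / R t) \<longlongrightarrow> var_const j) at_top"
proof -
  have "((\<lambda>t. weight_mean p j t / R t - weight_sq j t / R t) \<longlongrightarrow> var_const j) at_top"
    unfolding var_const_def using j by (intro tendsto_diff weight_mean_asymp weight_sq_asymp) auto
  moreover have "\<forall>\<^sub>F t in at_top. weight_mean p j t / R t - weight_sq j t / R t = weight_var p j t / R t"
    using eventually_ge_at_top[of 0]
    by eventually_elim (use j in \<open>simp add: weight_var_eq diff_divide_distrib\<close>)
  ultimately show ?thesis by (rule Lim_transform_eventually)
qed

text \<open>The subtracted term is \<open>1 / (j * (j - 1))\<close> times the binomial coefficient
  of \<open>2 * j - 2\<close> over \<open>j - 2\<close>, divided by \<open>2 ^ (2 * j - 1)\<close>.
  Since the coefficient is at most \<open>2 ^ (2 * j - 2)\<close>, at least half of the first term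
  survives.\<close>

lemma var_const_pos:
  assumes j: "2 \<le> j" shows "0 < var_const j"
proof -
  obtain n where n: "j = n + 2" using j by (metis add.commute le_Suc_ex)
  have f: "(fact (n + 2) :: real) = real j * (real j - 1) * fact n" by (simp add: n algebra_simps)
  have j0: "0 < real j * (real j - 1)" using j by simp
  have "real (2 * n + 2 choose n) \<le> real (2 ^ (2 * n + 2))" unfolding of_nat_le_iff by (rule binomial_le_pow2)
  moreover have "real (2 * n + 2 choose n) = fact (2 * n + 2) / (fact n * fact (n + 2))"
  proof -
    have "2 * n + 2 - n = n + 2" by simp
    then show ?thesis using binomial_fact[of n "2 * n + 2", where 'a=real] by simp
  qed
  ultimately have "fact (2 * n + 2) / (fact n * fact (n + 2)) \<le> (2::real) ^ (2 * n + 2)" by simp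
  then have "fact (2 * n + 2) \<le> 2 ^ (2 * n + 2) * (fact n * (fact (n + 2) :: real))"
    by (simp add: divide_le_eq del: fact_Suc)
  then have "fact (2 * n + 2) / (2 ^ (2 * n + 3) * (fact (n + 2))\<^sup>2) \<le>
      2 ^ (2 * n + 2) * (fact n * (fact (n + 2) :: real)) / (2 ^ (2 * n + 3) * (fact (n + 2))\<^sup>2)"
    by (intro divide_right_mono) auto
  also have "\<dots> = 1 / 2 * (fact n / fact (n + 2))"
  proof -
    have "(2::real) ^ (2 * n + 3) = 2 * 2 ^ (2 * n + 2)" by (simp add: power_add)
    then show ?thesis by (simp add: power2_eq_square del: fact_Suc)
  qed
  also have "fact n / fact (n + 2) = 1 / (real j * (real j - 1))" unfolding f by simp
  finally have le: "fact (2 * n + 2) / (2 ^ (2 * n + 3) * (fact (n + 2))\<^sup>2) \<le> 1 / 2 * (1 / (real j * (real j - 1)))" .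
  have "2 * j - 2 = 2 * n + 2" "2 * j - 1 = 2 * n + 3" by (auto simp: n)
  then have "var_const j = 1 / (real j * (real j - 1)) - fact (2 * n + 2) / (2 ^ (2 * n + 3) * (fact (n + 2))\<^sup>2)"
    by (simp only: var_const_def n[symmetric])
  then have "1 / 2 * (1 / (real j * (real j - 1))) \<le> var_const j" using le by linarith
  then show ?thesis using j0 by (simp add: less_le_trans[rotated])
qed

lemma weight_mean_1: "weight_mean p 1 t = occ1_mean t"
  by (simp add: weight_mean_def occ1_mean_def poisson_weight_def)

text \<open>The variance is the mean minus the squares; the mean is asymptotic to
  \<open>t * U t\<close>, the squares only have the order of \<rho>.\<close>

lemma weight_var_1_asymp: "((\<lambda>t. weight_var p 1 t / (t * U t)) \<longlongrightarrow> 1) at_top"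
proof -
  have "((\<lambda>t. weight_mean p 1 t / (t * U t) - weight_sq 1 t / R t * (R t / (t * U t)))
      \<longlongrightarrow> 1 - fact (2 * 1 - 2) / (2 ^ (2 * 1 - 1) * (fact 1)\<^sup>2) * 0) at_top"
    unfolding weight_mean_1 by (intro tendsto_diff tendsto_mult occ1_mean_asymp weight_sq_asymp R_over_U) auto
  then have "((\<lambda>t. weight_mean p 1 t / (t * U t) - weight_sq 1 t / R t * (R t / (t * U t))) \<longlongrightarrow> 1) at_top" by simp
  moreover have "\<forall>\<^sub>F t in at_top. weight_mean p 1 t / (t * U t) - weight_sq 1 t / R t * (R t / (t * U t)) = weight_var p 1 t / (t * U t)"
    using eventually_ge_at_top[of 0] R_pos
    by eventually_elim (simp add: weight_var_eq diff_divide_distrib)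
  ultimately show ?thesis by (rule Lim_transform_eventually)
qed

text \<open>The variance need not increase in t, but it is asymptotic to a multiple of an increasing
  function, namely of \<rho> or of \<open>t * U t\<close>.\<close>

lemma almost_mono_of_equivalent:
  fixes f g :: "real \<Rightarrow> real"
  assumes lim: "((\<lambda>t. f t / g t) \<longlongrightarrow> c) at_top" and c: "0 < c"
    and g: "\<forall>\<^sub>F t in at_top. 0 < g t" and mono: "\<And>s t. 0 < s \<Longrightarrow> s \<le> t \<Longrightarrow> g s \<le> g t"
    and eps: "0 < \<epsilon>"
  shows "\<forall>\<^sub>F t in at_top. \<forall>s\<ge>t. (1 - \<epsilon>) * f t \<le> f s"
proof -
  define \<eta> where "\<eta> = min \<epsilon> 1 / 2"
  have eta: "0 < \<eta>" "\<eta> \<le> 1 / 2" "\<eta> \<le> \<epsilon> / 2" using eps by (auto simp: \<eta>_def)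
  have "\<forall>\<^sub>F t in at_top. c * (1 - \<eta>) < f t / g t" "\<forall>\<^sub>F t in at_top. f t / g t < c * (1 + \<eta>)"
    using c eta by (auto intro!: order_tendstoD[OF lim])
  then have "\<forall>\<^sub>F t in at_top. c * (1 - \<eta>) * g t \<le> f t \<and> f t \<le> c * (1 + \<eta>) * g t \<and> 0 < g t \<and> 0 < t"
    using g eventually_gt_at_top[of 0]
    by eventually_elim (auto simp: pos_less_divide_eq pos_divide_less_eq)
  then obtain T where T: "\<And>t. T \<le> t \<Longrightarrow> c * (1 - \<eta>) * g t \<le> f t \<and> f t \<le> c * (1 + \<eta>) * g t \<and> 0 < g t \<and> 0 < t"
    unfolding eventually_at_top_linorder by blast
  have "(1 - \<epsilon>) * f t \<le> f s" if "T \<le> t" "t \<le> s" for s t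
  proof -
    note Tt = T[OF that(1)]
    have Ts: "c * (1 - \<eta>) * g s \<le> f s" using T[of s] that by simp
    have f0: "0 \<le> f t"
    proof -
      have "0 \<le> c * (1 - \<eta>) * g t" using c eta Tt by simp
      then show ?thesis using Tt by linarith
    qed
    have "g t \<le> g s" using mono[of t s] Tt that by simp
    then have "c * (1 - \<eta>) * g t \<le> c * (1 - \<eta>) * g s" using c eta by (intro mult_left_mono) auto
    then have 1: "c * (1 - \<eta>) * g t \<le> f s" using Ts by linarith
    have "(1 - \<epsilon>) * (1 + \<eta>) \<le> 1 - \<eta>"
    proof -
      have "(1 - \<epsilon>) * (1 + \<eta>) \<le> (1 - 2 * \<eta>) * (1 + \<eta>)" using eta by (intro mult_right_mono) auto
      also have "\<dots> = 1 - \<eta> - 2 * \<eta>\<^sup>2" by (simp add: power2_eq_square algebra_simps)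
      also have "\<dots> \<le> 1 - \<eta>" by simp
      finally show ?thesis .
    qed
    then have "(1 - \<epsilon>) * (1 + \<eta>) * (c * g t) \<le> (1 - \<eta>) * (c * g t)" using c Tt by (intro mult_right_mono) auto
    then have 2: "(1 - \<epsilon>) * (c * (1 + \<eta>) * g t) \<le> f s" using 1 by (simp add: mult_ac)
    show ?thesis
    proof (cases "\<epsilon> \<le> 1")
      case True
      then have "(1 - \<epsilon>) * f t \<le> (1 - \<epsilon>) * (c * (1 + \<eta>) * g t)" using Tt by (intro mult_left_mono) auto
      then show ?thesis using 2 by linarith
    next
      case False
      then have "(1 - \<epsilon>) * f t \<le> 0" using f0 by (intro mult_nonpos_nonneg) auto
      moreover have "0 \<le> c * (1 - \<eta>) * g t" using c eta Tt by simp
      ultimately show ?thesis using 1 by linarith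
    qed
  qed
  then show ?thesis unfolding eventually_at_top_linorder by blast
qed

text \<open>Multiplying by t turns the summands into \<open>min (pmf p k * t) 1\<close>, each of
  which increases.\<close>

lemma tU_mono:
  assumes "0 < s" "s \<le> t" shows "s * U s \<le> t * U t"
proof -
  have e: "u * U u = (\<Sum>k. min (pmf p k * u) 1)" if "0 < u" for u
  proof -
    have "u * min (pmf p k) (1 / u) = min (pmf p k * u) 1" for k using that by (auto simp: min_def field_simps)
    then show ?thesis unfolding U_def using suminf_mult[OF summable_U[OF that], of u] by simp
  qed
  have sm: "summable (\<lambda>k. min (pmf p k * u) 1)" if "0 < u" for u
    by (rule summable_box[where C=1 and f="\<lambda>x. min x 1"]) (use that in auto)
  have "min (pmf p k * s) 1 \<le> min (pmf p k * t) 1" for k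
    using assms by (intro min.mono mult_left_mono) auto
  then show ?thesis using assms by (simp add: e suminf_le sm)
qed

lemma weight_var_le:
  assumes "1 \<le> j" "0 \<le> t"
  shows "weight_var p j t \<le> t"
proof -
  have s: "summable (\<lambda>k. pmf p k * t)" by (intro summable_mult2 summable_pmf)
  have "weight_var p j t \<le> (\<Sum>k. pmf p k * t)"
    unfolding weight_var_def
  proof (rule suminf_le[OF _ _ s])
    show le: "poisson_weight j (pmf p k * t) * (1 - poisson_weight j (pmf p k * t)) \<le> pmf p k * t" for k
    proof -
      have "poisson_weight j (pmf p k * t) * (1 - poisson_weight j (pmf p k * t)) \<le> poisson_weight j (pmf p k * t)"
        using assms by (intro mult_left_le) (auto simp: poisson_weight_nonneg)
      also have "\<dots> \<le> pmf p k * t" using assms by (intro poisson_weight_le) auto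
      finally show ?thesis .
    qed
    show "summable (\<lambda>k. poisson_weight j (pmf p k * t) * (1 - poisson_weight j (pmf p k * t)))"
      by (rule summable_comparison_test'[OF s, of 0])
         (use le assms in \<open>auto simp: poisson_weight_nonneg poisson_weight_le_one\<close>)
  qed
  also have "\<dots> = (\<Sum>k. pmf p k) * t" by (rule suminf_mult2[OF summable_pmf, symmetric])
  also have "(\<Sum>k. pmf p k) \<le> 1"
    by (rule suminf_le_const[OF summable_pmf]) (simp add: sum_pmf_le_1)
  then have "(\<Sum>k. pmf p k) * t \<le> 1 * t" using assms by (intro mult_right_mono) auto
  finally show ?thesis by simp
qed

text \<open>The exponent 1/4 lies below the 1/2 of \<open>R_lower\<close>, which absorbs the
  constants.\<close>

lemma growth_of_dominates_R:
  assumes "\<forall>\<^sub>F t in at_top. c * R t \<le> f t" "0 < c"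
  shows "\<forall>\<^sub>F t in at_top. t powr (1 / 4) \<le> f t"
proof -
  obtain C where C: "0 < C" "\<forall>\<^sub>F t in at_top. C * sqrt t \<le> R t" using R_lower .
  have "0 < c * C" using C assms(2) by simp
  then have "\<forall>\<^sub>F t in at_top. t powr (1 / 4) \<le> (c * C) * sqrt t" by real_asymp
  then show ?thesis using C(2) assms(1)
  proof eventually_elim
    case (elim t)
    have "c * (C * sqrt t) \<le> c * R t" using elim assms(2) by (intro mult_left_mono) auto
    then show ?case using elim by (simp add: mult.assoc)
  qed
qed

lemma var_growth:
  assumes j: "1 \<le> j"
  shows "\<forall>\<^sub>F t in at_top. t powr (1 / 4) \<le> weight_var p j t"
proof (cases "2 \<le> j")
  case True
  have "\<forall>\<^sub>F t in at_top. var_const j / 2 < weight_var p j t / R t"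
    using var_const_pos[OF True] by (intro order_tendstoD(1)[OF weight_var_asymp[OF True]]) simp
  then have "\<forall>\<^sub>F t in at_top. var_const j / 2 * R t \<le> weight_var p j t"
    using R_pos by eventually_elim (simp add: pos_less_divide_eq)
  then show ?thesis by (rule growth_of_dominates_R) (simp add: var_const_pos[OF True])
next
  case False
  then have j1: "j = 1" using j by simp
  have "\<forall>\<^sub>F t in at_top. 1 / 2 < weight_var p 1 t / (t * U t)"
    by (intro order_tendstoD(1)[OF weight_var_1_asymp]) simp
  moreover have "\<forall>\<^sub>F t in at_top. 1 < t * U t / R t" using U_dominates unfolding filterlim_at_top_dense by blast
  ultimately have "\<forall>\<^sub>F t in at_top. 1 / 2 * R t \<le> weight_var p j t"
    using R_pos U_pos eventually_gt_at_top[of 0]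
  proof eventually_elim
    case (elim t)
    have tU: "0 < t * U t" using elim by simp
    have "1 / 2 * (t * U t) < weight_var p 1 t" using elim(1) tU by (simp add: pos_less_divide_eq)
    moreover have "R t < t * U t" using elim(2,3) by (simp add: pos_less_divide_eq)
    ultimately show ?case unfolding j1 by linarith
  qed
  then show ?thesis by (rule growth_of_dominates_R) simp
qed

lemma var_almost_mono:
  assumes j: "1 \<le> j" and eps: "0 < \<epsilon>"
  shows "\<forall>\<^sub>F t in at_top. \<forall>s\<ge>t. (1 - \<epsilon>) * weight_var p j t \<le> weight_var p j s"
proof (cases "2 \<le> j")
  case True
  show ?thesis
    by (rule almost_mono_of_equivalent[OF weight_var_asymp[OF True] var_const_pos[OF True] R_pos _ eps])
       (rule R_mono)
next
  case False
  then have j1: "j = 1" using j by simp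
  have "\<forall>\<^sub>F t in at_top. 0 < t * U t" using U_pos eventually_gt_at_top[of 0] by eventually_elim simp
  then show ?thesis unfolding j1
    by (rule almost_mono_of_equivalent[OF weight_var_1_asymp zero_less_one _ tU_mono eps])
qed

lemma bounded_ratio:
  fixes f g h :: "real \<Rightarrow> real"
  assumes "((\<lambda>t. f t / h t) \<longlongrightarrow> a) at_top" "((\<lambda>t. g t / h t) \<longlongrightarrow> b) at_top" "0 \<le> a" "0 < b"
    and h: "\<forall>\<^sub>F t in at_top. 0 < h t"
  shows "\<forall>\<^sub>F t in at_top. f t \<le> 2 * (a + 1) / b * g t"
proof -
  have "\<forall>\<^sub>F t in at_top. f t / h t < a + 1" by (rule order_tendstoD(2)[OF assms(1)]) simp
  moreover have "\<forall>\<^sub>F t in at_top. b / 2 < g t / h t" using assms(4) by (intro order_tendstoD(1)[OF assms(2)]) simp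
  ultimately show ?thesis using h
  proof eventually_elim
    case (elim t)
    have "f t \<le> (a + 1) * h t" using elim by (simp add: pos_divide_less_eq)
    also have "h t \<le> 2 / b * g t" using elim assms(4) by (simp add: pos_less_divide_eq field_simps)
    then have "(a + 1) * h t \<le> (a + 1) * (2 / b * g t)" using assms(3) by (intro mult_left_mono) auto
    finally show ?case by (simp add: mult_ac)
  qed
qed

text \<open>For j \<ge> 2 both means and the variance have the order of \<rho>. For j = 1 the mean
  number of boxes with two balls has this order too and is negligible against the variance, which
  grows like \<open>t * U t\<close>.\<close>

lemma mean_le_var:
  assumes j: "1 \<le> j"
  shows "\<exists>C>0. (\<forall>\<^sub>F t in at_top. weight_mean p j t \<le> C * weight_var p j t) \<and>
    (\<forall>\<^sub>F t in at_top. weight_mean p (Suc j) t \<le> C * weight_var p j t)"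
proof -
  have comb: "\<exists>C>0. (\<forall>\<^sub>F t in at_top. weight_mean p j t \<le> C * weight_var p j t) \<and>
    (\<forall>\<^sub>F t in at_top. weight_mean p (Suc j) t \<le> C * weight_var p j t)"
    if "\<forall>\<^sub>F t in at_top. weight_mean p j t \<le> C1 * weight_var p j t"
      "\<forall>\<^sub>F t in at_top. weight_mean p (Suc j) t \<le> C2 * weight_var p j t" for C1 C2
  proof (intro exI conjI)
    let ?C = "max 1 (max C1 C2)"
    have pos: "\<forall>\<^sub>F t in at_top. 0 \<le> weight_var p j t"
      using var_growth[OF j] by eventually_elim (rule order_trans[OF powr_ge_zero])
    have weaken: "x \<le> c' * v" if "x \<le> c * v" "0 \<le> v" "c \<le> c'" for x c c' v :: real
      using that(1) mult_right_mono[OF that(3,2)] by linarith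
    show "0 < ?C" by simp
    show "\<forall>\<^sub>F t in at_top. weight_mean p j t \<le> ?C * weight_var p j t"
      using that(1) pos by eventually_elim (erule weaken, auto)
    show "\<forall>\<^sub>F t in at_top. weight_mean p (Suc j) t \<le> ?C * weight_var p j t"
      using that(2) pos by eventually_elim (erule weaken, auto)
  qed
  show ?thesis
  proof (cases "2 \<le> j")
    case True
    show ?thesis
      by (rule comb[OF bounded_ratio[OF weight_mean_asymp[OF True] weight_var_asymp[OF True] _ var_const_pos[OF True] R_pos]
            bounded_ratio[OF weight_mean_asymp[of "Suc j"] weight_var_asymp[OF True] _ var_const_pos[OF True] R_pos]])
         (use True in auto)
  next
    case False
    then have j1: "j = 1" using j by simp
    have tU: "\<forall>\<^sub>F t in at_top. 0 < t * U t" using U_pos eventually_gt_at_top[of 0] by eventually_elim simp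
    have m1: "((\<lambda>t. weight_mean p 1 t / (t * U t)) \<longlongrightarrow> 1) at_top" unfolding weight_mean_1 by (rule occ1_mean_asymp)
    have A: "((\<lambda>t. weight_mean p 2 t / R t * (R t / (t * U t))) \<longlongrightarrow> 1 / (real 2 * (real 2 - 1)) * 0) at_top"
      by (intro tendsto_mult weight_mean_asymp R_over_U) simp
    have B: "\<forall>\<^sub>F t in at_top. weight_mean p 2 t / R t * (R t / (t * U t)) = weight_mean p 2 t / (t * U t)"
      using R_pos by eventually_elim simp
    from Lim_transform_eventually[OF A B]
    have m2: "((\<lambda>t. weight_mean p (Suc 1) t / (t * U t)) \<longlongrightarrow> 0) at_top"
      by (simp add: numeral_2_eq_2)
    show ?thesis unfolding j1
      by (rule comb[unfolded j1, OF bounded_ratio[OF m1 weight_var_1_asymp _ _ tU] bounded_ratio[OF m2 weight_var_1_asymp _ _ tU]]) auto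
  qed
qed

end

section \<open>The two halves combined\<close>

lemma frequently_filterlim:
  assumes "filterlim f F G" "\<exists>\<^sub>F x in G. P (f x)"
  shows "\<exists>\<^sub>F y in F. P y"
  using assms eventually_compose_filterlim[of "\<lambda>y. \<not> P y" F f G] unfolding frequently_def by blast

text \<open>Continuity at x = 0, where the last inequality reads
  \<open>(sqrt 2 - \<epsilon> / 2)\<^sup>2 \<le> 2\<close> and is strict. One number x will serve as
  d and \<delta> of \<open>lower_lil_blocks\<close> and, in the form \<open>1 + x\<close>, as its
  \<kappa>.\<close>

lemma lil_parameters:
  fixes \<epsilon> :: real
  assumes eps: "0 < \<epsilon>" "\<epsilon> < 1"
  shows "\<exists>x>0. x < 1 \<and> 4 * sqrt x \<le> \<epsilon> / 2 \<and>
    (1 + 4 * x) * (sqrt 2 - \<epsilon> / 2)\<^sup>2 * (1 + x) \<le> 2 * ((1 - x)\<^sup>2 * (1 - x))"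
proof -
  define c where "c = (sqrt 2 - \<epsilon> / 2)\<^sup>2"
  have s1: "1 \<le> sqrt (2::real)" by simp
  have "c < (sqrt 2)\<^sup>2" unfolding c_def using eps s1 by (intro power_strict_mono) linarith+
  then have c: "c < 2" by simp
  have lim1: "((\<lambda>x. 2 * ((1 - x)\<^sup>2 * (1 - x)) - (1 + 4 * x) * c * (1 + x)) \<longlongrightarrow>
      2 * ((1 - 0)\<^sup>2 * (1 - 0)) - (1 + 4 * 0) * c * (1 + 0)) (at_right 0)"
    by (intro tendsto_intros)
  have lim2: "((\<lambda>x. 4 * sqrt x) \<longlongrightarrow> 4 * sqrt 0) (at_right 0)" by (intro tendsto_intros)
  have "\<forall>\<^sub>F x in at_right 0. 0 < 2 * ((1 - x)\<^sup>2 * (1 - x)) - (1 + 4 * x) * c * (1 + x)"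
    using c by (intro order_tendstoD(1)[OF lim1]) simp
  moreover have "\<forall>\<^sub>F x in at_right 0. 4 * sqrt x < \<epsilon> / 2" using eps by (intro order_tendstoD(2)[OF lim2]) simp
  moreover have "\<forall>\<^sub>F x in at_right (0::real). 0 < x" by (rule eventually_at_right_less)
  moreover have "\<forall>\<^sub>F x in at_right (0::real). x < 1" by (rule order_tendstoD(2)[OF tendsto_ident_at]) simp
  ultimately have "\<forall>\<^sub>F x in at_right 0. 0 < x \<and> x < 1 \<and> 4 * sqrt x \<le> \<epsilon> / 2 \<and>
      (1 + 4 * x) * c * (1 + x) \<le> 2 * ((1 - x)\<^sup>2 * (1 - x))"
    by eventually_elim auto
  then show ?thesis
    unfolding c_def[symmetric] by (metis (mono_tags, lifting) eventually_happens trivial_limit_at_right_real)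
qed

locale karlin_regular = poissonized_karlin_scheme M p S X + regular_pmf p
  for M :: "'a measure" and p S X
begin

lemma upper_lil:
  assumes j: "1 \<le> j"
  shows "AE \<omega> in M. \<forall>m::nat. \<forall>\<^sub>F t in at_top.
    \<bar>K_star S X j t \<omega> - weight_mean p j t\<bar> \<le> (sqrt 2 + 13 / (real m + 2)) * lil_scale j t"
proof -
  obtain C where C: "0 < C" "\<forall>\<^sub>F t in at_top. weight_mean p j t \<le> C * weight_var p j t"
    "\<forall>\<^sub>F t in at_top. weight_mean p (Suc j) t \<le> C * weight_var p j t"
    using mean_le_var[OF j] by blast
  have "AE \<omega> in M. \<forall>\<^sub>F t in at_top.
    \<bar>K_star S X j t \<omega> - weight_mean p j t\<bar> \<le> (sqrt 2 + 13 / (real m + 2)) * lil_scale j t" for m :: nat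
    using upper_lil_eps[OF j var_growth[OF j] C var_almost_mono[OF j], of "1 / (real m + 2)"] by simp
  then show ?thesis by (simp add: AE_all_countable)
qed

lemma lil_scale_pos:
  assumes j: "1 \<le> j" shows "\<forall>\<^sub>F t in at_top. 0 < lil_scale j t"
proof -
  have VT: "filterlim (weight_var p j) at_top at_top" by (rule weight_var_filterlim[OF var_growth[OF j]])
  have "\<forall>\<^sub>F t in at_top. 0 < weight_var p j t" using VT unfolding filterlim_at_top_dense by blast
  then show ?thesis using eventually_compose_filterlim[OF loglog_limits(1) VT]
    by eventually_elim (simp add: lil_scale_def)
qed

lemma one_le_sqrt2: "1 \<le> sqrt (2::real)"
  by simp

text \<open>One half of \<epsilon> is spent on the constant reached inside the blocks, the other on
  the boxes discarded outside them.\<close>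

lemma lower_lil_along:
  assumes j: "1 \<le> j" and t: "filterlim t at_top sequentially"
    and ae: "AE \<omega> in M. \<exists>\<^sub>F n in sequentially.
      (sqrt 2 - \<epsilon> / 2 - 4 * sqrt x) * lil_scale j (t n) \<le> K_star S X j (t n) \<omega> - weight_mean p j (t n)"
    and x: "4 * sqrt x \<le> \<epsilon> / 2"
  shows "AE \<omega> in M. \<exists>\<^sub>F t in at_top. (sqrt 2 - \<epsilon>) * lil_scale j t \<le> K_star S X j t \<omega> - weight_mean p j t"
  using ae
proof eventually_elim
  case (elim \<omega>)
  from frequently_eventually_frequently[OF elim eventually_compose_filterlim[OF lil_scale_pos[OF j] t]]
  have "\<exists>\<^sub>F n in sequentially. (sqrt 2 - \<epsilon>) * lil_scale j (t n) \<le> K_star S X j (t n) \<omega> - weight_mean p j (t n)"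
  proof (rule frequently_elim1)
    fix n assume n: "(sqrt 2 - \<epsilon> / 2 - 4 * sqrt x) * lil_scale j (t n) \<le> K_star S X j (t n) \<omega> - weight_mean p j (t n)
      \<and> 0 < lil_scale j (t n)"
    have "(sqrt 2 - \<epsilon>) * lil_scale j (t n) \<le> (sqrt 2 - \<epsilon> / 2 - 4 * sqrt x) * lil_scale j (t n)"
      using x n by (intro mult_right_mono) auto
    then show "(sqrt 2 - \<epsilon>) * lil_scale j (t n) \<le> K_star S X j (t n) \<omega> - weight_mean p j (t n)"
      using n by linarith
  qed
  then show ?case by (rule frequently_filterlim[OF t])
qed

text \<open>Boxes with \<open>pmf p k * t\<close> outside the window from 1/b to b contribute at
  most a multiple of 1/b of \<rho> to the mean. Times growing by the factor
  \<open>b\<^sup>2\<close>, the ratio of the window's ends, make consecutive windows adjacent and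
  the blocks disjoint.\<close>

lemma lower_lil_ge2:
  assumes j: "2 \<le> j" and eps: "0 < \<epsilon>" "\<epsilon> < 1"
  shows "AE \<omega> in M. \<exists>\<^sub>F t in at_top. (sqrt 2 - \<epsilon>) * lil_scale j t \<le> K_star S X j t \<omega> - weight_mean p j t"
proof -
  obtain n where n: "j = n + 2" using j by (metis add.commute le_Suc_ex)
  have j1: "1 \<le> j" using j by simp
  obtain x where x: "0 < x" "x < 1" "4 * sqrt x \<le> \<epsilon> / 2"
    "(1 + 4 * x) * (sqrt 2 - \<epsilon> / 2)\<^sup>2 * (1 + x) \<le> 2 * ((1 - x)\<^sup>2 * (1 - x))"
    using lil_parameters[OF eps] by blast
  define c where "c = var_const j"
  have c: "0 < c" using var_const_pos[OF j] by (simp add: c_def)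
  \<comment> \<open>The discarded mean will be below \<open>5 / b * R s\<close> and the variance
    above \<open>c / 2 * R s\<close>; the fraction x is achieved once
    \<open>5 / b \<le> x * c / 2\<close>.\<close>
  define b where "b = max 2 (10 / (x * c))"
  have b: "2 \<le> b" "10 / (x * c) \<le> b" by (auto simp: b_def)
  define t where "t m = (b\<^sup>2) ^ m" for m :: nat
  define A where "A m = {k. 1 / b < pmf p k * t m \<and> pmf p k * t m \<le> b}" for m
  have b2: "1 < b\<^sup>2" using b by (simp add: one_less_power)
  have tpos: "0 < t m" for m using b by (simp add: t_def)
  have tT: "filterlim t at_top sequentially" unfolding t_def by (rule geometric_at_top[OF b2])
  have tmono: "strict_mono t" using mult_strict_right_mono[OF b2 tpos] by (simp add: strict_mono_Suc_iff t_def)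
  have finA: "finite (A m)" for m
  proof (rule finite_subset[OF _ finite_rho_set[of p "b * t m"]])
    show "A m \<subseteq> {k. 1 \<le> pmf p k * (b * t m)}" using b by (auto simp: A_def field_simps)
  qed
  have disjA: "disjoint_family A"
  proof -
    have "A m \<inter> A m' = {}" if "m < m'" for m m'
    proof -
      have "b\<^sup>2 * t m \<le> t m'"
        using power_increasing[of "Suc m" m' "b\<^sup>2"] that b2 by (simp add: t_def)
      then have "b * b * (pmf p k * t m) \<le> pmf p k * t m'" for k
        using mult_left_mono[of "b\<^sup>2 * t m" "t m'" "pmf p k"] by (simp add: power2_eq_square mult_ac)
      moreover have "b < b * b * (pmf p k * t m)" if "1 / b < pmf p k * t m" for k
        using that b mult_strict_left_mono[of "1 / b" "pmf p k * t m" "b * b"] by simp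
      ultimately show ?thesis unfolding A_def by (fastforce dest: less_le_trans)
    qed
    then show ?thesis unfolding disjoint_family_on_def by (metis Int_commute nat_neq_iff)
  qed
  have VT: "filterlim (\<lambda>m. weight_var p j (t m)) at_top sequentially"
    by (rule filterlim_compose[OF weight_var_filterlim[OF var_growth[OF j1]] tT])
  have "AE \<omega> in M. \<exists>\<^sub>F m in sequentially.
      (sqrt 2 - \<epsilon> / 2 - 4 * sqrt x) * lil_scale j (t m) \<le> K_star S X j (t m) \<omega> - weight_mean p j (t m)"
  proof (rule lower_lil_blocks[OF j1 tpos tmono finA disjA VT, where d=x and \<delta>=x and \<kappa>="1 + x"])
    have lb: "0 < ln (b\<^sup>2)" by (rule ln_gt_zero[OF b2])
    \<comment> \<open>Since \<open>ln (t m)\<close> is linear in m, its logarithm is asymptotic to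
      \<open>ln m\<close>, and any \<kappa> above 1 is admissible.\<close>
    have "((\<lambda>m. ln (ln (b\<^sup>2) * real m) / ln (real m)) \<longlongrightarrow> 1) sequentially"
      using lb by real_asymp
    then have "\<forall>\<^sub>F m in sequentially. ln (ln (b\<^sup>2) * real m) / ln (real m) < 1 + x"
      using x by (intro order_tendstoD(2)) auto
    moreover have "\<forall>\<^sub>F m in sequentially. 1 < weight_var p j (t m)"
      using VT unfolding filterlim_at_top_dense by blast
    ultimately show "\<forall>\<^sub>F m in sequentially. ln (ln (weight_var p j (t m))) \<le> (1 + x) * ln (real m)"
      using eventually_gt_at_top[of 1]
    proof eventually_elim
      case (elim m)
      have "weight_var p j (t m) \<le> t m" using j1 tpos[of m] by (intro weight_var_le) auto
      then have "ln (weight_var p j (t m)) \<le> ln (t m)" using elim by (intro ln_mono) auto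
      also have "ln (t m) = ln (b\<^sup>2) * real m" using b2 by (simp add: t_def ln_realpow)
      finally have "ln (ln (weight_var p j (t m))) \<le> ln (ln (b\<^sup>2) * real m)"
        using elim by (intro ln_mono) auto
      moreover have "ln (ln (b\<^sup>2) * real m) < (1 + x) * ln (real m)"
        using elim by (simp add: pos_divide_less_eq)
      ultimately show ?case by linarith
    qed
    have "0 < ln (b\<^sup>2) / 4" using lb by simp
    then have "\<forall>\<^sub>F m in sequentially. ln (real m) / 2 \<le> ln (ln (b\<^sup>2) / 4 * real m)" by real_asymp
    then show "\<forall>\<^sub>F m in sequentially. ln (real m) / 2 \<le> ln (ln (weight_var p j (t m)))"
      using loglog_var_geometric[OF var_growth[OF j1] b2] unfolding t_def by eventually_elim linarith
    \<comment> \<open>The majorant of the discarded mean, divided by \<rho>. The first sum handles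
      small \<open>pmf p k * s\<close> and contributes at most 3/b in the limit, with 3 for e; the
      second handles large values and contributes at most 1/b.\<close>
    define F where "F s = exp 1 / fact j * ((\<Sum>k. (pmf p k * s) ^ (n + 2) * exp (- (1 + b) * (pmf p k * s))) / R s)
      + 1 / (b * fact j) * ((\<Sum>k. (pmf p k * s) ^ (Suc n + 2) * exp (- 1 * (pmf p k * s))) / R s)" for s
    have limF: "(F \<longlongrightarrow> exp 1 / fact j * (fact n / (1 + b) ^ (n + 1)) + 1 / (b * fact j) * (fact (Suc n) / 1 ^ (Suc n + 1))) at_top"
      unfolding F_def using b by (intro tendsto_intros power_exp_sum_asymp) auto
    have "exp 1 / fact j * (fact n / (1 + b) ^ (n + 1)) + 1 / (b * fact j) * (fact (Suc n) / 1 ^ (Suc n + 1)) \<le> 4 / b"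
    proof -
      have f: "(fact n :: real) \<le> fact j" "(fact (Suc n) :: real) \<le> fact j" unfolding n by (intro fact_mono; simp)+
      have "(1 + b) ^ 1 \<le> (1 + b) ^ (n + 1)" using b by (intro power_increasing) auto
      then have "b \<le> (1 + b) ^ (n + 1)" by simp
      then have "fact n / (1 + b) ^ (n + 1) \<le> fact j / b" using f b by (intro frac_le) auto
      then have "exp 1 / fact j * (fact n / (1 + b) ^ (n + 1)) \<le> 3 / fact j * (fact j / b)"
        using exp_le b by (intro mult_mono divide_right_mono) auto
      moreover have "1 / (b * fact j) * (fact (Suc n) / 1 ^ (Suc n + 1)) \<le> 1 / (b * fact j) * fact j"
        using f b by (intro mult_left_mono) (auto simp del: fact_Suc)
      moreover have "3 / fact j * (fact j / b) = 3 / b" "1 / (b * fact j) * fact j = 1 / b" "3 / b + 1 / b = 4 / b" by simp_all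
      ultimately show ?thesis by linarith
    qed
    also have "4 / b < 5 / b" using b by (intro divide_strict_right_mono) auto
    finally have evF: "\<forall>\<^sub>F s in at_top. F s < 5 / b" by (rule order_tendstoD(2)[OF limF])
    have evV: "\<forall>\<^sub>F s in at_top. c / 2 < weight_var p j s / R s"
      using c unfolding c_def by (intro order_tendstoD(1)[OF weight_var_asymp[OF j]]) simp
    have ev: "\<forall>\<^sub>F s in at_top. F s * R s \<le> x * weight_var p j s"
      using evF evV R_pos
    proof eventually_elim
      case (elim s)
      have "F s * R s \<le> 5 / b * R s" using elim by (intro mult_right_mono) auto
      also have "5 / b \<le> x * (c / 2)" using b x c by (simp add: field_simps)
      then have "5 / b * R s \<le> x * (c / 2) * R s" using elim by (intro mult_right_mono) auto
      also have "\<dots> \<le> x * weight_var p j s"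
        using elim x by (simp add: pos_less_divide_eq mult.assoc)
      finally show ?case .
    qed
    show "\<forall>\<^sub>F m in sequentially. (\<Sum>k. of_bool (k \<in> - A m) * poisson_weight j (pmf p k * t m)) \<le> x * weight_var p j (t m)"
      using eventually_compose_filterlim[OF ev tT] eventually_compose_filterlim[OF R_pos tT]
    proof eventually_elim
      case (elim m)
      define y where "y k = pmf p k * t m" for k
      have y0: "0 \<le> y k" for k using tpos[of m] by (simp add: y_def)
      have s1: "summable (\<lambda>k. y k ^ (n + 2) * exp (- (1 + b) * y k))"
        using summable_pmf_power_exp[of "1 + b" "t m" "Suc n"] b tpos[of m] by (simp add: y_def)
      have s2: "summable (\<lambda>k. y k ^ (Suc n + 2) * exp (- 1 * y k))"
        using summable_pmf_power_exp[of 1 "t m" "Suc (Suc n)"] tpos[of m] by (simp add: y_def)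
      have pt: "of_bool (k \<in> - A m) * poisson_weight j (y k) \<le>
          exp 1 / fact j * (y k ^ (n + 2) * exp (- (1 + b) * y k)) + 1 / (b * fact j) * (y k ^ (Suc n + 2) * exp (- 1 * y k))" for k
      proof -
        have e: "exp (- (1 + b) * y k) = exp (- (b * y k)) * exp (- y k)"
          by (simp add: exp_add[symmetric] algebra_simps)
        \<comment> \<open>Both outer regions are dominated by functions that keep the sums of the
          form power times exponential: \<open>exp (1 - b * y) \<ge> 1\<close> for y \<le> 1/b, and
          y/b \<ge> 1 for y \<ge> b.\<close>
        have "of_bool (k \<in> - A m) \<le> exp (1 - b * y k) + y k / b"
        proof (cases "y k \<le> 1 / b")
          case True
          then have "b * y k \<le> 1" using b by (simp add: field_simps)
          then have "1 \<le> exp (1 - b * y k)" by simp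
          moreover have "0 \<le> y k / b" using y0[of k] b by simp
          ultimately have "1 \<le> exp (1 - b * y k) + y k / b" by linarith
          then show ?thesis by (cases "k \<in> A m") auto
        next
          case False
          show ?thesis
          proof (cases "k \<in> A m")
            case True
            then show ?thesis using y0[of k] b by (simp add: add_nonneg_nonneg)
          next
            case False
            then have "b \<le> y k" using \<open>\<not> y k \<le> 1 / b\<close> by (simp add: A_def y_def)
            then have "1 \<le> y k / b" using b by simp
            then have "1 \<le> exp (1 - b * y k) + y k / b" by (rule add_increasing[rotated]) simp
            then show ?thesis using False by simp
          qed
        qed
        then have "of_bool (k \<in> - A m) * poisson_weight j (y k) \<le> (exp (1 - b * y k) + y k / b) * poisson_weight j (y k)"
          by (intro mult_right_mono poisson_weight_nonneg y0)
        also have "\<dots> = exp 1 / fact j * (y k ^ (n + 2) * exp (- (1 + b) * y k)) + 1 / (b * fact j) * (y k ^ (Suc n + 2) * exp (- 1 * y k))"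
          unfolding e using b by (simp add: poisson_weight_def n exp_diff exp_minus algebra_simps divide_simps del: fact_Suc)
        finally show ?thesis .
      qed
      have sl: "summable (\<lambda>k. of_bool (k \<in> - A m) * poisson_weight j (y k))"
        by (rule summable_comparison_test'[OF summable_poisson_weight[of j "t m" p], of 0])
           (use j1 tpos[of m] in \<open>auto simp: y_def poisson_weight_nonneg\<close>)
      have "(\<Sum>k. of_bool (k \<in> - A m) * poisson_weight j (y k)) \<le>
          (\<Sum>k. exp 1 / fact j * (y k ^ (n + 2) * exp (- (1 + b) * y k)) + 1 / (b * fact j) * (y k ^ (Suc n + 2) * exp (- 1 * y k)))"
        by (intro suminf_le pt sl summable_add summable_mult s1 s2)
      also have "\<dots> = exp 1 / fact j * (\<Sum>k. y k ^ (n + 2) * exp (- (1 + b) * y k)) + 1 / (b * fact j) * (\<Sum>k. y k ^ (Suc n + 2) * exp (- 1 * y k))"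
        by (subst suminf_add[symmetric]) (intro summable_mult s1 s2 arg_cong2[where f="(+)"] suminf_mult)+
      also have "\<dots> = F (t m) * R (t m)"
      proof -
        have "R (t m) \<noteq> 0" using elim by simp
        then show ?thesis unfolding F_def y_def by (simp add: distrib_right)
      qed
      finally show ?case using elim(1) by (simp add: y_def)
    qed
    show "0 < sqrt 2 - \<epsilon> / 2" using eps one_le_sqrt2 by linarith
  qed (use x in auto)
  then show ?thesis by (rule lower_lil_along[OF j1 tT _ x(3)])
qed

text \<open>Choosing \<gamma> below x keeps the iterated logarithm of the variance within
  \<open>(1 + x) * ln n\<close>, while the vanishing quotient of \<open>U\<close> says that boxes
  reserved for later times carry a negligible part of the variance at time n.\<close>

lemma lower_lil_1:
  assumes star: "\<exists>\<^sub>F \<gamma> in at_right 0.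
      (\<lambda>n::nat. U (exp (real (n + 1) powr (1 + \<gamma>))) / U (exp (real n powr (1 + \<gamma>)))) \<longlonglongrightarrow> 0"
    and eps: "0 < \<epsilon>" "\<epsilon> < 1"
  shows "AE \<omega> in M. \<exists>\<^sub>F t in at_top. (sqrt 2 - \<epsilon>) * lil_scale 1 t \<le> K_star S X 1 t \<omega> - weight_mean p 1 t"
proof -
  obtain x where x: "0 < x" "x < 1" "4 * sqrt x \<le> \<epsilon> / 2"
    "(1 + 4 * x) * (sqrt 2 - \<epsilon> / 2)\<^sup>2 * (1 + x) \<le> 2 * ((1 - x)\<^sup>2 * (1 - x))"
    using lil_parameters[OF eps] by blast
  have "\<forall>\<^sub>F \<gamma> in at_right 0. 0 < \<gamma> \<and> \<gamma> < x"
    using eventually_at_right_less[of "0::real"] order_tendstoD(2)[OF tendsto_ident_at x(1)]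
    by eventually_elim auto
  from frequently_eventually_frequently[OF star this]
  obtain \<gamma> where g: "0 < \<gamma>" "\<gamma> < x"
    and lim: "(\<lambda>n::nat. U (exp (real (n + 1) powr (1 + \<gamma>))) / U (exp (real n powr (1 + \<gamma>)))) \<longlonglongrightarrow> 0"
    using frequently_ex by blast
  define t where "t n = exp (real n powr (1 + \<gamma>))" for n :: nat
  \<comment> \<open>The blocks cut the range of the probabilities at the points 1 /
    \<open>t n\<close>. Block n has \<open>pmf p k * t n \<le> 1\<close> throughout and is cut off
    below exactly where block n + 1 begins.\<close>
  define A where "A n = {k. 1 / t (Suc n) < pmf p k \<and> pmf p k \<le> 1 / t n}" for n
  have tpos: "0 < t n" for n by (simp add: t_def)
  have tmono: "strict_mono t"
    unfolding strict_mono_Suc_iff t_def using g by (auto intro!: powr_less_mono2)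
  have tT: "filterlim t at_top sequentially" unfolding t_def using g by real_asymp
  have finA: "finite (A n)" for n
  proof (rule finite_subset[OF _ finite_rho_set[of p "t (Suc n)"]])
    show "A n \<subseteq> {k. 1 \<le> pmf p k * t (Suc n)}"
      using tpos[of "Suc n"] by (auto simp: A_def pos_divide_less_eq)
  qed
  have disjA: "disjoint_family A"
  proof -
    have "A m \<inter> A n = {}" if "m < n" for m n
    proof -
      have "t (Suc m) \<le> t n" using that tmono by (simp add: strict_mono_less_eq)
      then have "1 / t n \<le> 1 / t (Suc m)" using tpos by (intro divide_left_mono) auto
      then show ?thesis by (auto simp: A_def)
    qed
    then show ?thesis unfolding disjoint_family_on_def by (metis Int_commute nat_neq_iff)
  qed
  have VT: "filterlim (\<lambda>n. weight_var p 1 (t n)) at_top sequentially"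
    by (rule filterlim_compose[OF weight_var_filterlim[OF var_growth] tT]) simp
  have "AE \<omega> in M. \<exists>\<^sub>F n in sequentially.
      (sqrt 2 - \<epsilon> / 2 - 4 * sqrt x) * lil_scale 1 (t n) \<le> K_star S X 1 (t n) \<omega> - weight_mean p 1 (t n)"
  proof (rule lower_lil_blocks[OF order_refl tpos tmono finA disjA VT, where d=x and \<delta>=x and \<kappa>="1 + x"])
    have lnt: "ln (ln (t n)) = (1 + \<gamma>) * ln (real n)" if "0 < n" for n
      using that by (simp add: t_def ln_powr)
    have "\<forall>\<^sub>F n in sequentially. 1 < weight_var p 1 (t n)"
      using VT unfolding filterlim_at_top_dense by blast
    then show "\<forall>\<^sub>F n in sequentially. ln (ln (weight_var p 1 (t n))) \<le> (1 + x) * ln (real n)"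
      using eventually_gt_at_top[of 1]
    proof eventually_elim
      case (elim n)
      have "weight_var p 1 (t n) \<le> t n" using tpos[of n] by (intro weight_var_le) auto
      then have "ln (weight_var p 1 (t n)) \<le> ln (t n)" using elim by (intro ln_mono) auto
      moreover have "0 < ln (weight_var p 1 (t n))" by (rule ln_gt_zero) (rule elim(1))
      ultimately have "ln (ln (weight_var p 1 (t n))) \<le> ln (ln (t n))" by (rule ln_mono)
      also have "\<dots> = (1 + \<gamma>) * ln (real n)" using elim by (intro lnt) simp
      also have "\<dots> \<le> (1 + x) * ln (real n)" using g elim by (intro mult_right_mono) auto
      finally show ?case .
    qed
    have "\<forall>\<^sub>F n in sequentially. ln (ln (t n) / 4) \<le> ln (ln (weight_var p 1 (t n)))"
      by (rule eventually_compose_filterlim[OF loglog_var_lower[OF var_growth] tT]) simp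
    moreover have "\<forall>\<^sub>F n in sequentially. ln (real n) / 2 \<le> (1 + \<gamma>) * ln (real n) - ln 4"
      using g by real_asymp
    ultimately show "\<forall>\<^sub>F n in sequentially. ln (real n) / 2 \<le> ln (ln (weight_var p 1 (t n)))"
      using eventually_gt_at_top[of 1]
    proof eventually_elim
      case (elim n)
      have "0 < ln (t n)" using elim by (simp add: t_def)
      then have "ln (ln (t n) / 4) = ln (ln (t n)) - ln 4" by (simp add: ln_div)
      then show ?case using elim lnt[of n] by simp
    qed
    let ?Q = "\<lambda>s. \<Sum>k. (pmf p k * s) ^ (0 + 2) * exp (- 1 * (pmf p k * s))"
    have "((\<lambda>s. ?Q s / R s * (R s / (s * U s))) \<longlongrightarrow> fact 0 / 1 ^ (0 + 1) * 0) at_top"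
      by (intro tendsto_mult power_exp_sum_asymp R_over_U) simp
    then have limQ: "((\<lambda>s. ?Q s / R s * (R s / (s * U s))) \<longlongrightarrow> 0) at_top" by simp
    have evQ: "\<forall>\<^sub>F s in at_top. ?Q s / R s * (R s / (s * U s)) < x / 4"
      using x by (intro order_tendstoD(2)[OF limQ]) simp
    have evV: "\<forall>\<^sub>F s in at_top. 1 / 2 < weight_var p 1 s / (s * U s)"
      by (intro order_tendstoD(1)[OF weight_var_1_asymp]) simp
    have tU: "\<forall>\<^sub>F s in at_top. 0 < s * U s" using U_pos eventually_gt_at_top[of 0] by eventually_elim simp
    have evS: "\<forall>\<^sub>F n in sequentially. U (t (Suc n)) / U (t n) < x / 4"
      using lim x unfolding t_def by (intro order_tendstoD(2)) auto
    show "\<forall>\<^sub>F n in sequentially. (\<Sum>k. of_bool (k \<in> - A n) * poisson_weight 1 (pmf p k * t n)) \<le> x * weight_var p 1 (t n)"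
      using eventually_compose_filterlim[OF evQ tT] eventually_compose_filterlim[OF evV tT]
        eventually_compose_filterlim[OF tU tT] eventually_compose_filterlim[OF R_pos tT] evS
    proof eventually_elim
      case (elim n)
      define y where "y k = pmf p k * t n" for k
      have y0: "0 \<le> y k" for k using tpos[of n] by (simp add: y_def)
      have s1: "summable (\<lambda>k. y k ^ (0 + 2) * exp (- 1 * y k))"
        using summable_pmf_power_exp[of 1 "t n" 1] tpos[of n] by (simp add: y_def numeral_2_eq_2)
      have s2: "summable (\<lambda>k. t n * min (pmf p k) (1 / t (Suc n)))"
        by (intro summable_mult summable_U tpos)
      \<comment> \<open>Boxes above the block have \<open>y k \<ge> 1\<close>, so an additional
        factor y turns their weight into a sum of order \<rho>. Those below have weight at most
        \<open>y k\<close>, and together these add up to at most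
        \<open>t n * U (t (Suc n))\<close>.\<close>
      have pt: "of_bool (k \<in> - A n) * poisson_weight 1 (y k) \<le>
          y k ^ (0 + 2) * exp (- 1 * y k) + t n * min (pmf p k) (1 / t (Suc n))" for k
      proof -
        have w: "poisson_weight 1 (y k) = y k * exp (- y k)" by (simp add: poisson_weight_def)
        have m0: "0 \<le> t n * min (pmf p k) (1 / t (Suc n))" using tpos[of n] tpos[of "Suc n"] by simp
        have q0: "0 \<le> y k ^ (0 + 2) * exp (- 1 * y k)" by simp
        have ob: "of_bool (k \<in> - A n) * poisson_weight 1 (y k) \<le> poisson_weight 1 (y k)"
          using poisson_weight_nonneg[OF y0, of 1 k] by (cases "k \<in> A n") auto
        consider "k \<in> A n" | "1 / t n < pmf p k" | "pmf p k \<le> 1 / t (Suc n)" unfolding A_def by force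
        then show ?thesis
        proof cases
          case 1
          then show ?thesis using m0 q0 by simp
        next
          case 2
          then have "1 \<le> y k" using tpos[of n] by (simp add: y_def pos_divide_less_eq)
          then have "1 * (y k * exp (- y k)) \<le> y k * (y k * exp (- y k))" using y0 by (intro mult_right_mono) auto
          also have "\<dots> = y k ^ (0 + 2) * exp (- 1 * y k)" by (simp add: power2_eq_square)
          finally have "poisson_weight 1 (y k) \<le> y k ^ (0 + 2) * exp (- 1 * y k)" by (simp only: w mult_1_left)
          then show ?thesis using m0 q0 ob by linarith
        next
          case 3
          have "poisson_weight 1 (y k) \<le> y k" using y0[of k] by (intro poisson_weight_le) auto
          also have "\<dots> = t n * min (pmf p k) (1 / t (Suc n))" using 3 by (simp add: y_def min_absorb1)
          finally show ?thesis using m0 q0 ob by linarith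
        qed
      qed
      have sl: "summable (\<lambda>k. of_bool (k \<in> - A n) * poisson_weight 1 (y k))"
        by (rule summable_comparison_test'[OF summable_poisson_weight[of 1 "t n" p], of 0])
           (use tpos[of n] in \<open>auto simp: y_def poisson_weight_nonneg\<close>)
      have "(\<Sum>k. of_bool (k \<in> - A n) * poisson_weight 1 (y k)) \<le>
          (\<Sum>k. y k ^ (0 + 2) * exp (- 1 * y k) + t n * min (pmf p k) (1 / t (Suc n)))"
        by (intro suminf_le pt sl summable_add s1 s2)
      also have "\<dots> = ?Q (t n) + t n * U (t (Suc n))"
        unfolding U_def y_def using suminf_add[OF s1 s2] suminf_mult[OF summable_U[OF tpos[of "Suc n"]], of "t n"]
        by (simp add: y_def)
      \<comment> \<open>Each part takes x/4 of \<open>t n * U (t n)\<close>; the variance is at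
        least half of that quantity, so the total is at most x times the variance.\<close>
      also have "\<dots> \<le> x / 4 * (t n * U (t n)) + x / 4 * (t n * U (t n))"
      proof (rule add_mono)
        have g: "a / s < c" if "0 < r" "a / r * (r / s) < c" for a r s c :: real using that by simp
        have "?Q (t n) / (t n * U (t n)) < x / 4" by (rule g[OF elim(4,1)])
        from this[unfolded pos_divide_less_eq[OF elim(3)]] show "?Q (t n) \<le> x / 4 * (t n * U (t n))"
          by (rule less_imp_le)
        have "0 < U (t n)" using elim(3) tpos[of n] by (simp add: zero_less_mult_iff)
        then have "U (t (Suc n)) \<le> x / 4 * U (t n)" using elim(5) by (simp add: pos_divide_less_eq)
        then have "t n * U (t (Suc n)) \<le> t n * (x / 4 * U (t n))" using tpos[of n] by (intro mult_left_mono) auto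
        then show "t n * U (t (Suc n)) \<le> x / 4 * (t n * U (t n))" by (simp add: mult_ac)
      qed
      also have "\<dots> = x * (1 / 2 * (t n * U (t n)))" by simp
      also have "\<dots> \<le> x * weight_var p 1 (t n)"
      proof (rule mult_left_mono)
        show "1 / 2 * (t n * U (t n)) \<le> weight_var p 1 (t n)"
          using elim(2) elim(3) by (simp only: pos_less_divide_eq)
      qed (use x in simp)
      finally show ?case by (simp add: y_def)
    qed
    show "0 < sqrt 2 - \<epsilon> / 2" using eps one_le_sqrt2 by linarith
  qed (use x in auto)
  then show ?thesis by (rule lower_lil_along[OF order_refl tT _ x(3)])
qed

section \<open>From eventual and frequent bounds to the upper and lower limits\<close>

lemma lil_ratio_eq:
  assumes "1 \<le> j" "0 < t"
  shows "lil_ratio M (K_star S X j) t \<omega> = (K_star S X j t \<omega> - weight_mean p j t) / lil_scale j t"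
  unfolding lil_ratio_def variance_K_star[OF assms(2,1)]
  unfolding expectation_K_star[OF assms(2,1)] lil_scale_def ..

lemma AE_lil_upper:
  assumes j: "1 \<le> j"
  shows "AE \<omega> in M. Limsup at_top (\<lambda>t. ereal (lil_ratio M (K_star S X j) t \<omega>)) \<le> ereal (sqrt 2)"
    and "AE \<omega> in M. Liminf at_top (\<lambda>t. ereal (lil_ratio M (K_star S X j) t \<omega>)) \<ge> ereal (- sqrt 2)"
proof -
  have lim: "(\<lambda>m::nat. 13 / (real m + 2)) \<longlonglongrightarrow> 0" by real_asymp
  have bound: "\<forall>\<^sub>F t in at_top. \<bar>lil_ratio M (K_star S X j) t \<omega>\<bar> \<le> sqrt 2 + 13 / (real m + 2)"
    if "\<forall>m::nat. \<forall>\<^sub>F t in at_top. \<bar>K_star S X j t \<omega> - weight_mean p j t\<bar> \<le> (sqrt 2 + 13 / (real m + 2)) * lil_scale j t" for \<omega> m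
    using that[rule_format, of m] lil_scale_pos[OF j] eventually_gt_at_top[of 0]
    by eventually_elim (simp add: lil_ratio_eq[OF j] abs_divide pos_divide_le_eq)
  show "AE \<omega> in M. Limsup at_top (\<lambda>t. ereal (lil_ratio M (K_star S X j) t \<omega>)) \<le> ereal (sqrt 2)"
    using upper_lil[OF j]
  proof eventually_elim
    case (elim \<omega>)
    have "Limsup at_top (\<lambda>t. ereal (lil_ratio M (K_star S X j) t \<omega>)) \<le> ereal (sqrt 2 + 13 / (real m + 2))" for m
      by (rule Limsup_bounded, rule eventually_mono[OF bound[OF elim, of m]]) auto
    moreover have T: "(\<lambda>m::nat. ereal (sqrt 2 + 13 / (real m + 2))) \<longlonglongrightarrow> ereal (sqrt 2)"
      using tendsto_add[OF tendsto_const lim, of "sqrt 2"] by (simp add: tendsto_ereal)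
    ultimately show ?case by (intro LIMSEQ_le_const[OF T]) blast
  qed
  show "AE \<omega> in M. Liminf at_top (\<lambda>t. ereal (lil_ratio M (K_star S X j) t \<omega>)) \<ge> ereal (- sqrt 2)"
    using upper_lil[OF j]
  proof eventually_elim
    case (elim \<omega>)
    have "ereal (- sqrt 2 - 13 / (real m + 2)) \<le> Liminf at_top (\<lambda>t. ereal (lil_ratio M (K_star S X j) t \<omega>))" for m
      by (rule Liminf_bounded, rule eventually_mono[OF bound[OF elim, of m]]) auto
    moreover have T: "(\<lambda>m::nat. ereal (- sqrt 2 - 13 / (real m + 2))) \<longlonglongrightarrow> ereal (- sqrt 2)"
      using tendsto_diff[OF tendsto_const lim, of "- sqrt 2"] by (simp add: tendsto_ereal)
    ultimately show ?case by (intro LIMSEQ_le_const2[OF T]) blast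
  qed
qed

lemma AE_lil_eq:
  assumes j: "1 \<le> j"
    and lower: "\<And>\<epsilon>. 0 < \<epsilon> \<Longrightarrow> \<epsilon> < 1 \<Longrightarrow>
      AE \<omega> in M. \<exists>\<^sub>F t in at_top. (sqrt 2 - \<epsilon>) * lil_scale j t \<le> K_star S X j t \<omega> - weight_mean p j t"
  shows "AE \<omega> in M. Limsup at_top (\<lambda>t. ereal (lil_ratio M (K_star S X j) t \<omega>)) = ereal (sqrt 2)"
proof -
  have lim: "(\<lambda>m::nat. 1 / (real m + 2)) \<longlonglongrightarrow> 0" by real_asymp
  have "AE \<omega> in M. \<forall>m::nat. \<exists>\<^sub>F t in at_top. (sqrt 2 - 1 / (real m + 2)) * lil_scale j t \<le> K_star S X j t \<omega> - weight_mean p j t"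
    by (subst AE_all_countable) (auto intro!: lower)
  then show ?thesis using AE_lil_upper(1)[OF j]
  proof eventually_elim
    case (elim \<omega>)
    let ?L = "Limsup at_top (\<lambda>t. ereal (lil_ratio M (K_star S X j) t \<omega>))"
    have "ereal (sqrt 2 - 1 / (real m + 2)) \<le> ?L" for m
    proof (rule ccontr)
      assume "\<not> ereal (sqrt 2 - 1 / (real m + 2)) \<le> ?L"
      then have "\<forall>\<^sub>F t in at_top. ereal (lil_ratio M (K_star S X j) t \<omega>) < ereal (sqrt 2 - 1 / (real m + 2))"
        by (intro Limsup_lessD) simp
      then have "\<forall>\<^sub>F t in at_top. \<not> (sqrt 2 - 1 / (real m + 2)) * lil_scale j t \<le> K_star S X j t \<omega> - weight_mean p j t"
        using lil_scale_pos[OF j] eventually_gt_at_top[of 0]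
        by eventually_elim (simp add: lil_ratio_eq[OF j] pos_divide_less_eq not_le)
      then show False using elim(1)[rule_format, of m] by (simp add: frequently_def)
    qed
    moreover have T: "(\<lambda>m::nat. ereal (sqrt 2 - 1 / (real m + 2))) \<longlonglongrightarrow> ereal (sqrt 2)"
      using tendsto_diff[OF tendsto_const lim, of "sqrt 2"] by (simp add: tendsto_ereal)
    ultimately have "ereal (sqrt 2) \<le> ?L" by (intro LIMSEQ_le_const2[OF T]) blast
    then show ?case using elim(2) by simp
  qed
qed

end

section \<open>The function \<open>L_hat\<close>\<close>

context regular_pmf
begin

text \<open>By Tonelli's theorem each box contributes the integral of \<open>1 / y\<^sup>2\<close>
  from \<open>max t (1 / pmf p k)\<close> to infinity, which is
  \<open>min (pmf p k) (1 / t)\<close>.\<close>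

lemma U_integral:
  assumes t: "0 < t"
  shows "(\<integral>\<^sup>+y. ennreal (R y / y\<^sup>2) * indicator {t..} y \<partial>lborel) = ennreal (U t)"
proof -
  have one: "(\<integral>\<^sup>+y. ennreal (1 / y\<^sup>2) * indicator {a..} y \<partial>lborel) = ennreal (1 / a)" if a: "0 < a" for a :: real
  proof -
    have "(\<integral>\<^sup>+y. ennreal (1 / y\<^sup>2) * indicator {a..} y \<partial>lborel) = ennreal (0 - (- (1 / a)))"
    proof (rule nn_integral_FTC_atLeast)
      show "DERIV (\<lambda>y. - (1 / y)) y :> 1 / y\<^sup>2" if "a \<le> y" for y
        using that a by (auto intro!: derivative_eq_intros simp: power2_eq_square)
      show "((\<lambda>y::real. - (1 / y)) \<longlongrightarrow> 0) at_top" by real_asymp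
    qed auto
    then show ?thesis by simp
  qed
  have box: "(\<integral>\<^sup>+y. ennreal (1 / y\<^sup>2) * indicator {y. t \<le> y \<and> 1 \<le> pmf p k * y} y \<partial>lborel) = ennreal (min (pmf p k) (1 / t))" for k
  proof (cases "pmf p k = 0")
    case True
    then show ?thesis using t by simp
  next
    case False
    then have pk: "0 < pmf p k" by (simp add: pmf_nonneg less_le)
    have m: "0 < max t (1 / pmf p k)" using t by simp
    have "{y. t \<le> y \<and> 1 \<le> pmf p k * y} = {max t (1 / pmf p k)..}"
      using pk by (auto simp: pos_divide_le_eq mult.commute)
    then have "(\<integral>\<^sup>+y. ennreal (1 / y\<^sup>2) * indicator {y. t \<le> y \<and> 1 \<le> pmf p k * y} y \<partial>lborel) = ennreal (1 / max t (1 / pmf p k))"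
      using one[OF m] by simp
    also have "1 / max t (1 / pmf p k) = min (pmf p k) (1 / t)"
      using pk t by (auto simp: max_def min_def field_simps)
    finally show ?thesis .
  qed
  have "ennreal (U t) = (\<Sum>k. ennreal (min (pmf p k) (1 / t)))"
    unfolding U_def using t by (intro suminf_ennreal2[symmetric] summable_U) auto
  also have "\<dots> = (\<Sum>k. \<integral>\<^sup>+y. ennreal (1 / y\<^sup>2) * indicator {y. t \<le> y \<and> 1 \<le> pmf p k * y} y \<partial>lborel)"
    by (simp add: box)
  also have "\<dots> = (\<integral>\<^sup>+y. (\<Sum>k. ennreal (1 / y\<^sup>2) * indicator {y. t \<le> y \<and> 1 \<le> pmf p k * y} y) \<partial>lborel)"
    by (rule nn_integral_suminf[symmetric]) measurable
  also have "\<dots> = (\<integral>\<^sup>+y. ennreal (R y / y\<^sup>2) * indicator {t..} y \<partial>lborel)"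
  proof (rule nn_integral_cong)
    fix y :: real
    have "(\<Sum>k. ennreal (1 / y\<^sup>2) * indicator {y. t \<le> y \<and> 1 \<le> pmf p k * y} y) =
        (\<Sum>k\<in>{k. 1 \<le> pmf p k * y}. ennreal (1 / y\<^sup>2) * indicator {y. t \<le> y \<and> 1 \<le> pmf p k * y} y)"
      by (rule suminf_finite[OF finite_rho_set]) auto
    also have "\<dots> = (\<Sum>k\<in>{k. 1 \<le> pmf p k * y}. ennreal (1 / y\<^sup>2) * indicator {t..} y)"
      by (rule sum.cong) (auto simp: indicator_def)
    also have "\<dots> = ennreal (R y / y\<^sup>2) * indicator {t..} y"
    proof -
      have "ennreal (R y / y\<^sup>2) = of_nat (\<rho> p y) * ennreal (1 / y\<^sup>2)"
        by (simp add: ennreal_of_nat_eq_real_of_nat ennreal_mult[symmetric])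
      then show ?thesis by (simp add: rho_eq mult.assoc)
    qed
    finally show "(\<Sum>k. ennreal (1 / y\<^sup>2) * indicator {y. t \<le> y \<and> 1 \<le> pmf p k * y} y) =
        ennreal (R y / y\<^sup>2) * indicator {t..} y" .
  qed
  finally show ?thesis by simp
qed

lemma U_set_integral:
  assumes t: "0 < t"
  shows "set_integrable lebesgue {t..} (\<lambda>y. R y / y\<^sup>2)" "(LINT y:{t..}|lebesgue. R y / y\<^sup>2) = U t"
proof -
  let ?f = "\<lambda>y. indicat_real {t..} y *\<^sub>R (R y / y\<^sup>2)"
  have m [measurable]: "?f \<in> borel_measurable lborel" by measurable
  have e: "ennreal (?f y) = ennreal (R y / y\<^sup>2) * indicator {t..} y" for y by (auto simp: indicator_def)
  have nn: "(\<integral>\<^sup>+y. ennreal (?f y) \<partial>lborel) = ennreal (U t)" unfolding e by (rule U_integral[OF t])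
  have "integrable lborel ?f \<and> integral\<^sup>L lborel ?f = U t"
    using nn U_nonneg[OF t] by (subst nn_integral_eq_integrable[symmetric]) (auto simp: indicator_def)
  then show "set_integrable lebesgue {t..} (\<lambda>y. R y / y\<^sup>2)" "(LINT y:{t..}|lebesgue. R y / y\<^sup>2) = U t"
    unfolding set_integrable_def set_lebesgue_integral_def
    by (simp_all only: integrable_completion[OF m] integral_completion[OF m])
qed

section \<open>Transfer between \<open>U\<close> and \<open>L_hat\<close>\<close>

context
  fixes L :: "real \<Rightarrow> real"
  assumes sv: "slowly_varying L"
    and RL: "((\<lambda>t. R t / (t * L t)) \<longlongrightarrow> 1) at_top"
begin

lemma L_pos: "\<forall>\<^sub>F t in at_top. 0 < L t"
  using sv unfolding slowly_varying_def eventually_at_top_linorder by blast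

lemma LR: "((\<lambda>t. t * L t / R t) \<longlongrightarrow> 1) at_top"
  using tendsto_inverse[OF RL] by (simp add: inverse_eq_divide)

text \<open>Far enough out, \<open>L y / y\<close> lies between \<open>1 - \<epsilon>\<close> and
  \<open>1 + \<epsilon>\<close> times \<open>R y / y\<^sup>2\<close>. As the latter has the finite
  integral \<open>U t\<close>, this domination yields integrability and both inequalities.\<close>

lemma L_hat_bounds:
  assumes eps: "0 < \<epsilon>"
  shows "\<forall>\<^sub>F t in at_top. set_integrable lebesgue {t..} (\<lambda>y. L y / y) \<and>
    (1 - \<epsilon>) * U t \<le> L_hat L t \<and> L_hat L t \<le> (1 + \<epsilon>) * U t"
proof -
  obtain a where a: "L \<in> borel_measurable (lebesgue_on {a..})"
    using sv unfolding slowly_varying_def by blast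
  have "\<forall>\<^sub>F t in at_top. 1 - \<epsilon> < t * L t / R t" "\<forall>\<^sub>F t in at_top. t * L t / R t < 1 + \<epsilon>"
    using eps by (auto intro!: order_tendstoD[OF LR])
  then have "\<forall>\<^sub>F t in at_top. (1 - \<epsilon>) * R t \<le> t * L t \<and> t * L t \<le> (1 + \<epsilon>) * R t \<and> 0 < L t"
    using R_pos L_pos by eventually_elim (auto simp: pos_less_divide_eq pos_divide_less_eq)
  then obtain T0 where T0: "\<And>y. T0 \<le> y \<Longrightarrow> (1 - \<epsilon>) * R y \<le> y * L y \<and> y * L y \<le> (1 + \<epsilon>) * R y \<and> 0 < L y"
    unfolding eventually_at_top_linorder by blast
  define T where "T = max 1 (max a T0)"
  have "set_integrable lebesgue {t..} (\<lambda>y. L y / y) \<and> (1 - \<epsilon>) * U t \<le> L_hat L t \<and> L_hat L t \<le> (1 + \<epsilon>) * U t"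
    if t: "T \<le> t" for t
  proof -
    have t0: "0 < t" using t by (simp add: T_def)
    have bd: "(1 - \<epsilon>) * (R y / y\<^sup>2) \<le> L y / y" "L y / y \<le> (1 + \<epsilon>) * (R y / y\<^sup>2)" "0 \<le> L y / y" if "y \<in> {t..}" for y
    proof -
      have y: "0 < y" "T0 \<le> y" using that t by (auto simp: T_def)
      have e: "L y / y = y * L y / y\<^sup>2" using y by (simp add: power2_eq_square)
      show "(1 - \<epsilon>) * (R y / y\<^sup>2) \<le> L y / y" "L y / y \<le> (1 + \<epsilon>) * (R y / y\<^sup>2)"
        unfolding e times_divide_eq_right using T0[OF y(2)] by (auto intro!: divide_right_mono)
      show "0 \<le> L y / y" using T0[OF y(2)] y by simp
    qed
    note I = U_set_integral[OF t0]
    have sub: "{t..} \<subseteq> {a..}" using t by (auto simp: T_def)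
    have "L \<in> borel_measurable (lebesgue_on {t..})" by (rule measurable_restrict_mono[OF a sub])
    moreover have "(\<lambda>y. y) \<in> borel_measurable (lebesgue_on {t..})"
      by (intro measurable_restrict_space1) (simp add: measurable_completion)
    ultimately have "(\<lambda>y. L y / y) \<in> borel_measurable (lebesgue_on {t..})" by (rule borel_measurable_divide)
    then have m: "(\<lambda>y. indicat_real {t..} y *\<^sub>R (L y / y)) \<in> borel_measurable lebesgue"
      by (subst (asm) borel_measurable_restrict_space_iff) auto
    have J: "set_integrable lebesgue {t..} (\<lambda>y. L y / y)"
      unfolding set_integrable_def
    proof (rule Bochner_Integration.integrable_bound[OF _ m])
      show "integrable lebesgue (\<lambda>y. (1 + \<epsilon>) * (indicat_real {t..} y *\<^sub>R (R y / y\<^sup>2)))"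
        using I(1) unfolding set_integrable_def by (rule integrable_mult_right)
      show "AE y in lebesgue. norm (indicat_real {t..} y *\<^sub>R (L y / y)) \<le> norm ((1 + \<epsilon>) * (indicat_real {t..} y *\<^sub>R (R y / y\<^sup>2)))"
      proof (rule AE_I2)
        fix y
        show "norm (indicat_real {t..} y *\<^sub>R (L y / y)) \<le> norm ((1 + \<epsilon>) * (indicat_real {t..} y *\<^sub>R (R y / y\<^sup>2)))"
        proof (cases "y \<in> {t..}")
          case True
          have "\<bar>L y / y\<bar> = L y / y" by (rule abs_of_nonneg[OF bd(3)[OF True]])
          also have "\<dots> \<le> \<bar>(1 + \<epsilon>) * (R y / y\<^sup>2)\<bar>" by (rule order_trans[OF bd(2)[OF True] abs_ge_self])
          finally show ?thesis by (simp only: indicator_simps(1)[OF True] scaleR_one real_norm_def)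
        qed simp
      qed
    qed
    have "(LINT y:{t..}|lebesgue. (1 - \<epsilon>) * (R y / y\<^sup>2)) \<le> (LINT y:{t..}|lebesgue. L y / y)"
      by (rule set_integral_mono[OF _ J bd(1)], rule set_integrable_mult_right, rule I(1))
    moreover have "(LINT y:{t..}|lebesgue. L y / y) \<le> (LINT y:{t..}|lebesgue. (1 + \<epsilon>) * (R y / y\<^sup>2))"
      by (rule set_integral_mono[OF J _ bd(2)], rule set_integrable_mult_right, rule I(1))
    ultimately show ?thesis
      using J I(2) unfolding L_hat_def set_integral_mult_right by simp
  qed
  then show ?thesis unfolding eventually_at_top_linorder by blast
qed

lemma L_over_x_integrable: "\<forall>\<^sub>F t in at_top. set_integrable lebesgue {t..} (\<lambda>y. L y / y)"
  using L_hat_bounds[of 1] by (auto elim: eventually_mono)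

lemma L_hat_U: "((\<lambda>t. L_hat L t / U t) \<longlongrightarrow> 1) at_top"
proof (rule tendstoI)
  fix e :: real assume e: "0 < e"
  show "\<forall>\<^sub>F t in at_top. dist (L_hat L t / U t) 1 < e"
    using L_hat_bounds[of "e / 2"] U_pos
  proof (rule eventually_elim2)
    fix t assume t: "set_integrable lebesgue {t..} (\<lambda>y. L y / y) \<and>
      (1 - e / 2) * U t \<le> L_hat L t \<and> L_hat L t \<le> (1 + e / 2) * U t" "0 < U t"
    then have "1 - e / 2 \<le> L_hat L t / U t" "L_hat L t / U t \<le> 1 + e / 2"
      by (auto simp: pos_le_divide_eq pos_divide_le_eq)
    then show "dist (L_hat L t / U t) 1 < e" using e by (simp add: dist_real_def abs_le_iff abs_less_iff)
  qed (use e in simp)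
qed

lemma L_hat_pos: "\<forall>\<^sub>F t in at_top. 0 < L_hat L t"
proof -
  have "\<forall>\<^sub>F t in at_top. 0 < L_hat L t / U t" by (rule order_tendstoD(1)[OF L_hat_U]) simp
  then show ?thesis using U_pos by eventually_elim (simp add: zero_less_divide_iff)
qed

lemma L_over_L_hat: "((\<lambda>t. L t / L_hat L t) \<longlongrightarrow> 0) at_top"
proof -
  have A: "((\<lambda>t. (t * L t / R t) * (R t / (t * U t)) * inverse (L_hat L t / U t)) \<longlongrightarrow> 1 * 0 * inverse 1) at_top"
    by (intro tendsto_mult tendsto_inverse LR R_over_U L_hat_U) simp
  have B: "\<forall>\<^sub>F t in at_top. (t * L t / R t) * (R t / (t * U t)) * inverse (L_hat L t / U t) = L t / L_hat L t"
    using R_pos U_pos eventually_gt_at_top[of 0] by eventually_elim (simp add: inverse_eq_divide)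
  from Lim_transform_eventually[OF A B] show ?thesis by simp
qed

text \<open>The quotient \<open>L_hat L t / U t\<close> tends to 1 along f and along g, so it
  cancels from the ratio. With f and g free, the same fact serves slow variation and the star
  condition.\<close>

lemma L_hat_ratio_transfer:
  assumes f: "filterlim f at_top F" and g: "filterlim g at_top F"
  shows "((\<lambda>n. L_hat L (f n) / L_hat L (g n)) \<longlongrightarrow> c) F \<longleftrightarrow> ((\<lambda>n. U (f n) / U (g n)) \<longlongrightarrow> c) F"
proof -
  let ?q = "\<lambda>t. L_hat L t / U t"
  have qf: "((\<lambda>n. ?q (f n)) \<longlongrightarrow> 1) F" by (rule filterlim_compose[OF L_hat_U f])
  have qg: "((\<lambda>n. ?q (g n)) \<longlongrightarrow> 1) F" by (rule filterlim_compose[OF L_hat_U g])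
  have q: "((\<lambda>n. ?q (f n) / ?q (g n)) \<longlongrightarrow> 1) F" using tendsto_divide[OF qf qg] by simp
  have q': "((\<lambda>n. ?q (g n) / ?q (f n)) \<longlongrightarrow> 1) F" using tendsto_divide[OF qg qf] by simp
  note ev = eventually_compose_filterlim[OF U_pos f] eventually_compose_filterlim[OF U_pos g]
    eventually_compose_filterlim[OF L_hat_pos f] eventually_compose_filterlim[OF L_hat_pos g]
  have B: "\<forall>\<^sub>F n in F. ?q (f n) / ?q (g n) * (U (f n) / U (g n)) = L_hat L (f n) / L_hat L (g n)"
    using ev by eventually_elim simp
  have B': "\<forall>\<^sub>F n in F. ?q (g n) / ?q (f n) * (L_hat L (f n) / L_hat L (g n)) = U (f n) / U (g n)"
    using ev by eventually_elim simp
  show ?thesis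
  proof
    assume "((\<lambda>n. L_hat L (f n) / L_hat L (g n)) \<longlongrightarrow> c) F"
    from Lim_transform_eventually[OF tendsto_mult[OF q' this] B'] show "((\<lambda>n. U (f n) / U (g n)) \<longlongrightarrow> c) F" by simp
  next
    assume "((\<lambda>n. U (f n) / U (g n)) \<longlongrightarrow> c) F"
    from Lim_transform_eventually[OF tendsto_mult[OF q this] B] show "((\<lambda>n. L_hat L (f n) / L_hat L (g n)) \<longlongrightarrow> c) F" by simp
  qed
qed

lemma slowly_varying_L_hat: "slowly_varying (L_hat L)"
  unfolding slowly_varying_def
proof (intro conjI allI impI)
  have "\<forall>\<^sub>F t in at_top. set_integrable lebesgue {t..} (\<lambda>y. L y / y) \<and> 0 < L_hat L t \<and> 0 < L t \<and> 0 < t"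
    using L_over_x_integrable L_hat_pos L_pos eventually_gt_at_top[of 0] by eventually_elim simp
  then obtain a where a: "\<And>t. a \<le> t \<Longrightarrow> set_integrable lebesgue {t..} (\<lambda>y. L y / y) \<and> 0 < L_hat L t \<and> 0 < L t \<and> 0 < t"
    unfolding eventually_at_top_linorder by blast
  have "L_hat L t \<le> L_hat L s" if st: "a \<le> s" "s \<le> t" for s t
    unfolding L_hat_def set_lebesgue_integral_def
  proof (rule integral_mono)
    show "integrable lebesgue (\<lambda>y. indicat_real {t..} y *\<^sub>R (L y / y))"
      using a[of t] st by (simp add: set_integrable_def)
    show "integrable lebesgue (\<lambda>y. indicat_real {s..} y *\<^sub>R (L y / y))"
      using a[of s] st by (simp add: set_integrable_def)
    fix y
    show "indicat_real {t..} y *\<^sub>R (L y / y) \<le> indicat_real {s..} y *\<^sub>R (L y / y)"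
      using a[of y] st by (auto simp: indicator_def)
  qed
  \<comment> \<open>\<open>L_hat L\<close> decreases where L is positive, and its measurability is
    deduced from this monotonicity.\<close>
  then have "mono_on {a..} (\<lambda>t. - L_hat L t)" by (intro mono_onI) auto
  then have "(\<lambda>t. - L_hat L t) \<in> borel_measurable (restrict_space borel {a..})" by (rule borel_measurable_mono_on_fnc)
  then have "(\<lambda>t. - (- L_hat L t)) \<in> borel_measurable (restrict_space borel {a..})" by (rule borel_measurable_uminus)
  then have "(\<lambda>t. indicat_real {a..} t *\<^sub>R L_hat L t) \<in> borel_measurable borel"
    by (simp add: borel_measurable_restrict_space_iff)
  then have "(\<lambda>t. indicat_real {a..} t *\<^sub>R L_hat L t) \<in> borel_measurable lebesgue"
    by (intro measurable_completion) simp
  then have "L_hat L \<in> borel_measurable (lebesgue_on {a..})"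
    by (subst borel_measurable_restrict_space_iff) auto
  then show "\<exists>a. L_hat L \<in> borel_measurable (lebesgue_on {a..}) \<and> (\<forall>t\<ge>a. 0 < L_hat L t)"
    using a by blast
  fix c :: real assume c: "0 < c"
  have fl: "filterlim (\<lambda>t. c * t) at_top at_top"
    by (rule filterlim_tendsto_pos_mult_at_top[OF tendsto_const c filterlim_ident])
  show "((\<lambda>t. L_hat L (c * t) / L_hat L t) \<longlongrightarrow> 1) at_top"
    unfolding L_hat_ratio_transfer[OF fl filterlim_ident] by (rule U_slowly_varying[OF c])
qed

lemma star_condition_U:
  assumes "0 < \<gamma>"
  shows "star_condition L \<gamma> \<longleftrightarrow>
    (\<lambda>n::nat. U (exp (real (n + 1) powr (1 + \<gamma>))) / U (exp (real n powr (1 + \<gamma>)))) \<longlonglongrightarrow> 0"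
  unfolding star_condition_def
  by (rule L_hat_ratio_transfer) (use assms in real_asymp)+

end

end

section \<open>Reduction of the hypothesis on L to regular variation of \<rho>\<close>

lemma regular_pmf_of_slowly_varying:
  assumes inf: "infinite (set_pmf p)" and sv: "slowly_varying L"
    and asymp: "(\<lambda>t. real (\<rho> p t)) \<sim>[at_top] (\<lambda>t. t * L t)"
  shows "regular_pmf p" "((\<lambda>t. real (\<rho> p t) / (t * L t)) \<longlongrightarrow> 1) at_top"
proof -
  have Lpos: "\<forall>\<^sub>F t in at_top. 0 < L t"
    using sv unfolding slowly_varying_def eventually_at_top_linorder by blast
  \<comment> \<open>Asymptotic equivalence reads 0/0 as 1; since \<open>t * L t\<close> is
    eventually positive, this convention can be removed.\<close>
  have B: "\<forall>\<^sub>F t in at_top. (if real (\<rho> p t) = 0 \<and> t * L t = 0 then 1 else real (\<rho> p t) / (t * L t)) = real (\<rho> p t) / (t * L t)"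
    using Lpos eventually_gt_at_top[of 0] by eventually_elim simp
  show q: "((\<lambda>t. real (\<rho> p t) / (t * L t)) \<longlongrightarrow> 1) at_top"
    by (rule Lim_transform_eventually[OF asymp_equivD[OF asymp] B])
  show "regular_pmf p"
  proof
    show "infinite (set_pmf p)" by (rule inf)
    fix c :: real assume c: "0 < c"
    have fl: "filterlim (\<lambda>t. c * t) at_top at_top"
      by (rule filterlim_tendsto_pos_mult_at_top[OF tendsto_const c filterlim_ident])
    have Lc: "((\<lambda>t. L (c * t) / L t) \<longlongrightarrow> 1) at_top" using sv c unfolding slowly_varying_def by blast
    have A: "((\<lambda>t. real (\<rho> p (c * t)) / (c * t * L (c * t)) * (c * (L (c * t) / L t)) / (real (\<rho> p t) / (t * L t)))
        \<longlongrightarrow> 1 * (c * 1) / 1) at_top"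
      by (intro tendsto_intros q Lc filterlim_compose[OF q fl]) simp
    have B: "\<forall>\<^sub>F t in at_top. real (\<rho> p (c * t)) / (c * t * L (c * t)) * (c * (L (c * t) / L t)) / (real (\<rho> p t) / (t * L t))
        = real (\<rho> p (c * t)) / real (\<rho> p t)"
      using Lpos eventually_compose_filterlim[OF Lpos fl] eventually_gt_at_top[of 0]
      by eventually_elim (use c in simp)
    from Lim_transform_eventually[OF A B] show "((\<lambda>t. real (\<rho> p (c * t)) / real (\<rho> p t)) \<longlongrightarrow> c) at_top" by simp
  qed
qed

theorem theorem1p5:
  fixes M :: "'a measure" and p :: "nat pmf"
    and S :: "nat \<Rightarrow> 'a \<Rightarrow> real" and X :: "nat \<Rightarrow> 'a \<Rightarrow> nat"
    and L :: "real \<Rightarrow> real"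
  assumes scheme: "poissonized_karlin_scheme M p S X"
    and L_sv: "slowly_varying L"
    and rho_asymp: "(\<lambda>t. real (\<rho> p t)) \<sim>[at_top] (\<lambda>t. t * L t)"
  shows
    "(\<forall>j\<ge>2.
        (AE \<omega> in M. Limsup at_top (\<lambda>t. ereal (lil_ratio M (K_star S X j) t \<omega>)) = ereal (sqrt 2)) \<and>
        (\<lambda>t. prob_space.expectation M (K_star S X j t))
          \<sim>[at_top] (\<lambda>t. 1 / (real j * (real j - 1)) * (t * L t)) \<and>
        ((\<lambda>t. prob_space.variance M (K_star S X j t) / (t * L t)) \<longlongrightarrow>
           1 / (real j * (real j - 1)) - fact (2 * j - 2) / (2 ^ (2 * j - 1) * (fact j)\<^sup>2)) at_top)
     \<and> (\<forall>\<^sub>F t in at_top. set_integrable lebesgue {t..} (\<lambda>y. L y / y))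
     \<and> slowly_varying (L_hat L)
     \<and> ((\<lambda>t. L t / L_hat L t) \<longlongrightarrow> 0) at_top
     \<and> ((\<forall>\<^sub>F \<gamma> in at_right 0. star_condition L \<gamma>) \<longrightarrow>
          (AE \<omega> in M. Limsup at_top (\<lambda>t. ereal (lil_ratio M (K_star S X 1) t \<omega>)) = ereal (sqrt 2)))
     \<and> (\<not> (\<forall>\<^sub>F \<gamma> in at_right 0. star_condition L \<gamma>) \<longrightarrow>
          (AE \<omega> in M. Limsup at_top (\<lambda>t. ereal (lil_ratio M (K_star S X 1) t \<omega>)) \<le> ereal (sqrt 2)) \<and>
          (AE \<omega> in M. Liminf at_top (\<lambda>t. ereal (lil_ratio M (K_star S X 1) t \<omega>)) \<ge> ereal (- sqrt 2)))
     \<and> (\<lambda>t. prob_space.variance M (K_star S X 1 t))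
          \<sim>[at_top] (\<lambda>t. prob_space.expectation M (K_star S X 1 t))
     \<and> (\<lambda>t. prob_space.expectation M (K_star S X 1 t)) \<sim>[at_top] (\<lambda>t. t * L_hat L t)"
proof -
  interpret poissonized_karlin_scheme M p S X by (rule scheme)
  interpret regular_pmf p by (rule regular_pmf_of_slowly_varying(1)[OF infinite_support L_sv rho_asymp])
  interpret karlin_regular M p S X ..
  have RL: "((\<lambda>t. R t / (t * L t)) \<longlongrightarrow> 1) at_top"
    by (rule regular_pmf_of_slowly_varying(2)[OF infinite_support L_sv rho_asymp])
  have asymp_ge2: "(\<lambda>t. expectation (K_star S X j t)) \<sim>[at_top] (\<lambda>t. 1 / (real j * (real j - 1)) * (t * L t))"
    if j: "2 \<le> j" for j
  proof (rule asymp_equivI')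
    have A: "((\<lambda>t. real j * (real j - 1) * (weight_mean p j t / R t * (R t / (t * L t)))) \<longlongrightarrow>
        real j * (real j - 1) * (1 / (real j * (real j - 1)) * 1)) at_top"
      by (intro tendsto_intros weight_mean_asymp RL j)
    have B: "\<forall>\<^sub>F t in at_top. real j * (real j - 1) * (weight_mean p j t / R t * (R t / (t * L t))) =
        expectation (K_star S X j t) / (1 / (real j * (real j - 1)) * (t * L t))"
      using R_pos eventually_gt_at_top[of 0] by eventually_elim (use j in \<open>simp add: expectation_K_star\<close>)
    from Lim_transform_eventually[OF A B]
    show "((\<lambda>t. expectation (K_star S X j t) / (1 / (real j * (real j - 1)) * (t * L t))) \<longlongrightarrow> 1) at_top"
      using j by simp
  qed
  have var_ge2: "((\<lambda>t. variance (K_star S X j t) / (t * L t)) \<longlongrightarrow>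
      1 / (real j * (real j - 1)) - fact (2 * j - 2) / (2 ^ (2 * j - 1) * (fact j)\<^sup>2)) at_top"
    if j: "2 \<le> j" for j
  proof -
    have A: "((\<lambda>t. weight_var p j t / R t * (R t / (t * L t))) \<longlongrightarrow> var_const j * 1) at_top"
      by (intro tendsto_mult weight_var_asymp RL j)
    have B: "\<forall>\<^sub>F t in at_top. weight_var p j t / R t * (R t / (t * L t)) = variance (K_star S X j t) / (t * L t)"
      using R_pos eventually_gt_at_top[of 0]
    proof eventually_elim
      case (elim t)
      then show ?case using j unfolding variance_K_star[OF elim(2), of j] by (subst variance_K_star) auto
    qed
    from Lim_transform_eventually[OF A B] show ?thesis by (simp only: var_const_def mult_1_right)
  qed
  have tU: "\<forall>\<^sub>F t in at_top. 0 < t * U t" using U_pos eventually_gt_at_top[of 0] by eventually_elim simp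
  have mean1: "\<forall>\<^sub>F t in at_top. expectation (K_star S X 1 t) = weight_mean p 1 t"
    using eventually_gt_at_top[of 0] by eventually_elim (rule expectation_K_star, auto)
  have var1: "\<forall>\<^sub>F t in at_top. variance (K_star S X 1 t) = weight_var p 1 t"
    using eventually_gt_at_top[of 0] by eventually_elim (rule variance_K_star, auto)
  have m1: "((\<lambda>t. weight_mean p 1 t / (t * U t)) \<longlongrightarrow> 1) at_top" unfolding weight_mean_1 by (rule occ1_mean_asymp)
  have var_mean: "(\<lambda>t. variance (K_star S X 1 t)) \<sim>[at_top] (\<lambda>t. expectation (K_star S X 1 t))"
  proof (rule asymp_equivI')
    have A: "((\<lambda>t. (weight_var p 1 t / (t * U t)) / (weight_mean p 1 t / (t * U t))) \<longlongrightarrow> 1 / 1) at_top"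
      by (intro tendsto_divide weight_var_1_asymp m1) simp
    have B: "\<forall>\<^sub>F t in at_top. (weight_var p 1 t / (t * U t)) / (weight_mean p 1 t / (t * U t)) =
        variance (K_star S X 1 t) / expectation (K_star S X 1 t)"
      using tU mean1 var1
    proof eventually_elim
      case (elim t)
      have g: "(a / c) / (b / c) = a / b" if "c \<noteq> 0" for a b c :: real using that by simp
      have "t * U t \<noteq> 0" using elim(1) by (rule less_imp_neq[symmetric])
      then show ?case unfolding elim(3) unfolding elim(2) by (rule g)
    qed
    from Lim_transform_eventually[OF A B]
    show "((\<lambda>t. variance (K_star S X 1 t) / expectation (K_star S X 1 t)) \<longlongrightarrow> 1) at_top" by simp
  qed
  have mean_L_hat: "(\<lambda>t. expectation (K_star S X 1 t)) \<sim>[at_top] (\<lambda>t. t * L_hat L t)"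
  proof (rule asymp_equivI')
    have A: "((\<lambda>t. (weight_mean p 1 t / (t * U t)) / (L_hat L t / U t)) \<longlongrightarrow> 1 / 1) at_top"
      by (intro tendsto_divide m1 L_hat_U[OF L_sv RL]) simp
    have B: "\<forall>\<^sub>F t in at_top. (weight_mean p 1 t / (t * U t)) / (L_hat L t / U t) =
        expectation (K_star S X 1 t) / (t * L_hat L t)"
      using U_pos mean1 by eventually_elim simp
    from Lim_transform_eventually[OF A B]
    show "((\<lambda>t. expectation (K_star S X 1 t) / (t * L_hat L t)) \<longlongrightarrow> 1) at_top" by simp
  qed
  have lil1: "AE \<omega> in M. Limsup at_top (\<lambda>t. ereal (lil_ratio M (K_star S X 1) t \<omega>)) = ereal (sqrt 2)"
    if star: "\<forall>\<^sub>F \<gamma> in at_right 0. star_condition L \<gamma>"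
  proof (rule AE_lil_eq[OF order_refl lower_lil_1])
    have "\<forall>\<^sub>F \<gamma> in at_right 0.
      (\<lambda>n::nat. U (exp (real (n + 1) powr (1 + \<gamma>))) / U (exp (real n powr (1 + \<gamma>)))) \<longlonglongrightarrow> 0"
      using star eventually_at_right_less[of "0::real"]
      by eventually_elim (simp only: star_condition_U[OF L_sv RL])
    then show "\<exists>\<^sub>F \<gamma> in at_right 0.
      (\<lambda>n::nat. U (exp (real (n + 1) powr (1 + \<gamma>))) / U (exp (real n powr (1 + \<gamma>)))) \<longlonglongrightarrow> 0"
      by (rule eventually_frequently[OF trivial_limit_at_right_real])
  qed
  show ?thesis
    using AE_lil_eq[OF _ lower_lil_ge2] asymp_ge2 var_ge2 L_over_x_integrable[OF L_sv RL]
      slowly_varying_L_hat[OF L_sv RL] L_over_L_hat[OF L_sv RL] lil1 AE_lil_upper[of 1] var_mean mean_L_hat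
    by (intro conjI allI impI) auto
qed

end
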